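(* Let $\varepsilon,\mu,\omega>0$, $k=\omega\sqrt{\varepsilon\mu}$. Let $S_1$ and $S_2$ be two planar screens in $\mathbb{R}^3$ contained in supporting hyperplanes $\pi_1$ and $\pi_2$ respectively. Let $u_1=(e_1,h_1)$ and $u_2=(e_2,h_2)$ be the scattering solutions for the perfectly conducting screens $S_1$ and $S_2$ corresponding to the same initial (incident) field, and assume that they have equal non-vanishing far fields. Then $\pi_1=\pi_2$.
   Context: Screens. A planar $C^j$-screen, $j=1,\dots,\infty$, is a compact, connected, two-dimensional $C^j$-submanifold $S$ (with boundary $\partial S$) of an affine hyperplane in $\mathbb{R}^3$; that hyperplane is its supporting hyperplane. A unit normal $\nu$ of $S$ is fixed. Spaces and traces. $L^2_{\rm loc,curl}(\mathbb{R}^3\setminus S)$ is the space of vector fields $u$ on $\mathbb{R}^3\setminus S$ with $u$ and $\nabla\times u$ square integrable on $(\mathbb{R}^3\setminus S)\cap B_R(0)$ for every large $R$; such $u$ has tangential traces $\nu\times u^\pm$ on $S$ from the sides $\pm\nu$, in the tangential $H^{-1/2}$ fields, defined through Green's identity. Scattering solutions. An incident (initial) field is a solution $(E_0,H_0)$ in $\mathbb{R}^3$ of $\nabla\times E_0=i\omega\mu H_0$, $\nabla\times H_0=-i\omega\varepsilon E_0$. The scattering solution for the perfectly conducting screen $S$ is the scattered field $(e,h)\in L^2_{\rm loc,curl}(\mathbb{R}^3\setminus S)^2$ satisfying $\nabla\times e=i\omega\mu h$, $\nabla\times h=-i\omega\varepsilon e$ in $\mathbb{R}^3\setminus S$; the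 boundary condition $\nu\times(e+E_0)=0$ on $S$ (traces from both sides); and the outgoing Silver–Müller radiation conditions $$\hat r\times e-\sqrt{\mu/\varepsilon}\;h=o(|x|^{-1}),\qquad \hat r\times h+\sqrt{\varepsilon/\mu}\;e=o(|x|^{-1}),\qquad |x|\to\infty,\ \hat r=x/|x| .$$ Far fields. The far field of $(e,h)$ is the pair $(E^\infty,H^\infty)$ on the unit sphere with $e(x)=\frac{e^{ik|x|}}{4\pi|x|}E^\infty(\hat x)+O(|x|^{-2})$ and $h(x)=\frac{e^{ik|x|}}{4\pi|x|}H^\infty(\hat x)+O(|x|^{-2})$ as $|x|\to\infty$, $\hat x=x/|x|$; non-vanishing means not identically zero. *)

theory Defs
  imports "HOL-Analysis.Analysis" "HOL-Library.Landau_Symbols"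
begin

section \<open>Planar screens\<close>

(* Only meant for open U, where differentiability at each point and continuity of the iterated
   directional derivatives is the usual notion of being n times continuously differentiable. *)
fun Ck_on :: "nat \<Rightarrow> ('a::euclidean_space \<Rightarrow> 'b::euclidean_space) \<Rightarrow> 'a set \<Rightarrow> bool" where
  "Ck_on 0 f U \<longleftrightarrow> continuous_on U f"
| "Ck_on (Suc n) f U \<longleftrightarrow>
     (\<forall>x\<in>U. f differentiable (at x)) \<and> (\<forall>v. Ck_on n (\<lambda>x. frechet_derivative f (at x) v) U)"

definition Cj_on :: "enat \<Rightarrow> ('a::euclidean_space \<Rightarrow> 'b::euclidean_space) \<Rightarrow> 'a set \<Rightarrow> bool" where
  "Cj_on j f U \<longleftrightarrow> (\<forall>n. enat n \<le> j \<longrightarrow> Ck_on n f U)"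

definition unit_normal :: "(real^3) set \<Rightarrow> real^3 \<Rightarrow> bool" where
  "unit_normal P \<nu> \<longleftrightarrow> norm \<nu> = 1 \<and> (\<exists>c. P = {x. \<nu> \<bullet> x = c})"

(* A C^j parametrization of a relatively open piece of the plane P, i.e. the inverse of a chart. *)
definition plane_param :: "enat \<Rightarrow> (real^3) set \<Rightarrow> (real^2) set \<Rightarrow> (real^2 \<Rightarrow> real^3) \<Rightarrow> bool" where
  "plane_param j P V \<psi> \<longleftrightarrow>
     open V \<and> openin (top_of_set P) (\<psi> ` V) \<and>
     (\<exists>\<phi>. homeomorphism V (\<psi> ` V) \<psi> \<phi>) \<and>
     Cj_on j \<psi> V \<and> (\<forall>y\<in>V. inj (frechet_derivative \<psi> (at y)))"

(* Each point has a chart flattening S to the half-plane y2 >= 0.  Interior points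
   are covered by charts whose domain V lies inside the half-plane. *)
definition plane_submanifold_with_boundary :: "enat \<Rightarrow> (real^3) set \<Rightarrow> (real^3) set \<Rightarrow> bool" where
  "plane_submanifold_with_boundary j P S \<longleftrightarrow>
     S \<subseteq> P \<and>
     (\<forall>p\<in>S. \<exists>V \<psi>. plane_param j P V \<psi> \<and> p \<in> \<psi> ` V \<and> S \<inter> \<psi> ` V = \<psi> ` {y\<in>V. 0 \<le> y $ 2})"

definition planar_screen :: "enat \<Rightarrow> (real^3) set \<Rightarrow> (real^3) set \<Rightarrow> real^3 \<Rightarrow> bool" where
  "planar_screen j S P \<nu> \<longleftrightarrow>
     1 \<le> j \<and> unit_normal P \<nu> \<and> S \<noteq> {} \<and> compact S \<and> connected S \<and>
     plane_submanifold_with_boundary j P S"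


section \<open>Complex vector fields on three-space\<close>

type_synonym field3 = "real^3 \<Rightarrow> complex^3"

definition cvec :: "real^3 \<Rightarrow> complex^3" where
  "cvec v = (\<chi> i. complex_of_real (v $ i))"

(* Bilinear, not the Hermitian product. *)
definition cdot :: "complex^3 \<Rightarrow> complex^3 \<Rightarrow> complex" where
  "cdot a b = (\<Sum>i\<in>UNIV. a $ i * b $ i)"

definition ccross :: "complex^3 \<Rightarrow> complex^3 \<Rightarrow> complex^3" where
  "ccross a b = vector [a $ 2 * b $ 3 - a $ 3 * b $ 2,
                        a $ 3 * b $ 1 - a $ 1 * b $ 3,
                        a $ 1 * b $ 2 - a $ 2 * b $ 1]"

definition partial :: "3 \<Rightarrow> field3 \<Rightarrow> field3" where
  "partial i \<phi> x = frechet_derivative \<phi> (at x) (axis i 1)"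

definition curl :: "field3 \<Rightarrow> field3" where
  "curl \<phi> x = vector [partial 2 \<phi> x $ 3 - partial 3 \<phi> x $ 2,
                      partial 3 \<phi> x $ 1 - partial 1 \<phi> x $ 3,
                      partial 1 \<phi> x $ 2 - partial 2 \<phi> x $ 1]"

definition test_field :: "(real^3) set \<Rightarrow> field3 \<Rightarrow> bool" where
  "test_field U \<phi> \<longleftrightarrow>
     Cj_on \<infinity> \<phi> UNIV \<and> compact (closure {x. \<phi> x \<noteq> 0}) \<and> closure {x. \<phi> x \<noteq> 0} \<subseteq> U"

definition square_integrable :: "(real^3) set \<Rightarrow> field3 \<Rightarrow> bool" where
  "square_integrable A u \<longleftrightarrow>
     u \<in> borel_measurable (lebesgue_on A) \<and> integrable (lebesgue_on A) (\<lambda>x. (norm (u x))\<^sup>2)"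

(* Local at infinity only: integrability is required up to the boundary of U. *)
definition L2_loc :: "(real^3) set \<Rightarrow> field3 \<Rightarrow> bool" where
  "L2_loc U u \<longleftrightarrow> (\<forall>\<^sub>F R in at_top. square_integrable (U \<inter> ball 0 R) u)"

definition has_weak_curl :: "(real^3) set \<Rightarrow> field3 \<Rightarrow> field3 \<Rightarrow> bool" where
  "has_weak_curl U u w \<longleftrightarrow>
     (\<forall>\<phi>. test_field U \<phi> \<longrightarrow>
        (LINT x|lebesgue_on U. cdot (u x) (curl \<phi> x)) = (LINT x|lebesgue_on U. cdot (w x) (\<phi> x)))"

definition L2_loc_curl :: "(real^3) set \<Rightarrow> field3 set" where
  "L2_loc_curl U = {u. L2_loc U u \<and> (\<exists>w. L2_loc U w \<and> has_weak_curl U u w)}"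


section \<open>Tangential traces on a screen\<close>

definition plane_side :: "(real^3) set \<Rightarrow> real^3 \<Rightarrow> real \<Rightarrow> (real^3) set" where
  "plane_side P \<nu> \<sigma> = {x. \<forall>p\<in>P. 0 < \<sigma> * (\<nu> \<bullet> (x - p))}"

(* Test fields that meet the plane only inside the interior of S; their restrictions to S
   are the compactly supported smooth fields on the interior, which are dense in the predual
   of the space H^(-1/2) on S.  Note rel_interior S = S minus its manifold boundary. *)
definition screen_test_field :: "(real^3) set \<Rightarrow> (real^3) set \<Rightarrow> field3 \<Rightarrow> bool" where
  "screen_test_field S P \<Phi> \<longleftrightarrow>
     test_field UNIV \<Phi> \<and> closure {x. \<Phi> x \<noteq> 0} \<inter> P \<subseteq> rel_interior S"

definition tangential_restriction :: "(real^3) set \<Rightarrow> real^3 \<Rightarrow> field3 \<Rightarrow> field3" where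
  "tangential_restriction S \<nu> \<Phi> x =
     (if x \<in> S then \<Phi> x - cdot (cvec \<nu>) (\<Phi> x) *s cvec \<nu> else 0)"

(* T is the trace \<nu> \<times> u on S from the side \<sigma>\<nu> (\<sigma> = 1 or -1), as a distribution acting on
   tangential fields on S.  Green's identity on D = plane_side P \<nu> \<sigma> reads
     integral over D of (curl u . \<Phi> - u . curl \<Phi>) = integral over P of (n \<times> u) . \<Phi>,
   where n = -\<sigma> \<nu> is the unit normal pointing out of D. *)
definition has_tangential_trace ::
    "(real^3) set \<Rightarrow> (real^3) set \<Rightarrow> real^3 \<Rightarrow> real \<Rightarrow> field3 \<Rightarrow> (field3 \<Rightarrow> complex) \<Rightarrow> bool" where
  "has_tangential_trace S P \<nu> \<sigma> u T \<longleftrightarrow>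
     (\<exists>w. L2_loc (- S) w \<and> has_weak_curl (- S) u w \<and>
        (\<forall>\<Phi>. screen_test_field S P \<Phi> \<longrightarrow>
           T (tangential_restriction S \<nu> \<Phi>) =
             - of_real \<sigma> * (LINT x|lebesgue_on (plane_side P \<nu> \<sigma>).
                 cdot (w x) (\<Phi> x) - cdot (u x) (curl \<Phi> x))))"


section \<open>Scattering by a perfectly conducting screen\<close>

definition maxwell :: "real \<Rightarrow> real \<Rightarrow> real \<Rightarrow> (real^3) set \<Rightarrow> field3 \<Rightarrow> field3 \<Rightarrow> bool" where
  "maxwell \<epsilon> \<mu> \<omega> U E H \<longleftrightarrow>
     E \<in> L2_loc_curl U \<and> H \<in> L2_loc_curl U \<and>
     has_weak_curl U E (\<lambda>x. (\<i> * of_real (\<omega> * \<mu>)) *s H x) \<and>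
     has_weak_curl U H (\<lambda>x. - ((\<i> * of_real (\<omega> * \<epsilon>)) *s E x))"

definition incident_field :: "real \<Rightarrow> real \<Rightarrow> real \<Rightarrow> field3 \<Rightarrow> field3 \<Rightarrow> bool" where
  "incident_field \<epsilon> \<mu> \<omega> E\<^sub>0 H\<^sub>0 \<longleftrightarrow> maxwell \<epsilon> \<mu> \<omega> UNIV E\<^sub>0 H\<^sub>0"

(* The fields are only determined up to null sets, so asymptotics as |x| tends to infinity
   (uniform in all directions) are understood for almost every x. *)
definition ae_at_infinity :: "(real^3) filter" where
  "ae_at_infinity = inf at_infinity (ae_filter lebesgue)"

definition silver_mueller :: "real \<Rightarrow> real \<Rightarrow> field3 \<Rightarrow> field3 \<Rightarrow> bool" where
  "silver_mueller \<epsilon> \<mu> e h \<longleftrightarrow>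
     (\<lambda>x. norm (ccross (cvec (x /\<^sub>R norm x)) (e x) - of_real (sqrt (\<mu> / \<epsilon>)) *s h x))
        \<in> o[ae_at_infinity](\<lambda>x. 1 / norm x) \<and>
     (\<lambda>x. norm (ccross (cvec (x /\<^sub>R norm x)) (h x) + of_real (sqrt (\<epsilon> / \<mu>)) *s e x))
        \<in> o[ae_at_infinity](\<lambda>x. 1 / norm x)"

definition scattering_solution ::
    "real \<Rightarrow> real \<Rightarrow> real \<Rightarrow> (real^3) set \<Rightarrow> (real^3) set \<Rightarrow> real^3 \<Rightarrow>
     field3 \<Rightarrow> field3 \<Rightarrow> field3 \<Rightarrow> bool" where
  "scattering_solution \<epsilon> \<mu> \<omega> S P \<nu> E\<^sub>0 e h \<longleftrightarrow>
     maxwell \<epsilon> \<mu> \<omega> (- S) e h \<and>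
     (\<forall>\<sigma>\<in>{1, -1}. has_tangential_trace S P \<nu> \<sigma> (\<lambda>x. e x + E\<^sub>0 x) (\<lambda>_. 0)) \<and>
     silver_mueller \<epsilon> \<mu> e h"

definition far_field_pattern :: "real \<Rightarrow> field3 \<Rightarrow> field3 \<Rightarrow> bool" where
  "far_field_pattern k e F \<longleftrightarrow>
     (\<lambda>x. norm (e x - (exp (\<i> * of_real (k * norm x)) / of_real (4 * pi * norm x)) *s F (x /\<^sub>R norm x)))
        \<in> O[ae_at_infinity](\<lambda>x. 1 / (norm x)\<^sup>2)"

(* The expansion holds almost everywhere and hence fixes the far field only up to null sets of
   directions; continuity selects the (automatically existing) regular representative, so that
   pointwise statements such as being not identically zero are meaningful. *)
definition far_field :: "real \<Rightarrow> field3 \<Rightarrow> field3 \<Rightarrow> field3 \<Rightarrow> field3 \<Rightarrow> bool" where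
  "far_field k e h Einf Hinf \<longleftrightarrow>
     continuous_on (sphere 0 1) Einf \<and> continuous_on (sphere 0 1) Hinf \<and>
     far_field_pattern k e Einf \<and> far_field_pattern k h Hinf"

end

theory Submission
  imports Defs
begin

text \<open>Every Cartesian component of the fields is a weak solution of the Helmholtz equation off the
  screens.  The difference of the two scattered fields has vanishing far field, so it vanishes near
  infinity by Rellich's lemma, and then almost everywhere by unique continuation along lines parallel to
  both planes.  Hence a single field solves Maxwell's equations off \<open>S\<^sub>1\<close> and off \<open>S\<^sub>2\<close>.  If the planes
  differ, \<open>S\<^sub>1 \<inter> S\<^sub>2\<close> lies in a line, which is removable for locally square integrable fields, so the
  field is an entire outgoing solution and is zero, contradicting the non-vanishing of its far field.

  Rellich's lemma, unique continuation across spheres and the vanishing of entire outgoing solutions are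
  obtained together, without elliptic regularity, by testing with \<open>(a \<bullet> (x - c))^l h(|x - c|\<^sup>2)\<close>: in the
  variable \<open>s = |x - c|\<^sup>2\<close> the Helmholtz operator acts on \<open>h\<close> as a second order operator whose
  \<open>l\<close>-dependence is removed by differentiation in \<open>s\<close>, so that all moments reduce to the
  one-dimensional equation \<open>y'' + k\<^sup>2 y = G\<close>.\<close>

section \<open>Closure rules for functions smooth in the sense of iterated directional
  derivatives\<close>

section \<open>Calculus of smooth functions\<close>

text \<open>The fields are known only up to null sets and have no regularity beyond local square
  integrability, so every conclusion is extracted from integrals against explicit test functions.
  The key is the commutation d/ds L_c = L_(c+4) d/ds for L_c = 4 s d^2/ds^2 + c d/ds + k^2: from c =
  2, where exp(i k r) and exp(-i k r) with r = sqrt s are the solutions, l + 1 derivatives lead to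
  solutions for c = 4 l + 6. This is Rayleigh's formula, and it replaces the theory of spherical
  Hankel functions. The three analytic statements differ in the end of the radial solution that has
  to be controlled. Near a centre where the field vanishes a cutoff costs nothing. At infinity the
  product of two outgoing waves carries exp(2 i k r) and averages out, whereas outgoing times
  incoming does not oscillate; so either the far field is zero, or the incoming part is cancelled by
  cos(k r), which is smooth through the centre. Flatness of the screens enters twice: translation
  along a common direction keeps the distances to both planes fixed, and distinct planes meet at
  most in a line, a set of codimension two.\<close>

definition smooth_on :: "('a::euclidean_space \<Rightarrow> 'b::euclidean_space) \<Rightarrow> 'a set \<Rightarrow> bool" where
  "smooth_on f U \<longleftrightarrow> (\<forall>n. Ck_on n f U)"

lemma Cj_on_infinity_iff: "Cj_on \<infinity> f U \<longleftrightarrow> smooth_on f U"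
  by (simp add: Cj_on_def smooth_on_def)

lemma Ck_on_imp_continuous_on: "Ck_on n f U \<Longrightarrow> continuous_on U f"
  by (cases n) (auto intro!: continuous_at_imp_continuous_on differentiable_imp_continuous_within)

lemma Ck_on_Suc_imp: "Ck_on (Suc n) f U \<Longrightarrow> Ck_on n f U"
proof (induction n arbitrary: f)
  case 0
  then show ?case using Ck_on_imp_continuous_on[OF 0] by simp
next
  case (Suc n)
  then show ?case by (metis Ck_on.simps(2))
qed

lemma Ck_on_cong:
  assumes "open U" "\<And>x. x \<in> U \<Longrightarrow> f x = g x"
  shows "Ck_on n f U \<longleftrightarrow> Ck_on n g U"
  using assms(2)
proof (induction n arbitrary: f g)
  case 0
  then show ?case by (simp cong: continuous_on_cong)
next
  case (Suc n)
  have hd: "(f has_derivative F) (at x) \<longleftrightarrow> (g has_derivative F) (at x)" if "x \<in> U" for F x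
    using has_derivative_transform_within_open[OF _ \<open>open U\<close> that] Suc.prems by metis
  then have d: "f differentiable (at x) \<longleftrightarrow> g differentiable (at x)" if "x \<in> U" for x
    using that by (auto simp: differentiable_def)
  have fd: "frechet_derivative f (at x) = frechet_derivative g (at x)" if "x \<in> U" for x
    using hd[OF that] by (simp add: frechet_derivative_def)
  have "Ck_on n (\<lambda>x. frechet_derivative f (at x) v) U
      \<longleftrightarrow> Ck_on n (\<lambda>x. frechet_derivative g (at x) v) U" for v
    by (rule Suc.IH) (simp add: fd)
  then show ?case using d by auto
qed

lemma Ck_on_SucI:
  assumes "open U" "\<And>x. x \<in> U \<Longrightarrow> (f has_derivative f' x) (at x)"
    and "\<And>v. Ck_on n (\<lambda>x. f' x v) U"
  shows "Ck_on (Suc n) f U"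
proof -
  have "Ck_on n (\<lambda>x. frechet_derivative f (at x) v) U" for v
    using Ck_on_cong[OF assms(1), of "\<lambda>x. frechet_derivative f (at x) v" "\<lambda>x. f' x v" n] assms(3)
    by (metis assms(2) frechet_derivative_at)
  then show ?thesis using assms(2) by (auto simp: differentiable_def)
qed

lemma smooth_on_cong:
  assumes "open U" "\<And>x. x \<in> U \<Longrightarrow> f x = g x"
  shows "smooth_on f U \<longleftrightarrow> smooth_on g U"
  using Ck_on_cong[OF assms] by (simp add: smooth_on_def)

lemma smooth_on_differentiable: "smooth_on f U \<Longrightarrow> x \<in> U \<Longrightarrow> f differentiable (at x)"
  unfolding smooth_on_def using Ck_on.simps(2) by blast

lemma smooth_on_frechet: "smooth_on f U \<Longrightarrow> smooth_on (\<lambda>x. frechet_derivative f (at x) v) U"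
  unfolding smooth_on_def using Ck_on.simps(2) by blast

lemma smooth_on_continuous: "smooth_on f U \<Longrightarrow> continuous_on U f"
  unfolding smooth_on_def using Ck_on_imp_continuous_on by blast

lemma smooth_onI:
  assumes "open U" "\<And>x. x \<in> U \<Longrightarrow> (f has_derivative f' x) (at x)"
    and "\<And>v. smooth_on (\<lambda>x. f' x v) U"
  shows "smooth_on f U"
  unfolding smooth_on_def
proof
  fix n show "Ck_on n f U"
    using Ck_on_SucI[OF assms(1,2)] assms(3) Ck_on_Suc_imp unfolding smooth_on_def by blast
qed

lemma Ck_on_subset: "Ck_on n f U \<Longrightarrow> V \<subseteq> U \<Longrightarrow> Ck_on n f V"
  by (induction n arbitrary: f) (auto intro: continuous_on_subset)

lemma smooth_on_subset: "smooth_on f U \<Longrightarrow> V \<subseteq> U \<Longrightarrow> smooth_on f V"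
  unfolding smooth_on_def using Ck_on_subset by blast

lemma Ck_on_Un:
  assumes "open U" "open V"
  shows "Ck_on n f U \<Longrightarrow> Ck_on n f V \<Longrightarrow> Ck_on n f (U \<union> V)"
  by (induction n arbitrary: f) (use assms in \<open>auto intro: continuous_on_open_Un\<close>)

lemma smooth_on_Un:
  "smooth_on f U \<Longrightarrow> smooth_on f V \<Longrightarrow> open U \<Longrightarrow> open V \<Longrightarrow> smooth_on f (U \<union> V)"
  unfolding smooth_on_def using Ck_on_Un by blast

lemma Ck_on_const: "open U \<Longrightarrow> Ck_on n (\<lambda>x. c) U"
proof (induction n arbitrary: c)
  case (Suc n)
  show ?case
    by (rule Ck_on_SucI[where f'="\<lambda>_ _. 0"]) (use Suc in auto)
qed auto

lemma smooth_on_const: "open U \<Longrightarrow> smooth_on (\<lambda>x. c) U"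
  by (simp add: smooth_on_def Ck_on_const)

lemma Ck_on_add:
  assumes "open U"
  shows "Ck_on n f U \<Longrightarrow> Ck_on n g U \<Longrightarrow> Ck_on n (\<lambda>x. f x + g x) U"
proof (induction n arbitrary: f g)
  case 0
  then show ?case by (auto intro: continuous_on_add)
next
  case (Suc n)
  show ?case
  proof (rule Ck_on_SucI[OF assms])
    show "((\<lambda>x. f x + g x) has_derivative
        (\<lambda>v. frechet_derivative f (at x) v + frechet_derivative g (at x) v)) (at x)" if "x \<in> U" for x
      using Suc.prems that
      by (auto intro!: has_derivative_add simp: frechet_derivative_works[symmetric])
    show "Ck_on n (\<lambda>x. frechet_derivative f (at x) v + frechet_derivative g (at x) v) U" for v
      using Suc by auto
  qed
qed


text \<open>One Leibniz rule for an arbitrary bounded bilinear map covers complex products, scalar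
  multiples and inner products; both summands of the derivative are again such products, of
  functions of one class lower.\<close>

lemma Ck_on_bilinear:
  fixes f :: "'d::euclidean_space \<Rightarrow> 'a::euclidean_space" and g :: "'d \<Rightarrow> 'b::euclidean_space"
    and B :: "'a \<Rightarrow> 'b \<Rightarrow> 'c::euclidean_space"
  assumes "open U" "bounded_bilinear B"
  shows "Ck_on n f U \<Longrightarrow> Ck_on n g U \<Longrightarrow> Ck_on n (\<lambda>x. B (f x) (g x)) U"
proof (induction n arbitrary: f g)
  case 0
  then show ?case using bounded_bilinear.continuous_on[OF assms(2)] by auto
next
  case (Suc n)
  show ?case
  proof (rule Ck_on_SucI[OF assms(1)])
    show "((\<lambda>x. B (f x) (g x)) has_derivative
        (\<lambda>v. B (f x) (frechet_derivative g (at x) v) + B (frechet_derivative f (at x) v) (g x))) (at x)"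
      if "x \<in> U" for x
      using Suc.prems that
      by (intro bounded_bilinear.FDERIV[OF assms(2)])
        (auto simp: frechet_derivative_works[symmetric])
    show "Ck_on n (\<lambda>x. B (f x) (frechet_derivative g (at x) v)
        + B (frechet_derivative f (at x) v) (g x)) U" for v
      using Suc.prems Ck_on_Suc_imp[OF Suc.prems(1)] Ck_on_Suc_imp[OF Suc.prems(2)]
      by (intro Ck_on_add assms(1) Suc.IH) auto
  qed
qed

lemma smooth_on_add:
  "smooth_on f U \<Longrightarrow> smooth_on g U \<Longrightarrow> open U \<Longrightarrow> smooth_on (\<lambda>x. f x + g x) U"
  by (simp add: smooth_on_def Ck_on_add)

lemma smooth_on_mult:
  fixes f g :: "'d::euclidean_space \<Rightarrow> 'a::{euclidean_space,real_normed_algebra}"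
  shows "smooth_on f U \<Longrightarrow> smooth_on g U \<Longrightarrow> open U \<Longrightarrow> smooth_on (\<lambda>x. f x * g x) U"
  by (simp add: smooth_on_def Ck_on_bilinear[OF _ bounded_bilinear_mult])

lemma smooth_on_scaleR:
  "smooth_on f U \<Longrightarrow> smooth_on g U \<Longrightarrow> open U \<Longrightarrow> smooth_on (\<lambda>x. f x *\<^sub>R g x) U"
  by (simp add: smooth_on_def Ck_on_bilinear[OF _ bounded_bilinear_scaleR])

lemma smooth_on_inner:
  "smooth_on f U \<Longrightarrow> smooth_on g U \<Longrightarrow> open U \<Longrightarrow> smooth_on (\<lambda>x. f x \<bullet> g x) U"
  by (simp add: smooth_on_def Ck_on_bilinear[OF _ bounded_bilinear_inner])

lemma smooth_on_bounded_linear: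
  assumes "open U" "bounded_linear L" "smooth_on f U"
  shows "smooth_on (\<lambda>x. L (f x)) U"
proof -
  \<comment> \<open>A linear map L is fed to the bilinear rule as (r, x) -> r L x, with the constant
    1 in the first slot.\<close>
  have "bounded_bilinear (\<lambda>(r::real) x. r *\<^sub>R L x)"
    using bounded_bilinear.comp[OF bounded_bilinear_scaleR bounded_linear_ident assms(2)] .
  from Ck_on_bilinear[OF assms(1) this Ck_on_const[OF assms(1), of _ 1]] assms(3)
  show ?thesis by (simp add: smooth_on_def)
qed

lemma smooth_on_ident: "open U \<Longrightarrow> smooth_on (\<lambda>x. x) U"
  by (rule smooth_onI[where f'="\<lambda>_ v. v"]) (auto intro: smooth_on_const)

lemma smooth_on_diff:
  "smooth_on f U \<Longrightarrow> smooth_on g U \<Longrightarrow> open U \<Longrightarrow> smooth_on (\<lambda>x. f x - g x) U"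
  using smooth_on_add[of f U "\<lambda>x. - g x"]
    smooth_on_bounded_linear[OF _ bounded_linear_minus[OF bounded_linear_ident], of U g] by simp

lemma smooth_on_power:
  fixes f :: "'d::euclidean_space \<Rightarrow> 'a::{euclidean_space,real_normed_algebra_1}"
  shows "smooth_on f U \<Longrightarrow> open U \<Longrightarrow> smooth_on (\<lambda>x. f x ^ n) U"
  by (induction n) (auto intro: smooth_on_const smooth_on_mult)

lemma smooth_on_sum:
  "open U \<Longrightarrow> (\<And>i. i \<in> I \<Longrightarrow> smooth_on (f i) U) \<Longrightarrow> smooth_on (\<lambda>x. \<Sum>i\<in>I. f i x) U"
  by (induction I rule: infinite_finite_induct) (auto intro: smooth_on_const smooth_on_add)

text \<open>With a scalar inner function the derivative is q'(x) v times h'(q x), a product in which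
  the same situation recurs with h' in place of h. So q is kept smooth of all orders and the
  induction generalises over h alone.\<close>

lemma Ck_on_compose:
  fixes h :: "real \<Rightarrow> 'b::euclidean_space" and q :: "'d::euclidean_space \<Rightarrow> real"
  assumes "open U" "open I" "q ` U \<subseteq> I" "smooth_on q U"
  shows "smooth_on h I \<Longrightarrow> Ck_on n (\<lambda>x. h (q x)) U"
proof (induction n arbitrary: h)
  case 0
  have "continuous_on U (h \<circ> q)"
    using smooth_on_continuous[OF 0] smooth_on_continuous[OF assms(4)] assms(3)
    by (meson continuous_on_compose continuous_on_subset)
  then show ?case by (simp add: o_def)
next
  case (Suc n)
  show ?case
  proof (rule Ck_on_SucI[OF assms(1)])
    fix x assume x: "x \<in> U"
    have 1: "(q has_derivative frechet_derivative q (at x)) (at x)"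
      using smooth_on_differentiable[OF assms(4) x] frechet_derivative_works by blast
    have 2: "(h has_derivative frechet_derivative h (at (q x))) (at (q x))"
      using smooth_on_differentiable[OF Suc.prems, of "q x"] x assms(3) frechet_derivative_works by blast
    then have 3: "frechet_derivative h (at (q x)) r = r *\<^sub>R frechet_derivative h (at (q x)) 1" for r
      using linear_scale[OF has_derivative_linear[OF 2], of r 1] by simp
    show "((\<lambda>x. h (q x)) has_derivative
       (\<lambda>v. frechet_derivative q (at x) v *\<^sub>R frechet_derivative h (at (q x)) 1)) (at x)"
      using has_derivative_compose[OF 1 2] by (subst (asm) 3)
  next
    fix v
    have "Ck_on n (\<lambda>x. frechet_derivative h (at (q x)) 1) U"
      by (rule Suc.IH[of "\<lambda>s. frechet_derivative h (at s) 1"]) (rule smooth_on_frechet[OF Suc.prems])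
    moreover have "Ck_on n (\<lambda>x. frechet_derivative q (at x) v) U"
      using smooth_on_frechet[OF assms(4)] by (simp add: smooth_on_def)
    ultimately show "Ck_on n (\<lambda>x. frechet_derivative q (at x) v *\<^sub>R frechet_derivative h (at (q x)) 1) U"
      by (intro Ck_on_bilinear[OF assms(1) bounded_bilinear_scaleR])
  qed
qed

lemma smooth_on_compose:
  fixes h :: "real \<Rightarrow> 'b::euclidean_space" and q :: "'d::euclidean_space \<Rightarrow> real"
  shows "smooth_on h I \<Longrightarrow> smooth_on q U \<Longrightarrow> q ` U \<subseteq> I \<Longrightarrow> open U \<Longrightarrow> open I
    \<Longrightarrow> smooth_on (\<lambda>x. h (q x)) U"
  using Ck_on_compose by (auto simp: smooth_on_def)

subsection \<open>Functions of one variable\<close>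

definition Dr :: "(real \<Rightarrow> complex) \<Rightarrow> real \<Rightarrow> complex" where
  "Dr h s = frechet_derivative h (at s) 1"

lemma Dr_works:
  assumes "smooth_on h I" "s \<in> I"
  shows "(h has_vector_derivative Dr h s) (at s)"
proof -
  have 2: "(h has_derivative frechet_derivative h (at s)) (at s)"
    using smooth_on_differentiable[OF assms] frechet_derivative_works by blast
  have "frechet_derivative h (at s) = (\<lambda>r. r *\<^sub>R Dr h s)"
  proof
    fix r show "frechet_derivative h (at s) r = r *\<^sub>R Dr h s"
      using linear_scale[OF has_derivative_linear[OF 2], of r 1] unfolding Dr_def by simp
  qed
  with 2 show ?thesis unfolding has_vector_derivative_def by simp
qed

lemma DrI: "(h has_vector_derivative d) (at s) \<Longrightarrow> Dr h s = d"
  unfolding Dr_def has_vector_derivative_def by (simp add: frechet_derivative_at[symmetric])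

lemma smooth_on_Dr: "smooth_on h I \<Longrightarrow> smooth_on (Dr h) I"
  unfolding Dr_def using smooth_on_frechet by blast

lemma smooth_on_Dr_iter: "smooth_on h I \<Longrightarrow> smooth_on ((Dr ^^ n) h) I"
  by (induction n) (auto intro: smooth_on_Dr)

lemma smooth_on_realI:
  fixes f :: "real \<Rightarrow> complex"
  assumes "open I" "\<And>s. s \<in> I \<Longrightarrow> (f has_vector_derivative g s) (at s)" "smooth_on g I"
  shows "smooth_on f I"
  by (rule smooth_onI[where f'="\<lambda>s v. v *\<^sub>R g s"])
    (use assms in \<open>auto simp: has_vector_derivative_def intro: smooth_on_scaleR smooth_on_const\<close>)

lemma Dr_cong:
  assumes "open I" "s \<in> I" "\<And>x. x \<in> I \<Longrightarrow> f x = g x"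
  shows "Dr f s = Dr g s"
proof -
  have "(f has_derivative F) (at s) \<longleftrightarrow> (g has_derivative F) (at s)" for F
    using has_derivative_transform_within_open[OF _ assms(1,2)] assms(3) by metis
  then show ?thesis by (simp add: Dr_def frechet_derivative_def)
qed

lemma Dr_iter_cong:
  assumes "open I" "s \<in> I" "\<And>x. x \<in> I \<Longrightarrow> f x = g x"
  shows "(Dr ^^ n) f s = (Dr ^^ n) g s"
  using assms(2)
proof (induction n arbitrary: s)
  case (Suc n)
  show ?case unfolding funpow.simps o_def by (rule Dr_cong[OF assms(1) Suc.prems]) (rule Suc.IH)
qed (use assms in auto)

lemma Dr_add:
  assumes "smooth_on f I" "smooth_on g I" "s \<in> I"
  shows "Dr (\<lambda>s. f s + g s) s = Dr f s + Dr g s"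
  by (rule DrI) (intro has_vector_derivative_add Dr_works[OF assms(1,3)] Dr_works[OF assms(2,3)])

lemma Dr_mult:
  assumes "smooth_on f I" "smooth_on g I" "s \<in> I"
  shows "Dr (\<lambda>s. f s * g s) s = f s * Dr g s + Dr f s * g s"
  by (rule DrI) (intro has_vector_derivative_mult Dr_works[OF assms(1,3)] Dr_works[OF assms(2,3)])

lemma Dr_cmult:
  assumes "smooth_on f I" "s \<in> I"
  shows "Dr (\<lambda>s. c * f s) s = c * Dr f s"
  by (rule DrI) (intro has_vector_derivative_mult_right Dr_works[OF assms])

lemma Dr_iter_lincomb:
  assumes "smooth_on f I" "smooth_on g I" "open I" "s \<in> I"
  shows "(Dr ^^ n) (\<lambda>s. c * f s + d * g s) s = c * (Dr ^^ n) f s + d * (Dr ^^ n) g s"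
  using assms(4)
proof (induction n arbitrary: s)
  case (Suc n)
  have "(Dr ^^ Suc n) (\<lambda>s. c * f s + d * g s) s
      = Dr (\<lambda>s. c * (Dr ^^ n) f s + d * (Dr ^^ n) g s) s"
    unfolding funpow.simps o_def by (rule Dr_cong[OF assms(3) Suc.prems]) (rule Suc.IH)
  also have "\<dots> = c * (Dr ^^ Suc n) f s + d * (Dr ^^ Suc n) g s"
    using Suc.prems assms smooth_on_Dr_iter[of f I n] smooth_on_Dr_iter[of g I n]
    by (subst Dr_add[where I=I])
      (auto simp: Dr_cmult[where I=I] intro!: smooth_on_mult smooth_on_const)
  finally show ?case .
qed auto

lemma Dr_eq_0_outside:
  assumes "closed K" "\<And>s. s \<notin> K \<Longrightarrow> h s = 0" "s \<notin> K"
  shows "(Dr ^^ n) h s = 0"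
proof -
  have z: "(Dr ^^ n) (\<lambda>s. 0) s = 0" for n s
  proof (induction n arbitrary: s)
    case (Suc n)
    then have "(Dr ^^ n) (\<lambda>s. 0) = (\<lambda>s. 0)" by blast
    then show ?case by (simp add: DrI[OF has_vector_derivative_const])
  qed auto
  show ?thesis
    using Dr_iter_cong[of "- K" s h "\<lambda>_. 0" n] assms z by auto
qed

text \<open>Functions built from sqrt s are smooth only for s > 0; if they vanish below some a > 0,
  they are smooth on the whole line, as test profiles have to be.\<close>

lemma smooth_on_glue_zero:
  fixes f :: "real \<Rightarrow> complex"
  assumes "smooth_on f {0<..}" "0 < a" "\<And>s. s < a \<Longrightarrow> f s = 0"
  shows "smooth_on f UNIV"
proof -
  have "smooth_on f {..<a}"
    using smooth_on_cong[of "{..<a}" f "\<lambda>_. 0"] assms(3) smooth_on_const[of "{..<a}"] by auto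
  then have "smooth_on f ({0<..} \<union> {..<a})" using assms(1) by (intro smooth_on_Un) auto
  moreover have "{0<..} \<union> {..<a} = UNIV" using assms(2) by auto
  ultimately show ?thesis by simp
qed

lemma antiderivative_smooth:
  fixes f :: "real \<Rightarrow> complex"
  assumes f: "smooth_on f UNIV" and z: "\<And>s. s \<le> a \<Longrightarrow> f s = 0"
  obtains A where "smooth_on A UNIV" "\<And>s. Dr A s = f s" "\<And>s. s \<le> a \<Longrightarrow> A s = 0"
proof -
  \<comment> \<open>With the base point a - 1 every s \<ge> a is interior to [a - 1, s + 1], so the
    derivative within that interval is a full derivative.\<close>
  define A where "A s = integral {a - 1..s} f" for s
  have A0: "A s = 0" if "s \<le> a" for s
    unfolding A_def using that z by (intro integral_eq_0_iff[THEN iffD2] integral_unique has_integral_is_0) auto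
  have d: "(A has_vector_derivative f s) (at s)" for s
  proof (cases "s < a")
    case True
    have "((\<lambda>_. 0) has_vector_derivative 0) (at s)" by simp
    then show ?thesis
      using has_vector_derivative_transform_within_open[of "\<lambda>_. 0" 0 s "{..<a}" A] True A0 z by auto
  next
    case False
    have "continuous_on {a - 1..s + 1} f"
      using smooth_on_continuous[OF f] continuous_on_subset by blast
    then have "(A has_vector_derivative f s) (at s within {a - 1..s + 1})"
      unfolding A_def using False by (intro integral_has_vector_derivative) auto
    moreover have "at s within {a - 1..s + 1} = at s"
      using False by (intro at_within_interior) auto
    ultimately show ?thesis by simp
  qed
  show ?thesis
    using that[of A] smooth_on_realI[OF _ d f] d A0 DrI by auto
qed

lemma Dr_zero_imp_const:
  assumes "smooth_on A I" "{b..} \<subseteq> I" "\<And>s. b \<le> s \<Longrightarrow> Dr A s = 0" "b \<le> s"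
  shows "A s = A b"
proof -
  have "(A has_vector_derivative 0) (at x within {b..})" if "x \<in> {b..}" for x
    using Dr_works[OF assms(1), of x] assms(2,3) that
    by (metis atLeast_iff has_vector_derivative_at_within subsetD)
  then obtain c where "\<And>x. x \<in> {b..} \<Longrightarrow> A x = c"
    using has_vector_derivative_zero_constant[of "{b..}" A] by (metis convex_real_interval(1))
  then show ?thesis using assms(4) by simp
qed

section \<open>Bumps and cutoffs from exp(-1/t)\<close>

subsection \<open>Cutoff functions\<close>

text \<open>The classical flat function exp(-1/t) and its multiples by t^(-m). The index m is
  present because derivatives stay in the linear span of this family, so that smoothness follows by
  one induction over all m.\<close>

definition flat :: "nat \<Rightarrow> real \<Rightarrow> real" where
  "flat m t = (if 0 < t then exp (- inverse t) * inverse t ^ m else 0)"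

lemma flat_tendsto_0: "(flat m \<longlongrightarrow> 0) (at 0)"
proof (rule filterlim_split_at)
  show "(flat m \<longlongrightarrow> 0) (at_left 0)"
    by (rule tendsto_eventually) (auto simp: flat_def eventually_at_filter)
  have "((\<lambda>x::real. x ^ m / exp x) \<longlongrightarrow> 0) at_top" by (rule tendsto_power_div_exp_0)
  from filterlim_compose[OF this filterlim_inverse_at_top_right]
  have "((\<lambda>t::real. inverse t ^ m / exp (inverse t)) \<longlongrightarrow> 0) (at_right 0)" .
  then show "(flat m \<longlongrightarrow> 0) (at_right 0)"
    by (rule Lim_transform_eventually)
      (auto simp: flat_def eventually_at_filter exp_minus field_simps)
qed

lemma flat_deriv:
  "(flat m has_real_derivative flat (m + 2) t - real m * flat (m + 1) t) (at t)"
proof (cases t "0::real" rule: linorder_cases)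
  case less
  have "((\<lambda>_. 0::real) has_real_derivative 0) (at t)" by simp
  then have "(flat m has_real_derivative 0) (at t)"
    by (rule has_field_derivative_transform_within_open[of _ _ _ "{..<0}"]) (use less in \<open>auto simp: flat_def\<close>)
  then show ?thesis using less by (simp add: flat_def)
next
  case equal
  \<comment> \<open>The difference quotient of \<open>flat m\<close> at 0 is
    \<open>flat (m + 1)\<close>, so its limit is again an instance of flatness.\<close>
  have "((\<lambda>h. (flat m (0 + h) - flat m 0) / h) \<longlongrightarrow> 0) (at 0)"
    by (rule Lim_transform_eventually[OF flat_tendsto_0[of "m + 1"]])
      (auto simp: flat_def eventually_at_filter field_simps)
  then show ?thesis using equal by (simp add: DERIV_def flat_def)
next
  case greater
  have "((\<lambda>t. exp (- inverse t) * inverse t ^ m) has_real_derivative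
      flat (m + 2) t - real m * flat (m + 1) t) (at t)"
    using greater
    by (auto intro!: derivative_eq_intros simp: flat_def power2_eq_square)
      (cases m; simp add: field_simps)
  then show ?thesis
    by (rule has_field_derivative_transform_within_open[of _ _ _ "{0<..}"])
      (use greater in \<open>auto simp: flat_def\<close>)
qed

lemma smooth_flat: "smooth_on (\<lambda>t. complex_of_real (flat m t)) UNIV"
proof -
  have "Ck_on n (\<lambda>t. complex_of_real (flat m t)) UNIV" for n
  proof (induction n arbitrary: m)
    case 0
    have "continuous_on UNIV (flat m)"
      using flat_deriv by (intro continuous_at_imp_continuous_on) (auto intro: DERIV_isCont)
    then show ?case by (auto intro!: continuous_intros)
  next
    case (Suc n)
    show ?case
    proof (rule Ck_on_SucI)
      show "((\<lambda>t. complex_of_real (flat m t)) has_derivative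
        (\<lambda>v. v *\<^sub>R (of_real (flat (m + 2) t) + complex_of_real (- real m) * of_real (flat (m + 1) t)))) (at t)" for t
        using has_vector_derivative_of_real[OF flat_deriv[of m t]]
        by (simp add: has_vector_derivative_def)
      show "Ck_on n (\<lambda>t. v *\<^sub>R (complex_of_real (flat (m + 2) t)
          + complex_of_real (- real m) * of_real (flat (m + 1) t))) UNIV" for v
        by (intro Ck_on_bilinear[OF _ bounded_bilinear_scaleR] Ck_on_add Suc Ck_on_const
            Ck_on_bilinear[OF _ bounded_bilinear_mult]) auto
    qed auto
  qed
  then show ?thesis by (simp add: smooth_on_def)
qed

lemma bump_function:
  fixes a b :: real
  obtains \<beta> :: "real \<Rightarrow> real" where "smooth_on (\<lambda>s. complex_of_real (\<beta> s)) UNIV" "\<And>s. 0 \<le> \<beta> s"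
    "\<And>s. \<beta> s \<noteq> 0 \<longleftrightarrow> a < s \<and> s < b"
proof
  let ?b = "\<lambda>s. flat 0 (s - a) * flat 0 (b - s)"
  have "smooth_on (\<lambda>s. complex_of_real (flat 0 (s - a)) * of_real (flat 0 (b - s))) UNIV"
    by (intro smooth_on_mult smooth_on_compose[OF smooth_flat] smooth_on_diff smooth_on_ident smooth_on_const) auto
  then show "smooth_on (\<lambda>s. complex_of_real (?b s)) UNIV" by simp
qed (auto simp: flat_def)

text \<open>The antiderivative of a bump on (a, b), divided by its final value and subtracted from
  1.\<close>

lemma cutoff_function:
  fixes a b :: real
  assumes "a < b"
  obtains \<theta> :: "real \<Rightarrow> complex" where "smooth_on \<theta> UNIV" "\<And>s. s \<le> a \<Longrightarrow> \<theta> s = 1" "\<And>s. b \<le> s \<Longrightarrow> \<theta> s = 0"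
proof -
  obtain \<beta> :: "real \<Rightarrow> real" where \<beta>: "smooth_on (\<lambda>s. complex_of_real (\<beta> s)) UNIV" "\<And>s. 0 \<le> \<beta> s"
    "\<And>s. \<beta> s \<noteq> 0 \<longleftrightarrow> a < s \<and> s < b" using bump_function[of a b] by blast
  have "complex_of_real (\<beta> s) = 0" if "s \<le> a" for s
    using \<beta>(3)[of s] that by auto
  from antiderivative_smooth[OF \<beta>(1) this]
  obtain A where A: "smooth_on A UNIV" "\<And>s. Dr A s = complex_of_real (\<beta> s)" "\<And>s. s \<le> a \<Longrightarrow> A s = 0"
    by metis
  \<comment> \<open>The antiderivative is complex valued; its real part has the nonnegative
    derivative \<beta>, whence a nonzero final value by which to divide.\<close>
  have d: "((\<lambda>s. Re (A s)) has_real_derivative \<beta> s) (at s)" for s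
    using bounded_linear.has_vector_derivative[OF bounded_linear_Re Dr_works[OF A(1), of s]] A(2)
    by (simp add: has_real_derivative_iff_has_vector_derivative)
  have "Re (A a) < Re (A b)"
  proof (rule DERIV_pos_imp_increasing_open[OF assms])
    show "\<exists>y. ((\<lambda>s. Re (A s)) has_real_derivative y) (at x) \<and> 0 < y" if "a < x" "x < b" for x
      using d[of x] \<beta>(2)[of x] \<beta>(3)[of x] that by (intro exI[of _ "\<beta> x"]) auto
    show "continuous_on {a..b} (\<lambda>s. Re (A s))"
      using d by (intro continuous_at_imp_continuous_on) (auto intro: DERIV_isCont)
  qed
  then have nz: "A b \<noteq> 0" using A(3)[of a] by auto
  have c: "A s = A b" if "b \<le> s" for s
  proof (rule Dr_zero_imp_const[OF A(1) _ _ that])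
    show "Dr A t = 0" if "b \<le> t" for t using \<beta>(3)[of t] A(2)[of t] that by auto
  qed simp
  show ?thesis
  proof (rule that[of "\<lambda>s. 1 - A s * inverse (A b)"])
    show "smooth_on (\<lambda>s. 1 - A s * inverse (A b)) UNIV"
      by (intro smooth_on_diff smooth_on_mult smooth_on_const A(1)) auto
    show "1 - A s * inverse (A b) = 0" if "b \<le> s" for s
      using nz c[OF that] by simp
    show "1 - A s * inverse (A b) = 1" if "s \<le> a" for s
      using A(3)[OF that] by simp
  qed
qed

section \<open>The operators L_c and their commutation with d/ds\<close>

subsection \<open>The radial operators\<close>

text \<open>In the variable \<open>s = |x|\<^sup>2\<close> the operator \<open>\<Delta> + k\<^sup>2\<close> acts on \<open>(a \<bullet> x)^l h(s)\<close>
  as \<open>Lop k (4 l + 6)\<close>, up to a term with \<open>(a \<bullet> x)^(l - 2)\<close>; \<open>c = 2\<close> is the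
  one-dimensional operator \<open>d\<^sup>2/dr\<^sup>2 + k\<^sup>2\<close> with \<open>s = r\<^sup>2\<close>.\<close>

definition Lop :: "real \<Rightarrow> real \<Rightarrow> (real \<Rightarrow> complex) \<Rightarrow> real \<Rightarrow> complex" where
  "Lop k c h s = of_real (4 * s) * Dr (Dr h) s + of_real c * Dr h s + of_real (k\<^sup>2) * h s"

text \<open>4 s h'' + c h' is the total derivative of this expression; the shift to c - 4
  compensates the derivative that falls on 4 s.\<close>

definition Mop :: "real \<Rightarrow> (real \<Rightarrow> complex) \<Rightarrow> real \<Rightarrow> complex" where
  "Mop c h s = of_real (4 * s) * Dr h s + of_real (c - 4) * h s"

lemma smooth_on_of_real_mult: "open I \<Longrightarrow> smooth_on (\<lambda>s. complex_of_real (c * s)) I"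
  by (rule smooth_on_bounded_linear[OF _ bounded_linear_compose[OF bounded_linear_of_real bounded_linear_mult_right]])
    (auto intro: smooth_on_ident)

lemma smooth_Lop: "smooth_on h I \<Longrightarrow> open I \<Longrightarrow> smooth_on (Lop k c h) I"
  unfolding Lop_def[abs_def]
  by (intro smooth_on_add smooth_on_mult smooth_on_of_real_mult smooth_on_Dr smooth_on_const) auto

lemma smooth_Mop: "smooth_on h I \<Longrightarrow> open I \<Longrightarrow> smooth_on (Mop c h) I"
  unfolding Mop_def[abs_def]
  by (intro smooth_on_add smooth_on_mult smooth_on_of_real_mult smooth_on_Dr smooth_on_const) auto

lemma has_vector_derivative_of_real_mult:
  "((\<lambda>s. complex_of_real (4 * s)) has_vector_derivative 4) (at s)"
proof -
  have "((\<lambda>s. 4 * s) has_real_derivative 4) (at s)"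
    by (auto intro!: derivative_eq_intros)
  from has_vector_derivative_of_real[OF this] show ?thesis by simp
qed

text \<open>The derivative of the coefficient 4 s contributes another 4 h'', so differentiation
  raises c by 4. Hence l + 1 steps lead from c = 2 to c = 4 l + 6.\<close>

lemma Dr_Lop:
  assumes "smooth_on h I" "s \<in> I"
  shows "Dr (Lop k c h) s = Lop k (c + 4) (Dr h) s"
proof -
  note d = Dr_works[OF assms] Dr_works[OF smooth_on_Dr[OF assms(1)] assms(2)]
    Dr_works[OF smooth_on_Dr[OF smooth_on_Dr[OF assms(1)]] assms(2)]
  have "(Lop k c h has_vector_derivative
      (of_real (4 * s) * Dr (Dr (Dr h)) s + 4 * Dr (Dr h) s) + of_real c * Dr (Dr h) s
        + of_real (k\<^sup>2) * Dr h s) (at s)"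
    unfolding Lop_def[abs_def]
    by (intro has_vector_derivative_add has_vector_derivative_mult_right
        has_vector_derivative_mult[OF has_vector_derivative_of_real_mult] d)
  from DrI[OF this] show ?thesis by (simp add: Lop_def algebra_simps)
qed

lemma Dr_iter_Lop:
  assumes "smooth_on h I" "open I" "s \<in> I"
  shows "(Dr ^^ n) (Lop k c h) s = Lop k (c + 4 * real n) ((Dr ^^ n) h) s"
  using assms(3)
proof (induction n arbitrary: s)
  case (Suc n)
  have "(Dr ^^ Suc n) (Lop k c h) s = Dr (Lop k (c + 4 * real n) ((Dr ^^ n) h)) s"
    unfolding funpow.simps o_def by (rule Dr_cong[OF assms(2) Suc.prems]) (rule Suc.IH)
  also have "\<dots> = Lop k (c + 4 * real (Suc n)) ((Dr ^^ Suc n) h) s"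
    using Dr_Lop[OF smooth_on_Dr_iter[OF assms(1), of n] Suc.prems] by (simp add: algebra_simps)
  finally show ?case .
qed auto

lemma Dr_Mop:
  assumes "smooth_on h I" "s \<in> I"
  shows "Dr (Mop c h) s = Lop k c h s - of_real (k\<^sup>2) * h s"
proof -
  note d = Dr_works[OF assms] Dr_works[OF smooth_on_Dr[OF assms(1)] assms(2)]
  have "(Mop c h has_vector_derivative
      (of_real (4 * s) * Dr (Dr h) s + 4 * Dr h s) + of_real (c - 4) * Dr h s) (at s)"
    unfolding Mop_def[abs_def]
    by (intro has_vector_derivative_add has_vector_derivative_mult_right
        has_vector_derivative_mult[OF has_vector_derivative_of_real_mult] d)
  from DrI[OF this] show ?thesis by (simp add: Lop_def algebra_simps)
qed

lemma Lop_cong: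
  assumes "open I" "s \<in> I" "\<And>x. x \<in> I \<Longrightarrow> f x = g x"
  shows "Lop k c f s = Lop k c g s"
  using Dr_iter_cong[OF assms, where n=1] Dr_iter_cong[OF assms, where n=2] assms(2,3)
  by (simp add: Lop_def numeral_2_eq_2)

lemma Lop_lincomb:
  assumes "smooth_on f I" "smooth_on g I" "open I" "s \<in> I"
  shows "Lop k c (\<lambda>s. a * f s + b * g s) s = a * Lop k c f s + b * Lop k c g s"
  using Dr_iter_lincomb[OF assms, where n=1 and c=a and d=b] Dr_iter_lincomb[OF assms, where n=2 and c=a and d=b]
  by (simp add: Lop_def numeral_2_eq_2 algebra_simps)

text \<open>Apart from f times \<open>Lop\<close> of g, every term contains a derivative of f. With
  f a cutoff, the remainder lives only where the cutoff varies.\<close>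

lemma Lop_mult:
  assumes "smooth_on f I" "smooth_on g I" "open I" "s \<in> I"
  shows "Lop k c (\<lambda>s. f s * g s) s = f s * Lop k c g s
    + (of_real (8 * s) * Dr f s * Dr g s + (of_real (4 * s) * Dr (Dr f) s + of_real c * Dr f s) * g s)"
proof -
  have 1: "Dr (\<lambda>s. f s * g s) t = f t * Dr g t + Dr f t * g t" if "t \<in> I" for t
    by (rule Dr_mult[OF assms(1,2) that])
  have "Dr (Dr (\<lambda>s. f s * g s)) s = Dr (\<lambda>t. f t * Dr g t + Dr f t * g t) s"
    by (rule Dr_cong[OF assms(3,4) 1])
  also have "\<dots> = (f s * Dr (Dr g) s + Dr f s * Dr g s) + (Dr f s * Dr g s + Dr (Dr f) s * g s)"
    using assms
    by (subst Dr_add[where I=I]) (auto simp: Dr_mult[where I=I] smooth_on_Dr intro!: smooth_on_mult)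
  finally show ?thesis using 1[OF assms(4)] by (simp add: Lop_def algebra_simps)
qed

section \<open>The waves exp(i k r) / r^m in the variable s = r^2 and the equation y'' + k^2 y =
  G\<close>

subsection \<open>Radial waves\<close>

text \<open>exp(i k r) / r^m with r = sqrt s; a negative k gives incoming waves. Since d/ds = (1 /
  (2 r)) d/dr, derivatives are combinations of the waves with exponents m + 1 and m + 2.\<close>

definition Ek :: "real \<Rightarrow> nat \<Rightarrow> real \<Rightarrow> complex" where
  "Ek k m s = exp (\<i> * of_real (k * sqrt s)) * inverse (of_real (sqrt s) ^ m)"

lemma norm_Ek: "norm (Ek k m s) = inverse (\<bar>sqrt s\<bar> ^ m)"
  by (simp add: Ek_def norm_mult norm_inverse norm_power)

lemma Ek_deriv:
  assumes "0 < s"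
  shows "(Ek k m has_vector_derivative
    \<i> * of_real k / 2 * Ek k (m + 1) s + - of_nat m / 2 * Ek k (m + 2) s) (at s)"
proof -
  let ?g = "\<lambda>z::complex. exp (\<i> * of_real k * z) * inverse (z ^ m)"
  have nz: "complex_of_real (sqrt s) \<noteq> 0" using assms by simp
  have "(sqrt has_real_derivative inverse (2 * sqrt s)) (at s)"
    using assms by (auto intro!: derivative_eq_intros simp: field_simps)
  then have 1: "((\<lambda>s. complex_of_real (sqrt s)) has_vector_derivative of_real (inverse (2 * sqrt s))) (at s)"
    by (rule has_vector_derivative_of_real)
  define z where "z = complex_of_real (sqrt s)"
  have z: "z \<noteq> 0" using nz by (simp add: z_def)
  have "(?g has_field_derivative
      exp (\<i> * of_real k * z) * (\<i> * of_real k * inverse (z ^ m)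
        - of_nat m * inverse (z ^ (m + 1)))) (at z)"
  proof (cases m)
    case 0
    then show ?thesis by (auto intro!: derivative_eq_intros)
  next
    case (Suc j)
    show ?thesis unfolding Suc using z
      by (auto intro!: derivative_eq_intros simp: divide_simps) (cases j; auto simp: algebra_simps)
  qed
  from field_vector_diff_chain_at[OF 1 this[unfolded z_def]]
  have "(?g \<circ> (\<lambda>s. complex_of_real (sqrt s)) has_vector_derivative
     of_real (inverse (2 * sqrt s)) * (exp (\<i> * of_real k * z) * (\<i> * of_real k * inverse (z ^ m)
        - of_nat m * inverse (z ^ (m + 1))))) (at s)"
    by (simp add: z_def)
  moreover have "?g \<circ> (\<lambda>s. complex_of_real (sqrt s)) = Ek k m"
    by (auto simp: Ek_def mult.assoc)
  moreover have "of_real (inverse (2 * sqrt s)) * (exp (\<i> * of_real k * z) * (\<i> * of_real k * inverse (z ^ m)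
        - of_nat m * inverse (z ^ (m + 1))))
      = \<i> * of_real k / 2 * Ek k (m + 1) s + - of_nat m / 2 * Ek k (m + 2) s"
    using z unfolding Ek_def z_def[symmetric] of_real_inverse of_real_mult
    by (simp add: field_simps power2_eq_square)
  ultimately show ?thesis by (simp only:)
qed

lemma Dr_Ek: "0 < s \<Longrightarrow>
  Dr (Ek k m) s = \<i> * of_real k / 2 * Ek k (m + 1) s + - of_nat m / 2 * Ek k (m + 2) s"
  by (rule DrI[OF Ek_deriv])

lemma smooth_Ek: "smooth_on (Ek k m) {0<..}"
proof -
  have "Ck_on n (Ek k m) {0<..}" for n
  proof (induction n arbitrary: m)
    case 0
    have "continuous (at s) (Ek k m)" if "0 < s" for s
      using has_vector_derivative_continuous[OF Ek_deriv[OF that]] .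
    then show ?case by (auto intro!: continuous_at_imp_continuous_on)
  next
    case (Suc n)
    show ?case
    proof (rule Ck_on_SucI)
      show "(Ek k m has_derivative (\<lambda>v. v *\<^sub>R (\<i> * of_real k / 2 * Ek k (m + 1) s
          + - of_nat m / 2 * Ek k (m + 2) s))) (at s)" if "s \<in> {0<..}" for s
        using Ek_deriv[of s k m] that by (simp add: has_vector_derivative_def)
      show "Ck_on n (\<lambda>s. v *\<^sub>R (\<i> * of_real k / 2 * Ek k (m + 1) s
          + - of_nat m / 2 * Ek k (m + 2) s)) {0<..}" for v
        by (intro Ck_on_bilinear[OF _ bounded_bilinear_scaleR] Ck_on_add Suc Ck_on_const
            Ck_on_bilinear[OF _ bounded_bilinear_mult]) auto
    qed auto
  qed
  then show ?thesis by (simp add: smooth_on_def)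
qed

lemma Dr_iter_Ek_Suc:
  assumes "0 < s"
  shows "(Dr ^^ Suc n) (Ek k m) s = \<i> * of_real k / 2 * (Dr ^^ n) (Ek k (m + 1)) s
    + - of_nat m / 2 * (Dr ^^ n) (Ek k (m + 2)) s"
proof -
  have "(Dr ^^ Suc n) (Ek k m) s = (Dr ^^ n) (Dr (Ek k m)) s"
    by (simp add: funpow_swap1)
  also have "\<dots> = (Dr ^^ n) (\<lambda>s. \<i> * of_real k / 2 * Ek k (m + 1) s + - of_nat m / 2 * Ek k (m + 2) s) s"
    by (rule Dr_iter_cong[of "{0<..}"]) (use assms Dr_Ek in auto)
  also have "\<dots> = \<i> * of_real k / 2 * (Dr ^^ n) (Ek k (m + 1)) s
    + - of_nat m / 2 * (Dr ^^ n) (Ek k (m + 2)) s"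
    by (rule Dr_iter_lincomb[OF smooth_Ek smooth_Ek]) (use assms in auto)
  finally show ?thesis .
qed

text \<open>A derivative that hits the exponential gives i k / 2 and one power of 1/r; one that hits
  a power of r costs an additional 1/r. Only the term in which all n derivatives hit the exponential
  is of leading order.\<close>

lemma Dr_iter_Ek_asymptotic:
  "\<exists>C. \<forall>s\<ge>1. norm ((Dr ^^ n) (Ek k m) s - (\<i> * of_real k / 2) ^ n * Ek k (m + n) s)
    \<le> C * inverse (sqrt s ^ (m + n + 1))"
proof (induction n arbitrary: m)
  case 0
  show ?case by (intro exI[of _ 0]) auto
next
  case (Suc n)
  let ?c = "\<i> * complex_of_real k / 2"
  obtain C1 where C1: "\<And>s. s \<ge> 1 \<Longrightarrow> norm ((Dr ^^ n) (Ek k (m + 1)) s - ?c ^ n * Ek k (m + 1 + n) s)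
    \<le> C1 * inverse (sqrt s ^ (m + 1 + n + 1))" using Suc[of "m + 1"] by blast
  obtain C2 where C2: "\<And>s. s \<ge> 1 \<Longrightarrow> norm ((Dr ^^ n) (Ek k (m + 2)) s - ?c ^ n * Ek k (m + 2 + n) s)
    \<le> C2 * inverse (sqrt s ^ (m + 2 + n + 1))" using Suc[of "m + 2"] by blast
  show ?case
  \<comment> \<open>The \<open>m + 1\<close> branch passes on its error constant. The
    \<open>m + 2\<close> branch is as a whole of error order, so its full size, with the main term
    \<open>norm ?c ^ n\<close>, is charged to the constant.\<close>
  proof (intro exI[of _ "norm ?c * C1 + real m / 2 * (\<bar>C2\<bar> + norm ?c ^ n)"] allI impI)
    fix s :: real assume s: "1 \<le> s"
    let ?w = "inverse (sqrt s ^ (m + n + 2))"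
    have s1: "sqrt s \<ge> 1" using s by simp
    let ?X = "(Dr ^^ n) (Ek k (m + 1)) s - ?c ^ n * Ek k (m + 1 + n) s"
    let ?Y = "(Dr ^^ n) (Ek k (m + 2)) s"
    have eq: "(Dr ^^ Suc n) (Ek k m) s - ?c ^ Suc n * Ek k (m + Suc n) s = ?c * ?X + - of_nat m / 2 * ?Y"
      using Dr_iter_Ek_Suc[of s n k m] s by (simp add: algebra_simps)
    have X: "norm ?X \<le> C1 * ?w" using C1[OF s] by (simp add: add.commute add.left_commute)
    have "norm ?Y \<le> norm (?Y - ?c ^ n * Ek k (m + 2 + n) s) + norm (?c ^ n * Ek k (m + 2 + n) s)"
      by norm
    also have "norm (?c ^ n * Ek k (m + 2 + n) s) = norm ?c ^ n * ?w"
      using s1 by (simp add: norm_mult norm_power norm_Ek add.commute add.left_commute)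
    also have "norm (?Y - ?c ^ n * Ek k (m + 2 + n) s) \<le> \<bar>C2\<bar> * ?w"
    proof -
      have "C2 * inverse (sqrt s ^ (m + 2 + n + 1)) \<le> \<bar>C2\<bar> * ?w"
      proof (rule mult_mono)
        show "inverse (sqrt s ^ (m + 2 + n + 1)) \<le> ?w"
          using s1 by (intro le_imp_inverse_le power_increasing) auto
      qed (use s1 in auto)
      then show ?thesis using C2[OF s] by linarith
    qed
    finally have Y: "norm ?Y \<le> (\<bar>C2\<bar> + norm ?c ^ n) * ?w" by (simp add: algebra_simps)
    have "norm ((Dr ^^ Suc n) (Ek k m) s - ?c ^ Suc n * Ek k (m + Suc n) s)
        \<le> norm ?c * norm ?X + real m / 2 * norm ?Y"
      unfolding eq by (rule norm_triangle_le) (simp add: norm_mult norm_divide)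
    also have "\<dots> \<le> norm ?c * (C1 * ?w) + real m / 2 * ((\<bar>C2\<bar> + norm ?c ^ n) * ?w)"
      using X Y by (intro add_mono mult_left_mono) auto
    finally show "norm ((Dr ^^ Suc n) (Ek k m) s - ?c ^ Suc n * Ek k (m + Suc n) s)
      \<le> (norm ?c * C1 + real m / 2 * (\<bar>C2\<bar> + norm ?c ^ n)) * inverse (sqrt s ^ (m + Suc n + 1))"
      by (simp add: algebra_simps)
  qed
qed

lemma Ek_shift: "0 < s \<Longrightarrow> Ek k (m + 2) s = Ek k m s * inverse (of_real s)"
proof -
  assume "0 < s"
  then have "complex_of_real (sqrt s) ^ 2 = of_real s"
    by (metis of_real_power less_imp_le real_sqrt_pow2)
  then show ?thesis unfolding Ek_def power_add inverse_mult_distrib by (simp add: mult.assoc)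
qed

lemma Lop_Ek:
  assumes "0 < s" "\<kappa>\<^sup>2 = k\<^sup>2"
  shows "Lop k 2 (Ek \<kappa> 0) s = 0"
proof -
  let ?c = "\<i> * complex_of_real \<kappa> / 2"
  \<comment> \<open>The summand with factor 0 gives the two-term shape to which
    \<open>Dr_iter_lincomb\<close> applies.\<close>
  have 1: "Dr (Ek \<kappa> 0) t = ?c * Ek \<kappa> 1 t + 0 * Ek \<kappa> 1 t" if "t \<in> {0<..}" for t
    using Dr_Ek[of t \<kappa> 0] that by simp
  have "Dr (Dr (Ek \<kappa> 0)) s = (Dr ^^ Suc 0) (\<lambda>t. ?c * Ek \<kappa> 1 t + 0 * Ek \<kappa> 1 t) s"
    unfolding funpow.simps o_def id_def by (rule Dr_cong[of "{0<..}", OF _ _ 1]) (use assms in auto)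
  also have "\<dots> = ?c * Dr (Ek \<kappa> 1) s"
    by (subst Dr_iter_lincomb[where I="{0<..}"]) (use assms smooth_Ek in auto)
  also have "\<dots> = ?c * (?c * Ek \<kappa> 2 s - 1 / 2 * Ek \<kappa> 3 s)"
    using Dr_Ek[of s \<kappa> 1] assms by (simp add: numeral_2_eq_2 numeral_3_eq_3)
  finally have 2: "Dr (Dr (Ek \<kappa> 0)) s = ?c * (?c * Ek \<kappa> 2 s - 1 / 2 * Ek \<kappa> 3 s)" .
  have sh: "of_real s * Ek \<kappa> 2 s = Ek \<kappa> 0 s" "of_real s * Ek \<kappa> 3 s = Ek \<kappa> 1 s"
    using Ek_shift[OF assms(1), of \<kappa> 0] Ek_shift[OF assms(1), of \<kappa> 1] assms(1)
    by (simp_all add: numeral_3_eq_3 numeral_2_eq_2)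
  have "Lop k 2 (Ek \<kappa> 0) s = 4 * ?c * (?c * (of_real s * Ek \<kappa> 2 s) - 1 / 2 * (of_real s * Ek \<kappa> 3 s))
     + 2 * ?c * Ek \<kappa> 1 s + of_real (k\<^sup>2) * Ek \<kappa> 0 s"
    unfolding Lop_def 2 using 1[of s] assms(1) by (simp add: algebra_simps)
  also have "\<dots> = (of_real (k\<^sup>2) - of_real (\<kappa>\<^sup>2)) * Ek \<kappa> 0 s"
    unfolding sh by (simp add: algebra_simps power2_eq_square)
  finally show ?thesis using assms(2) by simp
qed

text \<open>Variation of constants for \<open>y'' + k\<^sup>2 y = G\<close> in the variable \<open>r = sqrt s\<close>.\<close>

lemma inhomogeneous_solution:
  assumes k: "0 < k" and G: "smooth_on G UNIV" and a: "0 < \<alpha>"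
    and Ga: "\<And>s. s \<le> \<alpha> \<Longrightarrow> G s = 0" and Gb: "\<And>s. \<beta> \<le> s \<Longrightarrow> G s = 0"
  obtains y c d where "smooth_on y UNIV" "\<And>s. s \<le> \<alpha> \<Longrightarrow> y s = 0"
    "\<And>s. 0 < s \<Longrightarrow> Lop k 2 y s = G s" "\<And>s. \<beta> \<le> s \<Longrightarrow> y s = c * Ek k 0 s + d * Ek (- k) 0 s"
proof -
  let ?I = "{0<..} :: real set"
  \<comment> \<open>Variation of constants in r gives dA/dr = exp(-i k r) G / (2 i k), with 2 i k
    the Wronskian up to sign; ds = 2 r dr turns this into dA/ds = exp(-i k r) G / (4 i k r). The
    coefficient of the other wave arises from -k.\<close>
  define f where "f \<kappa> s = G s * Ek (- \<kappa>) 1 s * (1 / (4 * \<i> * of_real \<kappa>))" for \<kappa> s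
  have f0: "f \<kappa> s = 0" if "s \<le> \<alpha>" for \<kappa> s using Ga that by (simp add: f_def)
  have sf: "smooth_on (f \<kappa>) UNIV" for \<kappa>
  proof (rule smooth_on_glue_zero[OF _ a])
    show "smooth_on (f \<kappa>) {0<..}" unfolding f_def
      by (intro smooth_on_mult smooth_Ek smooth_on_subset[OF G] smooth_on_const) auto
  qed (use f0 in auto)
  obtain A where A: "smooth_on A UNIV" "\<And>s. Dr A s = f k s" "\<And>s. s \<le> \<alpha> \<Longrightarrow> A s = 0"
    using antiderivative_smooth[OF sf f0] by metis
  obtain B where B: "smooth_on B UNIV" "\<And>s. Dr B s = f (-k) s" "\<And>s. s \<le> \<alpha> \<Longrightarrow> B s = 0"
    using antiderivative_smooth[OF sf f0] by metis
  define y where "y s = Ek k 0 s * A s + Ek (-k) 0 s * B s" for s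
  have y0: "y s = 0" if "s \<le> \<alpha>" for s using A(3) B(3) that by (simp add: y_def)
  have sA: "smooth_on A ?I" "smooth_on B ?I" using A(1) B(1) smooth_on_subset by blast+
  have sy: "smooth_on y ?I"
    unfolding y_def[abs_def] by (intro smooth_on_add smooth_on_mult smooth_Ek sA) auto
  \<comment> \<open>The usual side condition of the method: derivatives of the coefficients do not
    show up in y'.\<close>
  have f_id: "Ek k m s * f k s + Ek (-k) m s * f (-k) s = 0" for m s
    using k by (simp add: f_def Ek_def exp_minus field_simps)
  have d1: "Dr y s = Dr (Ek k 0) s * A s + Dr (Ek (-k) 0) s * B s" if "s \<in> ?I" for s
    unfolding y_def[abs_def] using that sA smooth_Ek f_id[of 0 s] A(2) B(2)
    by (subst Dr_add[where I="?I"]) (auto simp: Dr_mult[where I="?I"] algebra_simps intro!: smooth_on_mult)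
  have d2: "Dr (Dr y) s = Dr (Dr (Ek k 0)) s * A s + Dr (Dr (Ek (-k) 0)) s * B s
      + (Dr (Ek k 0) s * f k s + Dr (Ek (-k) 0) s * f (-k) s)" if "s \<in> ?I" for s
  proof -
    have "Dr (Dr y) s = Dr (\<lambda>s. Dr (Ek k 0) s * A s + Dr (Ek (-k) 0) s * B s) s"
      by (rule Dr_cong[OF _ that d1]) auto
    also have "\<dots> = Dr (Dr (Ek k 0)) s * A s + Dr (Dr (Ek (-k) 0)) s * B s
      + (Dr (Ek k 0) s * f k s + Dr (Ek (-k) 0) s * f (-k) s)"
      using that sA smooth_on_Dr[OF smooth_Ek] A(2) B(2)
      by (subst Dr_add[where I="?I"]) (auto simp: Dr_mult[where I="?I"] intro!: smooth_on_mult)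
    finally show ?thesis .
  qed
  have L: "Lop k 2 y s = G s" if s: "0 < s" for s
  proof -
    \<comment> \<open>The second condition: the coefficient derivatives that remain in y'' reproduce
      G after multiplication by the leading coefficient 4 s.\<close>
    have jump: "of_real (4 * s) * (Dr (Ek k 0) s * f k s + Dr (Ek (-k) 0) s * f (-k) s) = G s"
    proof -
      have E1: "Ek k 1 s * Ek (-k) 1 s = inverse (of_real s)"
        using s by (simp add: Ek_def exp_minus field_simps flip: of_real_mult)
      have "Dr (Ek k 0) s * f k s + Dr (Ek (-k) 0) s * f (-k) s
         = G s * (Ek k 1 s * Ek (-k) 1 s) * (1 / 4)"
      proof -
        have D: "Dr (Ek k 0) s = \<i> * of_real k / 2 * Ek k 1 s" "Dr (Ek (-k) 0) s = - (\<i> * of_real k / 2) * Ek (-k) 1 s"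
          using Dr_Ek[OF s, of k 0] Dr_Ek[OF s, of "-k" 0] by simp_all
        show ?thesis unfolding D f_def using k by (simp add: field_simps)
      qed
      then show ?thesis unfolding E1 mult.assoc using s by (simp add: field_simps)
    qed
    have "Lop k 2 y s = A s * Lop k 2 (Ek k 0) s + B s * Lop k 2 (Ek (-k) 0) s
      + of_real (4 * s) * (Dr (Ek k 0) s * f k s + Dr (Ek (-k) 0) s * f (-k) s)"
      unfolding Lop_def using d1[of s] d2[of s] s by (simp add: y_def algebra_simps)
    then show ?thesis using jump Lop_Ek[OF s, of k k] Lop_Ek[OF s, of "-k" k] by simp
  qed
  show ?thesis
  proof (rule that[of y "A \<beta>" "B \<beta>"])
    show "smooth_on y UNIV" by (rule smooth_on_glue_zero[OF sy a]) (use y0 in auto)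
    fix s assume s: "\<beta> \<le> s"
    have "A s = A \<beta>" using A Gb by (intro Dr_zero_imp_const[OF A(1) _ _ s]) (auto simp: f_def)
    moreover have "B s = B \<beta>" using B Gb by (intro Dr_zero_imp_const[OF B(1) _ _ s]) (auto simp: f_def)
    ultimately show "y s = A \<beta> * Ek k 0 s + B \<beta> * Ek (- k) 0 s" by (simp add: y_def)
  qed (use y0 L in auto)
qed

lemma smooth_power_series:
  fixes c :: "nat \<Rightarrow> complex"
  assumes "\<And>z. summable (\<lambda>n. c n * z ^ n)"
  shows "smooth_on (\<lambda>s. \<Sum>n. c n * complex_of_real s ^ n) UNIV"
proof -
  have d: "((\<lambda>s. \<Sum>n. c n * complex_of_real s ^ n) has_vector_derivative
      (\<Sum>n. diffs c n * complex_of_real s ^ n)) (at s)" if "\<And>z. summable (\<lambda>n. c n * z ^ n)" for s c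
  proof -
    have "((\<lambda>z. \<Sum>n. c n * z ^ n) has_field_derivative (\<Sum>n. diffs c n * complex_of_real s ^ n)) (at (of_real s))"
      by (rule termdiffs_strong_converges_everywhere[OF that])
    moreover have "((\<lambda>s. complex_of_real s) has_vector_derivative of_real 1) (at s)"
      by (rule has_vector_derivative_of_real) (auto intro!: derivative_eq_intros)
    ultimately show ?thesis
      using field_vector_diff_chain_at by (fastforce simp: o_def)
  qed
  have "Ck_on n (\<lambda>s. \<Sum>n. c n * complex_of_real s ^ n) UNIV" for n
    using assms
  proof (induction n arbitrary: c)
    case 0
    have "continuous (at s) (\<lambda>s. \<Sum>n. c n * complex_of_real s ^ n)" for s
      using has_vector_derivative_continuous[OF d[OF 0]] .
    then show ?case by (auto intro!: continuous_at_imp_continuous_on)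
  next
    case (Suc n)
    have "summable (\<lambda>n. diffs c n * z ^ n)" for z by (rule termdiff_converges_all[OF Suc.prems])
    from Suc.IH[OF this] have "Ck_on n (\<lambda>s. \<Sum>n. diffs c n * complex_of_real s ^ n) UNIV" .
    then show ?case
      using d[OF Suc.prems]
      by (intro Ck_on_SucI[where f'="\<lambda>s v. v *\<^sub>R (\<Sum>n. diffs c n * complex_of_real s ^ n)"])
        (auto simp: has_vector_derivative_def intro!: Ck_on_bilinear[OF _ bounded_bilinear_scaleR] Ck_on_const)
  qed
  then show ?thesis by (simp add: smooth_on_def)
qed

text \<open>cos(k r) is even in r, hence given by an everywhere convergent power series in s = r^2,
  in contrast to exp(i k r). It is the standing wave, smooth at the centre, that later cancels
  incoming parts.\<close>

lemma smooth_cos_sqrt: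
  obtains y where "smooth_on y UNIV" "\<And>s. 0 \<le> s \<Longrightarrow> y s = Ek k 0 s / 2 + Ek (- k) 0 s / 2"
proof -
  define c where "c n = complex_of_real ((- 1) ^ n / fact (2 * n) * (k\<^sup>2) ^ n)" for n
  have sums: "(\<lambda>n. c n * complex_of_real s ^ n) sums of_real (cos (k * sqrt s))" if "0 \<le> s" for s
  proof -
    have "(\<lambda>n. complex_of_real ((- 1) ^ n / fact (2 * n) * (k * sqrt s) ^ (2 * n))) sums of_real (cos (k * sqrt s))"
      using cos_paired[of "k * sqrt s"] by (rule sums_of_real)
    moreover have "(k * sqrt s) ^ (2 * n) = (k\<^sup>2) ^ n * s ^ n" for n
      using that by (simp add: power_mult power_mult_distrib)
    ultimately show ?thesis by (simp add: c_def mult.assoc)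
  qed
  \<comment> \<open>Convergence to the cosine at the larger real point norm z + 1 yields convergence
    at the complex point z.\<close>
  have "summable (\<lambda>n. c n * z ^ n)" for z
    using powser_inside[OF sums_summable[OF sums[of "norm z + 1"]], of z] by simp
  from smooth_power_series[OF this]
  have "smooth_on (\<lambda>s. \<Sum>n. c n * complex_of_real s ^ n) UNIV" .
  moreover have "(\<Sum>n. c n * complex_of_real s ^ n) = Ek k 0 s / 2 + Ek (- k) 0 s / 2" if "0 \<le> s" for s
    using sums_unique[OF sums[OF that]] cos_exp_eq[of "complex_of_real (k * sqrt s)"]
    by (simp add: Ek_def cos_of_real[symmetric] add_divide_distrib)
  ultimately show ?thesis using that by blast
qed

section \<open>Moments against (a \<bullet> (x - c))^l h(|x - c|^2) and the descent in the number of
  derivatives\<close>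

section \<open>Radial moments of locally integrable functions\<close>

definition loc_integrable :: "(real^3 \<Rightarrow> complex) \<Rightarrow> bool" where
  "loc_integrable v \<longleftrightarrow> (\<forall>r. integrable lebesgue (\<lambda>x. indicator (ball 0 r) x *\<^sub>R v x))"

lemma continuous_borel_measurable_lebesgue:
  fixes f :: "'a::euclidean_space \<Rightarrow> 'b::euclidean_space"
  shows "continuous_on UNIV f \<Longrightarrow> f \<in> borel_measurable lebesgue"
  using measurable_completion[of f lborel borel] borel_measurable_continuous_onI[of f] by simp

lemma loc_integrable_mult:
  assumes "loc_integrable v" "f \<in> borel_measurable lebesgue" "\<And>x. norm (f x) \<le> B" "\<And>x. r \<le> norm x \<Longrightarrow> f x = 0"
  shows "integrable lebesgue (\<lambda>x. v x * f x)"
proof -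
  let ?w = "\<lambda>x. indicator (ball 0 r) x *\<^sub>R v x"
  have w: "integrable lebesgue ?w" using assms(1) by (simp add: loc_integrable_def)
  have eq: "v x * f x = ?w x * f x" for x
    using assms(4)[of x] by (cases "norm x < r") (auto simp: indicator_def)
  have "integrable lebesgue (\<lambda>x. ?w x * f x)"
  proof (rule Bochner_Integration.integrable_bound[of _ "\<lambda>x. B * norm (?w x)"])
    show "integrable lebesgue (\<lambda>x. B * norm (?w x))" by (intro integrable_mult_right integrable_norm w)
    show "(\<lambda>x. ?w x * f x) \<in> borel_measurable lebesgue"
      using borel_measurable_integrable[OF w] assms(2) by (rule borel_measurable_times)
    show "AE x in lebesgue. norm (?w x * f x) \<le> norm (B * norm (?w x))"
    proof (rule AE_I2)
      fix x
      have "norm (f x) * norm (?w x) \<le> B * norm (?w x)" using assms(3) by (intro mult_right_mono) auto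
      also have "\<dots> \<le> norm (B * norm (?w x))" unfolding real_norm_def by (rule abs_ge_self)
      finally show "norm (?w x * f x) \<le> norm (B * norm (?w x))" by (simp only: norm_mult mult.commute)
    qed
  qed
  then show ?thesis by (rule Bochner_Integration.integrable_cong[THEN iffD2, OF refl eq])
qed

lemma bounded_of_compact_support:
  fixes f :: "real^3 \<Rightarrow> 'b::real_normed_vector"
  assumes "continuous_on UNIV f" "\<And>x. r \<le> norm x \<Longrightarrow> f x = 0"
  obtains B where "0 \<le> B" "\<And>x. norm (f x) \<le> B"
proof -
  have "compact (f ` cball 0 r)"
    using assms(1) continuous_on_subset by (intro compact_continuous_image) auto
  then obtain B where B: "\<And>x. x \<in> cball 0 r \<Longrightarrow> norm (f x) \<le> B"
    by (meson bounded_iff compact_imp_bounded imageI)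
  have "norm (f x) \<le> max B 0" for x
    using B[of x] assms(2)[of x] by (cases "norm x \<le> r") auto
  then show ?thesis using that[of "max B 0"] by simp
qed

lemma loc_integrable_mult_continuous:
  assumes "loc_integrable v" "continuous_on UNIV f" "\<And>x. r \<le> norm x \<Longrightarrow> f x = 0"
  shows "integrable lebesgue (\<lambda>x. v x * f x)"
proof -
  obtain B where "\<And>x. norm (f x) \<le> B" using bounded_of_compact_support[OF assms(2,3)] by blast
  from loc_integrable_mult[OF assms(1) continuous_borel_measurable_lebesgue[OF assms(2)] this assms(3)]
  show ?thesis .
qed

text \<open>Profiles in the variable s = |x - c|^2, where J selects a shell. An open J keeps
  supports away from its ends; J = UNIV also admits profiles that do not vanish at s = 0, so that
  the test function reaches the centre.\<close>

definition tests :: "real set \<Rightarrow> (real \<Rightarrow> complex) \<Rightarrow> bool" where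
  "tests J h \<longleftrightarrow> smooth_on h UNIV \<and> (\<exists>K. compact K \<and> K \<subseteq> J \<and> (\<forall>s. s \<notin> K \<longrightarrow> h s = 0))"

lemma tests_Dr:
  assumes "tests J h" shows "tests J (Dr h)"
proof -
  obtain K where K: "smooth_on h UNIV" "compact K" "K \<subseteq> J" "\<And>s. s \<notin> K \<Longrightarrow> h s = 0"
    using assms unfolding tests_def by blast
  have "Dr h s = 0" if "s \<notin> K" for s
    using Dr_eq_0_outside[OF compact_imp_closed[OF K(2)] K(4) that, where n=1] by simp
  then show ?thesis using K smooth_on_Dr[OF K(1)] unfolding tests_def by auto
qed

lemma tests_Dr_iter: "tests J h \<Longrightarrow> tests J ((Dr ^^ n) h)"
  by (induction n) (auto intro: tests_Dr)

lemma tests_Lop: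
  assumes "tests J h" shows "tests J (Lop k c h)"
proof -
  obtain K where K: "smooth_on h UNIV" "compact K" "K \<subseteq> J" "\<And>s. s \<notin> K \<Longrightarrow> h s = 0"
    using assms unfolding tests_def by blast
  have "Lop k c h s = 0" if "s \<notin> K" for s
    using Dr_eq_0_outside[OF compact_imp_closed[OF K(2)] K(4) that, where n=1]
      Dr_eq_0_outside[OF compact_imp_closed[OF K(2)] K(4) that, where n=2] K(4)[OF that]
    by (simp add: Lop_def numeral_2_eq_2)
  then show ?thesis using K smooth_Lop[OF K(1)] unfolding tests_def by auto
qed

lemma tests_Mop:
  assumes "tests J h" shows "tests J (Mop c h)"
proof -
  obtain K where K: "smooth_on h UNIV" "compact K" "K \<subseteq> J" "\<And>s. s \<notin> K \<Longrightarrow> h s = 0"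
    using assms unfolding tests_def by blast
  have "Mop c h s = 0" if "s \<notin> K" for s
    using Dr_eq_0_outside[OF compact_imp_closed[OF K(2)] K(4) that, where n=1] K(4)[OF that]
    by (simp add: Mop_def)
  then show ?thesis using K smooth_Mop[OF K(1)] unfolding tests_def by auto
qed

lemma tests_mono: "tests J h \<Longrightarrow> J \<subseteq> J' \<Longrightarrow> tests J' h"
  unfolding tests_def by blast

lemma tests_smooth: "tests J h \<Longrightarrow> smooth_on h UNIV"
  unfolding tests_def by blast

lemma tests_bounded_support:
  assumes "tests J h" obtains r where "0 < r" "\<And>s. r \<le> s \<Longrightarrow> h s = 0"
proof -
  obtain K where K: "compact K" "\<And>s. s \<notin> K \<Longrightarrow> h s = 0"
    using assms unfolding tests_def by blast
  obtain B where B: "\<And>s. s \<in> K \<Longrightarrow> \<bar>s\<bar> \<le> B"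
    using compact_imp_bounded[OF K(1)] unfolding bounded_iff by auto
  have "h s = 0" if "\<bar>B\<bar> + 1 \<le> s" for s using K(2)[of s] B[of s] that by force
  then show ?thesis using that[of "\<bar>B\<bar> + 1"] by simp
qed

definition sq_dist :: "real^3 \<Rightarrow> real^3 \<Rightarrow> real" where
  "sq_dist c x = (x - c) \<bullet> (x - c)"

lemma sq_dist_eq: "sq_dist c x = (norm (x - c))\<^sup>2"
  by (simp add: sq_dist_def power2_norm_eq_inner)

text \<open>For real a the power of a \<bullet> (x - c) is in general not harmonic, so order l is
  coupled to order l - 2. In return only powers of real linear forms occur, and these sum up to
  exponentials.\<close>

definition mom_test :: "real^3 \<Rightarrow> real^3 \<Rightarrow> nat \<Rightarrow> (real \<Rightarrow> complex) \<Rightarrow> real^3 \<Rightarrow> complex" where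
  "mom_test c a l h x = of_real (a \<bullet> (x - c)) ^ l * h (sq_dist c x)"

definition mom :: "(real^3 \<Rightarrow> complex) \<Rightarrow> real^3 \<Rightarrow> real^3 \<Rightarrow> nat \<Rightarrow> (real \<Rightarrow> complex) \<Rightarrow> complex" where
  "mom v c a l h = (LINT x|lebesgue. v x * mom_test c a l h x)"

lemma continuous_mom_test:
  assumes "continuous_on UNIV h"
  shows "continuous_on UNIV (mom_test c a l h)"
proof -
  have "continuous_on UNIV (sq_dist c)"
    unfolding sq_dist_def[abs_def] by (intro continuous_intros)
  then have "continuous_on UNIV (\<lambda>x. h (sq_dist c x))"
    using continuous_on_compose2[OF assms] by blast
  then show ?thesis
    unfolding mom_test_def[abs_def] by (intro continuous_intros)
qed

lemma mom_test_outside: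
  assumes "\<And>s. r \<le> s \<Longrightarrow> h s = 0" "0 < r" "norm c + r + 1 \<le> norm x"
  shows "mom_test c a l h x = 0"
proof -
  have "r + 1 \<le> norm (x - c)" using assms(3) norm_triangle_ineq2[of x c] by linarith
  then have "(r + 1)\<^sup>2 \<le> (norm (x - c))\<^sup>2" using assms(2) by (intro power_mono) auto
  moreover have "r \<le> (r + 1)\<^sup>2" using assms(2) by (simp add: power2_eq_square algebra_simps)
  ultimately show ?thesis using assms(1) by (simp add: mom_test_def sq_dist_eq)
qed

lemma mom_integrable:
  assumes "loc_integrable v" "tests J h"
  shows "integrable lebesgue (\<lambda>x. v x * mom_test c a l h x)"
proof -
  obtain r where r: "0 < r" "\<And>s. r \<le> s \<Longrightarrow> h s = 0" using tests_bounded_support[OF assms(2)] by blast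
  have 1: "continuous_on UNIV (mom_test c a l h)"
    by (rule continuous_mom_test[OF smooth_on_continuous[OF tests_smooth[OF assms(2)]]])
  have 2: "mom_test c a l h x = 0" if "norm c + r + 1 \<le> norm x" for x
    by (rule mom_test_outside[OF r(2) r(1) that])
  from 1 2 show ?thesis by (rule loc_integrable_mult_continuous[OF assms(1)])
qed

lemma mom_lincomb:
  assumes "loc_integrable v" "tests J f" "tests J g"
  shows "mom v c a l (\<lambda>s. p * f s + q * g s) = p * mom v c a l f + q * mom v c a l g"
proof -
  note i = mom_integrable[OF assms(1,2), where c=c and a=a and l=l]
    mom_integrable[OF assms(1,3), where c=c and a=a and l=l]
  have "mom v c a l (\<lambda>s. p * f s + q * g s)
      = (LINT x|lebesgue. p * (v x * mom_test c a l f x) + q * (v x * mom_test c a l g x))"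
    unfolding mom_def by (rule Bochner_Integration.integral_cong) (simp_all add: mom_test_def distrib_left mult_ac)
  also have "\<dots> = p * mom v c a l f + q * mom v c a l g"
    unfolding mom_def
    by (subst Bochner_Integration.integral_add[OF integrable_mult_right[OF i(1)] integrable_mult_right[OF i(2)]])
      (simp only: integral_mult_right_zero)
  finally show ?thesis .
qed

text \<open>Since \<open>Dr (Mop c g) = Lop k c g - k\<^sup>2 g\<close>, functionals killing the range of \<open>Lop\<close> see
  \<open>g\<close> and \<open>- Dr (Mop c g) / k\<^sup>2\<close> alike.\<close>

lemma functional_descent:
  fixes \<Lambda> :: "(real \<Rightarrow> complex) \<Rightarrow> complex"
  assumes "0 < k"
    and lin: "\<And>f g p q. tests J f \<Longrightarrow> tests J g \<Longrightarrow> \<Lambda> (\<lambda>s. p * f s + q * g s) = p * \<Lambda> f + q * \<Lambda> g"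
    and eq: "\<And>h. tests J h \<Longrightarrow> \<Lambda> (Lop k (4 * real l + 6) h) = 0"
    and top: "\<And>G. tests J G \<Longrightarrow> \<Lambda> ((Dr ^^ (l + 1)) G) = 0"
    and h: "tests J h"
  shows "\<Lambda> h = 0"
proof -
  have step: "\<Lambda> ((Dr ^^ n) g) = 0"
    if IH: "\<And>g. tests J g \<Longrightarrow> \<Lambda> ((Dr ^^ Suc n) g) = 0" and g: "tests J g" for n g
  proof -
    \<comment> \<open>Chosen so that n derivatives raise c to 4 l + 6, the coefficient for which
      \<Lambda> vanishes on the range.\<close>
    define c where "c = 4 * real l + 6 - 4 * real n"
    have sg: "smooth_on g UNIV" using g by (rule tests_smooth)
    have "(Dr ^^ Suc n) (Mop c g) s = 1 * Lop k (4 * real l + 6) ((Dr ^^ n) g) s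
        + - of_real (k\<^sup>2) * (Dr ^^ n) g s" for s
    proof -
      have "(Dr ^^ Suc n) (Mop c g) s = (Dr ^^ n) (Dr (Mop c g)) s"
        by (simp add: funpow_swap1)
      also have "\<dots> = (Dr ^^ n) (\<lambda>s. 1 * Lop k c g s + - of_real (k\<^sup>2) * g s) s"
        by (rule Dr_iter_cong[of UNIV]) (use Dr_Mop[OF sg] in auto)
      also have "\<dots> = 1 * (Dr ^^ n) (Lop k c g) s + - of_real (k\<^sup>2) * (Dr ^^ n) g s"
        by (rule Dr_iter_lincomb[OF smooth_Lop[OF sg] sg]) auto
      also have "(Dr ^^ n) (Lop k c g) s = Lop k (4 * real l + 6) ((Dr ^^ n) g) s"
        using Dr_iter_Lop[OF sg, of s n k c] by (simp add: c_def)
      finally show ?thesis .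
    qed
    then have "(Dr ^^ Suc n) (Mop c g) = (\<lambda>s. 1 * Lop k (4 * real l + 6) ((Dr ^^ n) g) s
        + - of_real (k\<^sup>2) * (Dr ^^ n) g s)" by (rule ext)
    moreover have "\<Lambda> ((Dr ^^ Suc n) (Mop c g)) = 0" by (rule IH[OF tests_Mop[OF g]])
    ultimately have "0 = 1 * \<Lambda> (Lop k (4 * real l + 6) ((Dr ^^ n) g)) + - of_real (k\<^sup>2) * \<Lambda> ((Dr ^^ n) g)"
      using lin[OF tests_Lop[OF tests_Dr_iter[OF g]] tests_Dr_iter[OF g]] by metis
    then show ?thesis using eq[OF tests_Dr_iter[OF g]] \<open>0 < k\<close> by simp
  qed
  \<comment> \<open>Descending induction: d counts how many of the l + 1 derivatives have been
    removed.\<close>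
  have "\<Lambda> ((Dr ^^ (l + 1 - d)) g) = 0" if "d \<le> l + 1" "tests J g" for d g
    using that
  proof (induction d arbitrary: g)
    case 0
    then show ?case using top[of g] by simp
  next
    case (Suc d)
    have "Suc (l + 1 - Suc d) = l + 1 - d" using Suc.prems by simp
    then have "\<Lambda> ((Dr ^^ Suc (l + 1 - Suc d)) g') = 0" if "tests J g'" for g'
      using Suc.IH[of g'] Suc.prems(1) that by simp
    then show ?case using Suc.prems(2) by (rule step)
  qed
  from this[of "l + 1" h] show ?thesis using h by simp
qed

section \<open>Vanishing of all moments on a shell forces the function to vanish there\<close>

subsection \<open>Functions with vanishing moments\<close>

text \<open>Real exponentials multiply by adding their exponents, so their span is already an
  algebra that contains the constants and separates points, as Stone-Weierstrass requires.\<close>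

inductive_set exp_span :: "(real^3 \<Rightarrow> real) set" where
  base: "(\<lambda>x. p * exp (a \<bullet> x)) \<in> exp_span"
| add: "f \<in> exp_span \<Longrightarrow> g \<in> exp_span \<Longrightarrow> (\<lambda>x. f x + g x) \<in> exp_span"

lemma exp_span_mult_base: "f \<in> exp_span \<Longrightarrow> (\<lambda>x. f x * (p * exp (a \<bullet> x))) \<in> exp_span"
proof (induction rule: exp_span.induct)
  case (base q b)
  have "(\<lambda>x. q * exp (b \<bullet> x) * (p * exp (a \<bullet> x))) = (\<lambda>x. (q * p) * exp ((b + a) \<bullet> x))"
    by (auto simp: inner_add_left exp_add)
  then show ?case using exp_span.base by metis
next
  case (add f g)
  then show ?case using exp_span.add[OF add.IH] by (simp add: distrib_right)
qed

lemma exp_span_mult: "g \<in> exp_span \<Longrightarrow> f \<in> exp_span \<Longrightarrow> (\<lambda>x. f x * g x) \<in> exp_span"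
proof (induction rule: exp_span.induct)
  case (base p a)
  then show ?case using exp_span_mult_base by blast
next
  case (add g h)
  then show ?case using exp_span.add[OF add.IH] by (simp add: distrib_left)
qed

lemma exp_span_continuous: "f \<in> exp_span \<Longrightarrow> continuous_on S f"
  by (induction rule: exp_span.induct) (auto intro!: continuous_intros)

lemma exp_span_dense:
  fixes f :: "real^3 \<Rightarrow> real"
  assumes "compact S" "continuous_on S f" "0 < e"
  obtains g where "g \<in> exp_span" "\<And>x. x \<in> S \<Longrightarrow> \<bar>f x - g x\<bar> < e"
proof -
  interpret function_ring_on exp_span S
  proof
    show "(\<lambda>_. c) \<in> exp_span" for c using exp_span.base[of c 0] by simp
    show "\<exists>f\<in>exp_span. f x \<noteq> f y" if "x \<in> S" "y \<in> S" "x \<noteq> y" for x y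
    proof -
      have "(x - y) \<bullet> x \<noteq> (x - y) \<bullet> y"
        using that(3) by (metis eq_iff_diff_eq_0 inner_diff_right inner_eq_zero_iff)
      then have "1 * exp ((x - y) \<bullet> x) \<noteq> 1 * exp ((x - y) \<bullet> y)" by simp
      then show ?thesis using exp_span.base[of 1 "x - y"] by (metis (mono_tags, lifting))
    qed
  qed (use assms exp_span.add exp_span_mult exp_span_continuous in auto)
  obtain g where "g \<in> exp_span" "\<forall>x\<in>S. \<bar>f x - g x\<bar> < e"
    using Stone_Weierstrass_basic[OF assms(2,3)] by blast
  then show ?thesis using that by blast
qed

text \<open>Testing with the conjugate phase of w would give the integral of |w|. The phase is only
  measurable, so continuous functions converging to it almost everywhere take its place.\<close>

lemma AE_zero_if_continuous_integrals_zero: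
  fixes w :: "real^3 \<Rightarrow> complex"
  assumes w: "integrable lebesgue w"
    and z: "\<And>f. continuous_on UNIV f \<Longrightarrow> (\<And>x. norm (f x) \<le> 1) \<Longrightarrow> (LINT x|lebesgue. w x * f x) = 0"
  shows "AE x in lebesgue. w x = 0"
proof -
  have wm: "w \<in> borel_measurable lebesgue" using w by (rule borel_measurable_integrable)
  define u where "u x = cnj (w x) / of_real (norm (w x))" for x
  have um: "u \<in> borel_measurable lebesgue"
  proof -
    have "(\<lambda>x. cnj (w x)) \<in> borel_measurable lebesgue"
      using wm by (rule borel_measurable_continuous_on[OF continuous_on_cnj[OF continuous_on_id]])
    moreover have "(\<lambda>x. complex_of_real (norm (w x))) \<in> borel_measurable lebesgue" using wm by measurable
    ultimately show ?thesis unfolding u_def[abs_def] by (rule borel_measurable_divide)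
  qed
  have "u measurable_on UNIV" using um by (simp add: measurable_on_iff_borel_measurable)
  then obtain N g where N: "negligible N" and g: "\<And>n. continuous_on UNIV (g n)"
    and lim: "\<And>x. x \<notin> N \<Longrightarrow> (\<lambda>n. g n x) \<longlonglongrightarrow> u x"
    unfolding measurable_on_def by auto
  \<comment> \<open>Radial retraction to the closed unit disc. It keeps the approximants bounded by
    1, so that |w| dominates, and it fixes the phase \<open>u\<close>, whose modulus is at most
    1.\<close>
  define cl where "cl z = z / of_real (max 1 (norm z))" for z :: complex
  have cl_le: "norm (cl z) \<le> 1" for z
    by (auto simp: cl_def norm_divide divide_le_eq)
  have cl_cont: "continuous_on UNIV cl"
    unfolding cl_def[abs_def] by (intro continuous_intros) (auto simp: max_def split: if_splits)
  have cu: "cl (u x) = u x" for x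
    by (cases "w x = 0") (auto simp: cl_def u_def norm_divide)
  have AEN: "AE x in lebesgue. x \<notin> N"
    using N by (simp add: AE_iff_null_sets negligible_iff_null_sets AE_not_in)
  have "(\<lambda>n. LINT x|lebesgue. w x * cl (g n x)) \<longlonglongrightarrow> (LINT x|lebesgue. of_real (norm (w x)))"
  proof (rule integral_dominated_convergence[where w="\<lambda>x. norm (w x)"])
    show "(\<lambda>x. complex_of_real (norm (w x))) \<in> borel_measurable lebesgue" using wm by measurable
    have "continuous_on UNIV (\<lambda>x. cl (g n x))" for n
      using continuous_on_compose2[OF cl_cont g] by blast
    then show "(\<lambda>x. w x * cl (g n x)) \<in> borel_measurable lebesgue" for n
      by (intro borel_measurable_times wm continuous_borel_measurable_lebesgue)
    show "AE x in lebesgue. (\<lambda>n. w x * cl (g n x)) \<longlonglongrightarrow> of_real (norm (w x))"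
      using AEN
    proof eventually_elim
      case (elim x)
      have "(\<lambda>n. cl (g n x)) \<longlonglongrightarrow> cl (u x)"
        using lim[OF elim] cl_cont by (intro continuous_on_tendsto_compose[OF cl_cont]) auto
      then have "(\<lambda>n. w x * cl (g n x)) \<longlonglongrightarrow> w x * u x" unfolding cu by (intro tendsto_intros)
      moreover have "w x * u x = of_real (norm (w x))"
        by (cases "w x = 0") (auto simp: u_def complex_norm_square[symmetric] power2_eq_square field_simps)
      ultimately show ?case by simp
    qed
    show "AE x in lebesgue. norm (w x * cl (g n x)) \<le> norm (w x)" for n
      using cl_le by (auto simp: norm_mult mult_left_le)
  qed (use w in auto)
  moreover have "(LINT x|lebesgue. w x * cl (g n x)) = 0" for n
    using z[OF continuous_on_compose2[OF cl_cont g]] cl_le by blast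
  ultimately have "(LINT x|lebesgue. complex_of_real (norm (w x))) = 0"
    by (simp add: LIMSEQ_const_iff)
  then have "(LINT x|lebesgue. norm (w x)) = 0" by simp
  then have "AE x in lebesgue. norm (w x) = 0"
    using w by (subst (asm) integral_nonneg_eq_0_iff_AE) auto
  then show ?thesis by simp
qed

text \<open>On the ball that carries w, continuous real functions are uniform limits of combinations
  of exponentials, and integrability of w transfers this to the integrals. Complex functions are
  split into real and imaginary parts.\<close>

lemma AE_zero_if_exp_integrals_zero:
  fixes w :: "real^3 \<Rightarrow> complex"
  assumes w: "integrable lebesgue w" and supp: "\<And>x. r \<le> norm x \<Longrightarrow> w x = 0"
    and z: "\<And>a. (LINT x|lebesgue. w x * of_real (exp (a \<bullet> x))) = 0"
  shows "AE x in lebesgue. w x = 0"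
proof (rule AE_zero_if_continuous_integrals_zero[OF w])
  have wm: "w \<in> borel_measurable lebesgue" using w by (rule borel_measurable_integrable)
  have ig: "integrable lebesgue (\<lambda>x. w x * of_real (g x))" if g: "continuous_on UNIV g" for g
  proof -
    have "compact (g ` cball 0 r)"
      using g continuous_on_subset by (intro compact_continuous_image) auto
    then obtain B where B: "\<And>x. x \<in> cball 0 r \<Longrightarrow> \<bar>g x\<bar> \<le> B"
      by (metis bounded_iff compact_imp_bounded imageI real_norm_def)
    show ?thesis
    proof (rule Bochner_Integration.integrable_bound[of _ "\<lambda>x. \<bar>B\<bar> * norm (w x)"])
      show "(\<lambda>x. w x * of_real (g x)) \<in> borel_measurable lebesgue"
        by (intro borel_measurable_times wm continuous_borel_measurable_lebesgue continuous_on_of_real g)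
      show "AE x in lebesgue. norm (w x * of_real (g x)) \<le> norm (\<bar>B\<bar> * norm (w x))"
      proof (rule AE_I2)
        fix x show "norm (w x * of_real (g x)) \<le> norm (\<bar>B\<bar> * norm (w x))"
        proof (cases "norm x \<le> r")
          case True
          then have "\<bar>g x\<bar> * norm (w x) \<le> \<bar>B\<bar> * norm (w x)"
            using B[of x] by (intro mult_right_mono) auto
          then show ?thesis by (simp add: norm_mult mult.commute)
        qed (use supp in auto)
      qed
    qed (use w in auto)
  qed
  have zs: "(LINT x|lebesgue. w x * of_real (g x)) = 0" if "g \<in> exp_span" for g
    using that
  proof (induction rule: exp_span.induct)
    case (base p a)
    have "(LINT x|lebesgue. of_real p * (w x * of_real (exp (a \<bullet> x)))) = 0"
      using z[of a] by simp
    then show ?case by (simp add: algebra_simps)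
  next
    case (add f g)
    then show ?case using ig[OF exp_span_continuous[OF add.hyps(1)]] ig[OF exp_span_continuous[OF add.hyps(2)]]
      by (simp add: distrib_left)
  qed
  have zr: "(LINT x|lebesgue. w x * of_real (f x)) = 0" if f: "continuous_on UNIV f" for f :: "real^3 \<Rightarrow> real"
  proof -
    have small: "norm (LINT x|lebesgue. w x * of_real (f x)) \<le> e * (LINT x|lebesgue. norm (w x))" if e: "0 < e" for e
    proof -
      have "compact (cball (0::real^3) r)" by simp
      from exp_span_dense[OF this continuous_on_subset[OF f subset_UNIV] e]
      obtain g where g: "g \<in> exp_span" "\<And>x. x \<in> cball 0 r \<Longrightarrow> \<bar>f x - g x\<bar> < e" by blast
      have "(LINT x|lebesgue. w x * of_real (f x)) = (LINT x|lebesgue. w x * of_real (f x) - w x * of_real (g x))"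
        using zs[OF g(1)] ig[OF f] ig[OF exp_span_continuous[OF g(1)]] by simp
      also have "norm \<dots> \<le> (LINT x|lebesgue. e * norm (w x))"
      proof (rule order.trans[OF integral_norm_bound integral_mono])
        show "integrable lebesgue (\<lambda>x. norm (w x * of_real (f x) - w x * of_real (g x)))"
          using ig[OF f] ig[OF exp_span_continuous[OF g(1)]] by (intro integrable_norm Bochner_Integration.integrable_diff)
        show "integrable lebesgue (\<lambda>x. e * norm (w x))" by (intro integrable_mult_right integrable_norm w)
        fix x
        show "norm (w x * of_real (f x) - w x * of_real (g x)) \<le> e * norm (w x)"
        proof (cases "norm x \<le> r")
          case True
          have "norm (w x * of_real (f x) - w x * of_real (g x)) = norm (w x) * \<bar>f x - g x\<bar>"
            by (metis norm_mult norm_of_real of_real_diff right_diff_distrib)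
          also have "\<dots> \<le> norm (w x) * e" using g(2)[of x] True by (intro mult_left_mono) auto
          finally show ?thesis by (simp add: mult.commute)
        qed (use supp in auto)
      qed
      finally show ?thesis by simp
    qed
    have "norm (LINT x|lebesgue. w x * of_real (f x)) \<le> 0"
    proof (rule ccontr)
      assume "\<not> ?thesis"
      then have p: "0 < norm (LINT x|lebesgue. w x * of_real (f x))" by simp
      define M where "M = (LINT x|lebesgue. norm (w x))"
      have M: "0 \<le> M" unfolding M_def by (rule integral_nonneg_AE) auto
      \<comment> \<open>With this e the estimate bounds the quantity by half of itself; M + 1 avoids
        a division by 0.\<close>
      define e where "e = norm (LINT x|lebesgue. w x * of_real (f x)) / (2 * (M + 1))"
      have "0 < e" using p M by (simp add: e_def)
      from small[OF this] have "norm (LINT x|lebesgue. w x * of_real (f x)) \<le> e * (M + 1)"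
        using \<open>0 < e\<close> unfolding M_def by (simp add: distrib_left)
      also have "\<dots> = norm (LINT x|lebesgue. w x * of_real (f x)) / 2" using M by (simp add: e_def field_simps)
      finally show False using p by simp
    qed
    then show ?thesis by simp
  qed
  fix f :: "real^3 \<Rightarrow> complex" assume f: "continuous_on UNIV f"
  have c: "continuous_on UNIV (\<lambda>x. Re (f x))" "continuous_on UNIV (\<lambda>x. Im (f x))"
    using f by (auto intro!: continuous_intros)
  have "w x * f x = w x * of_real (Re (f x)) + \<i> * (w x * of_real (Im (f x)))" for x
    by (subst complex_eq[of "f x"]) (simp add: algebra_simps)
  then have "(LINT x|lebesgue. w x * f x) = (LINT x|lebesgue. w x * of_real (Re (f x)) + \<i> * (w x * of_real (Im (f x))))"
    by presburger
  also have "\<dots> = 0" using zr[OF c(1)] zr[OF c(2)] ig[OF c(1)] ig[OF c(2)] by simp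
  finally show "(LINT x|lebesgue. w x * f x) = 0" .
qed

text \<open>A bump that is nonzero exactly on the shell is absorbed into v. The weights (a \<bullet>
  (x - c))^l / l! then sum to an exponential, so all exponential integrals vanish, and inside the
  shell the bump can be divided out again.\<close>

lemma AE_zero_if_moments_zero:
  assumes v: "loc_integrable v"
    and z: "\<And>a l h. tests J h \<Longrightarrow> mom v c a l h = 0"
    and J: "{\<alpha>..\<beta>} \<subseteq> J"
  shows "AE x in lebesgue. \<alpha> < sq_dist c x \<longrightarrow> sq_dist c x < \<beta> \<longrightarrow> v x = 0"
proof -
  obtain b :: "real \<Rightarrow> real" where b: "smooth_on (\<lambda>s. complex_of_real (b s)) UNIV"
    "\<And>s. b s \<noteq> 0 \<longleftrightarrow> \<alpha> < s \<and> s < \<beta>" using bump_function[of \<alpha> \<beta>] by metis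
  define h where "h s = complex_of_real (b s)" for s
  have h0: "h s = 0" if "s \<notin> {\<alpha>..\<beta>}" for s using b(2)[of s] that by (auto simp: h_def)
  have th: "tests J h" unfolding tests_def using b(1) h0 J
    by (intro conjI exI[of _ "{\<alpha>..\<beta>}"]) (auto simp: h_def[abs_def])
  define w where "w x = v x * h (sq_dist c x)" for x
  have w: "integrable lebesgue w"
    using mom_integrable[OF v th, where c=c and a=0 and l=0] by (simp add: w_def[abs_def] mom_test_def)
  obtain r where r: "0 < r" "\<And>s. r \<le> s \<Longrightarrow> h s = 0" using tests_bounded_support[OF th] by blast
  have supp: "w x = 0" if "norm c + r + 1 \<le> norm x" for x
    using mom_test_outside[where h=h and a=0 and l=0, OF r(2,1) that] by (simp add: w_def mom_test_def)
  \<comment> \<open>|x - c| \<ge> R implies |x| \<ge> |c| + r + 1, so w is carried by the ball of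
    radius R about c. There each partial sum of the exponential series is at most exp(|a| R), which
    gives the dominating function.\<close>
  define R where "R = 2 * norm c + r + 1"
  have supp': "w x = 0" if "R \<le> norm (x - c)" for x
    using that norm_triangle_ineq4[of x c] by (intro supp) (simp add: R_def)
  have wt: "(LINT x|lebesgue. w x * of_real ((a \<bullet> (x - c)) ^ l)) = 0" for a l
    using z[OF th, of a l] by (simp add: w_def mom_def mom_test_def algebra_simps)
  have wti: "integrable lebesgue (\<lambda>x. w x * of_real ((a \<bullet> (x - c)) ^ l))" for a l
    using mom_integrable[OF v th, where c=c and a=a and l=l] by (simp add: w_def mom_test_def algebra_simps)
  have "(LINT x|lebesgue. w x * of_real (exp (a \<bullet> x))) = 0" for a
  proof -
    let ?S = "\<lambda>n x. \<Sum>i<n. (a \<bullet> (x - c)) ^ i /\<^sub>R fact i"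
    have "(\<lambda>n. LINT x|lebesgue. w x * of_real (?S n x)) \<longlonglongrightarrow> (LINT x|lebesgue. w x * of_real (exp (a \<bullet> (x - c))))"
    proof (rule integral_dominated_convergence[where w="\<lambda>x. exp (norm a * R) * norm (w x)"])
      have wm: "w \<in> borel_measurable lebesgue" using w by (rule borel_measurable_integrable)
      show "(\<lambda>x. w x * of_real (exp (a \<bullet> (x - c)))) \<in> borel_measurable lebesgue"
        by (intro borel_measurable_times wm continuous_borel_measurable_lebesgue) (auto intro!: continuous_intros)
      show "(\<lambda>x. w x * of_real (?S n x)) \<in> borel_measurable lebesgue" for n
        by (intro borel_measurable_times wm continuous_borel_measurable_lebesgue) (auto intro!: continuous_intros)
      show "AE x in lebesgue. (\<lambda>n. w x * of_real (?S n x)) \<longlonglongrightarrow> w x * of_real (exp (a \<bullet> (x - c)))"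
        using exp_converges[where 'a=real] unfolding sums_def by (intro AE_I2 tendsto_intros)
      show "AE x in lebesgue. norm (w x * of_real (?S n x)) \<le> exp (norm a * R) * norm (w x)" for n
      proof (rule AE_I2)
        fix x
        show "norm (w x * of_real (?S n x)) \<le> exp (norm a * R) * norm (w x)"
        proof (cases "norm (x - c) < R")
          case True
          have "\<bar>?S n x\<bar> \<le> (\<Sum>i<n. \<bar>a \<bullet> (x - c)\<bar> ^ i /\<^sub>R fact i)"
            by (rule order.trans[OF sum_abs]) (simp add: power_abs abs_mult)
          also have "\<dots> \<le> exp \<bar>a \<bullet> (x - c)\<bar>"
          proof -
            have e: "(\<lambda>n. \<bar>a \<bullet> (x - c)\<bar> ^ n /\<^sub>R fact n) sums exp \<bar>a \<bullet> (x - c)\<bar>"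
              by (rule exp_converges)
            show ?thesis
              unfolding sums_unique[OF e] by (rule sum_le_suminf[OF sums_summable[OF e]]) auto
          qed
          also have "\<bar>a \<bullet> (x - c)\<bar> \<le> norm a * R"
            using Cauchy_Schwarz_ineq2[of a "x - c"] True
            by (meson less_imp_le mult_left_mono norm_ge_zero order_trans)
          finally have "norm (w x) * \<bar>?S n x\<bar> \<le> norm (w x) * exp (norm a * R)"
            by (intro mult_left_mono) auto
          then show ?thesis by (simp add: norm_mult mult.commute del: of_real_sum)
        qed (use supp' in auto)
      qed
    qed (use w in auto)
    moreover have "(LINT x|lebesgue. w x * of_real (?S n x)) = 0" for n
    proof -
      have "(LINT x|lebesgue. w x * of_real (?S n x))
        = (LINT x|lebesgue. (\<Sum>i<n. of_real (inverse (fact i)) * (w x * of_real ((a \<bullet> (x - c)) ^ i))))"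
        by (intro Bochner_Integration.integral_cong) (auto simp: sum_distrib_left algebra_simps)
      also have "\<dots> = (\<Sum>i<n. LINT x|lebesgue. of_real (inverse (fact i)) * (w x * of_real ((a \<bullet> (x - c)) ^ i)))"
        using wti by (intro Bochner_Integration.integral_sum) (auto intro!: integrable_mult_right)
      also have "\<dots> = 0" using wt by simp
      finally show ?thesis .
    qed
    ultimately have "(LINT x|lebesgue. w x * of_real (exp (a \<bullet> (x - c)))) = 0"
      by (simp add: LIMSEQ_const_iff)
    \<comment> \<open>The factor exp(a \<bullet> c) moves the centre of the exponential from c to
      the origin.\<close>
    then have "of_real (exp (a \<bullet> c)) * (LINT x|lebesgue. w x * of_real (exp (a \<bullet> (x - c)))) = 0" by simp
    then have "(LINT x|lebesgue. of_real (exp (a \<bullet> c)) * (w x * of_real (exp (a \<bullet> (x - c))))) = 0" by simp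
    moreover have "of_real (exp (a \<bullet> c)) * (w x * of_real (exp (a \<bullet> (x - c)))) = w x * of_real (exp (a \<bullet> x))" for x
      by (simp add: inner_diff_right exp_diff)
    ultimately show ?thesis by simp
  qed
  from AE_zero_if_exp_integrals_zero[OF w supp this]
  have "AE x in lebesgue. w x = 0" by blast
  then show ?thesis
  proof eventually_elim
    case (elim x)
    then show ?case using b(2)[of "sq_dist c x"] by (auto simp: w_def h_def)
  qed
qed

section \<open>A Riemann-Lebesgue lemma for radial phases\<close>

subsection \<open>Oscillating integrals\<close>

lemma lebesgue_integral_scale:
  fixes f :: "real^3 \<Rightarrow> complex"
  assumes f: "continuous_on UNIV f" and t: "0 < t"
  shows "(LINT x|lebesgue. f x) = of_real (t ^ 3) * (LINT x|lebesgue. f (t *\<^sub>R x))"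
proof -
  have fm: "f \<in> borel_measurable borel" using f by (rule borel_measurable_continuous_onI)
  have "continuous_on UNIV (\<lambda>x. f (t *\<^sub>R x))"
    by (intro continuous_on_compose2[OF f]) (auto intro!: continuous_intros)
  then have gm: "(\<lambda>x. f (t *\<^sub>R x)) \<in> borel_measurable borel" by (rule borel_measurable_continuous_onI)
  have tm: "(\<lambda>x::real^3. 0 + t *\<^sub>R x) \<in> measurable lborel borel" by simp
  have "(LINT x|lebesgue. f x) = (LINT x|lborel. f x)"
    using fm by (intro integral_completion) simp
  also have "\<dots> = (LINT x|density (distr lborel borel (\<lambda>x. 0 + t *\<^sub>R x)) (\<lambda>_. ennreal (t ^ 3)). f x)"
    using lborel_affine[of t "0::real^3"] t by simp
  also have "\<dots> = (LINT x|distr lborel borel (\<lambda>x. 0 + t *\<^sub>R x). t ^ 3 *\<^sub>R f x)"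
    using fm t by (intro integral_density) auto
  also have "\<dots> = (LINT x|lborel. t ^ 3 *\<^sub>R f (0 + t *\<^sub>R x))"
    using fm tm by (intro integral_distr) auto
  also have "\<dots> = of_real (t ^ 3) * (LINT x|lborel. f (t *\<^sub>R x))"
    by (simp add: scaleR_conv_of_real)
  also have "(LINT x|lborel. f (t *\<^sub>R x)) = (LINT x|lebesgue. f (t *\<^sub>R x))"
    using gm by (intro integral_completion[symmetric]) simp
  finally show ?thesis .
qed

lemma integrable_continuous_compact_support:
  fixes f :: "real^3 \<Rightarrow> complex"
  assumes f: "continuous_on UNIV f" and z: "\<And>x. r \<le> norm x \<Longrightarrow> f x = 0"
  shows "integrable lebesgue f"
proof -
  obtain B where B: "\<And>x. norm (f x) \<le> B" using bounded_of_compact_support[OF f z] by blast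
  show ?thesis
  proof (rule Bochner_Integration.integrable_bound[of _ "\<lambda>x. B * indicator (cball 0 r) x"])
    have "cball (0::real^3) r \<in> lmeasurable" by (rule lmeasurable_cball)
    then show "integrable lebesgue (\<lambda>x. B * indicator (cball (0::real^3) r) x)"
      by (intro integrable_mult_right) (simp add: fmeasurable_def)
    show "f \<in> borel_measurable lebesgue" by (rule continuous_borel_measurable_lebesgue[OF f])
    show "AE x in lebesgue. norm (f x) \<le> norm (B * indicator (cball 0 r) x)"
    proof (rule AE_I2)
      fix x show "norm (f x) \<le> norm (B * indicator (cball 0 r) x)"
        using B[of x] z[of x] by (cases "norm x \<le> r") auto
    qed
  qed
qed

text \<open>The dilation by \<open>1 + 1/\<tau>\<close> multiplies \<open>exp (\<i> \<tau> |x|)\<close> by \<open>exp (\<i> |x|)\<close>, but moves the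
  amplitude only slightly.\<close>

lemma Riemann_Lebesgue_aux:
  fixes w :: "real^3 \<Rightarrow> complex"
  assumes w: "continuous_on UNIV w" and z: "\<And>x. r \<le> norm x \<Longrightarrow> w x = 0" and \<tau>: "0 < \<tau>"
  shows "(\<lambda>n. LINT x|lebesgue. w x * (exp (\<i> * of_real (norm x)) - 1) * exp (\<i> * of_real (\<tau> * real (Suc n) * norm x)))
    \<longlonglongrightarrow> 0"
proof -
  define t where "t n = 1 + 1 / (\<tau> * real (Suc n))" for n
  have t1: "1 \<le> t n" for n using \<tau> by (simp add: t_def)
  have tl: "t \<longlonglongrightarrow> 1"
  proof -
    have "(\<lambda>n. 1 + (1 / \<tau>) * inverse (real (Suc n))) \<longlonglongrightarrow> 1 + (1 / \<tau>) * 0"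
      by (intro tendsto_intros LIMSEQ_inverse_real_of_nat)
    then show ?thesis by (simp add: t_def[abs_def] field_simps)
  qed
  obtain B where B: "0 \<le> B" "\<And>x. norm (w x) \<le> B" using bounded_of_compact_support[OF w z] by blast
  define e where "e n x = exp (\<i> * complex_of_real (\<tau> * real (Suc n) * norm (x::real^3)))" for n x
  define e1 where "e1 x = exp (\<i> * complex_of_real (norm (x::real^3)))" for x
  have ec: "continuous_on UNIV (e n)" "continuous_on UNIV e1" for n
    unfolding e_def[abs_def] e1_def[abs_def] by (intro continuous_intros)+
  have wt: "continuous_on UNIV (\<lambda>x. w (t n *\<^sub>R x))" for n
    by (intro continuous_on_compose2[OF w]) (auto intro!: continuous_intros)
  have zt: "w (t n *\<^sub>R x) = 0" if "r \<le> norm x" for n x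
  proof (rule z)
    have "norm x \<le> t n * norm x" using t1[of n] by (simp add: mult_left_le mult_le_cancel_right1)
    then show "r \<le> norm (t n *\<^sub>R x)" using that t1[of n] by simp
  qed
  have en: "norm (e n x) = 1" "norm (e1 x) = 1" for n x
    by (simp_all add: e_def e1_def norm_exp_eq_Re)
  \<comment> \<open>Dilation turns the integral of w e_n into that of t^3 w(t x) e1 e_n; subtracting
    it from the integral of w e1 e_n leaves a difference of amplitudes that tends to 0.\<close>
  have key: "(LINT x|lebesgue. w x * (e1 x - 1) * e n x)
      = (LINT x|lebesgue. (w x - of_real (t n ^ 3) * w (t n *\<^sub>R x)) * e1 x * e n x)" for n
  proof -
    have split: "e n (t n *\<^sub>R x) = e1 x * e n x" for x
    proof -
      have "\<tau> * real (Suc n) * norm (t n *\<^sub>R x) = norm x + \<tau> * real (Suc n) * norm x"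
      proof -
        have 1: "norm (t n *\<^sub>R x) = t n * norm x" using t1[of n] by simp
        have 2: "\<tau> * real (Suc n) * t n = 1 + \<tau> * real (Suc n)"
          using \<tau> by (simp add: t_def field_simps del: of_nat_Suc)
        have "\<tau> * real (Suc n) * norm (t n *\<^sub>R x) = \<tau> * real (Suc n) * t n * norm x"
          by (simp only: 1 mult.assoc)
        also have "\<dots> = norm x + \<tau> * real (Suc n) * norm x"
          unfolding 2 by (simp only: distrib_right mult_1_left)
        finally show ?thesis .
      qed
      then show ?thesis by (simp add: e_def e1_def distrib_left flip: exp_add del: norm_scaleR)
    qed
    have i1: "integrable lebesgue (\<lambda>x. w x * e n x)"
      by (rule integrable_continuous_compact_support[where r=r]) (use z in \<open>auto intro!: continuous_intros w ec\<close>)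
    have i2: "integrable lebesgue (\<lambda>x. w x * e1 x * e n x)"
      by (rule integrable_continuous_compact_support[where r=r]) (use z in \<open>auto intro!: continuous_intros w ec\<close>)
    have i3: "integrable lebesgue (\<lambda>x. w (t n *\<^sub>R x) * e1 x * e n x)"
      by (rule integrable_continuous_compact_support[where r=r]) (use zt in \<open>auto intro!: continuous_intros wt ec\<close>)
    have "(LINT x|lebesgue. w x * e n x) = of_real (t n ^ 3) * (LINT x|lebesgue. w (t n *\<^sub>R x) * e n (t n *\<^sub>R x))"
      by (rule lebesgue_integral_scale) (use t1[of n] in \<open>auto intro!: continuous_intros w ec\<close>)
    then have s: "(LINT x|lebesgue. w x * e n x) = of_real (t n ^ 3) * (LINT x|lebesgue. w (t n *\<^sub>R x) * e1 x * e n x)"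
      unfolding split mult.assoc .
    have "(LINT x|lebesgue. w x * (e1 x - 1) * e n x) = (LINT x|lebesgue. w x * e1 x * e n x - w x * e n x)"
      by (rule Bochner_Integration.integral_cong) (simp_all add: algebra_simps)
    also have "\<dots> = (LINT x|lebesgue. w x * e1 x * e n x) - (LINT x|lebesgue. w x * e n x)"
      by (rule Bochner_Integration.integral_diff[OF i2 i1])
    also have "\<dots> = (LINT x|lebesgue. w x * e1 x * e n x - of_real (t n ^ 3) * (w (t n *\<^sub>R x) * e1 x * e n x))"
      unfolding s by (subst Bochner_Integration.integral_diff[OF i2 integrable_mult_right[OF i3]]) simp
    also have "\<dots> = (LINT x|lebesgue. (w x - of_real (t n ^ 3) * w (t n *\<^sub>R x)) * e1 x * e n x)"
      by (rule Bochner_Integration.integral_cong) (simp_all add: algebra_simps)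
    finally show ?thesis .
  qed
  define T where "T = 1 + 1 / \<tau>"
  have tT: "t n \<le> T" for n 
  proof -
    have "\<tau> * 1 \<le> \<tau> * real (Suc n)" using \<tau> by (intro mult_left_mono) auto
    then show ?thesis using \<tau> unfolding t_def T_def by (intro add_left_mono divide_left_mono) auto
  qed
  have "(\<lambda>n. LINT x|lebesgue. (w x - of_real (t n ^ 3) * w (t n *\<^sub>R x)) * e1 x * e n x) \<longlonglongrightarrow> integral\<^sup>L lebesgue (\<lambda>x::real^3. 0::complex)"
  proof (rule integral_dominated_convergence[where f="\<lambda>_. 0" and w="\<lambda>x. (B + T ^ 3 * B) * indicator (cball 0 r) x"])
    show "(\<lambda>x. (w x - of_real (t n ^ 3) * w (t n *\<^sub>R x)) * e1 x * e n x) \<in> borel_measurable lebesgue" for n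
      by (rule continuous_borel_measurable_lebesgue) (auto intro!: continuous_intros w wt ec)
    have "cball (0::real^3) r \<in> lmeasurable" by (rule lmeasurable_cball)
    then show "integrable lebesgue (\<lambda>x. (B + T ^ 3 * B) * indicator (cball (0::real^3) r) x)"
      by (intro integrable_mult_right) (simp add: fmeasurable_def)
    show "AE x in lebesgue. (\<lambda>n. (w x - of_real (t n ^ 3) * w (t n *\<^sub>R x)) * e1 x * e n x) \<longlonglongrightarrow> 0"
    proof (rule AE_I2)
      fix x :: "real^3"
      have "(\<lambda>n. t n *\<^sub>R x) \<longlonglongrightarrow> 1 *\<^sub>R x" by (intro tendsto_intros tl)
      then have "(\<lambda>n. w (t n *\<^sub>R x)) \<longlonglongrightarrow> w x"
        using w by (intro continuous_on_tendsto_compose[OF w]) auto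
      then have "(\<lambda>n. w x - of_real (t n ^ 3) * w (t n *\<^sub>R x)) \<longlonglongrightarrow> w x - of_real (1 ^ 3) * w x"
        by (intro tendsto_intros tl)
      then have "(\<lambda>n. norm (w x - of_real (t n ^ 3) * w (t n *\<^sub>R x))) \<longlonglongrightarrow> 0"
        by (simp add: tendsto_norm_zero)
      moreover have "norm ((w x - of_real (t n ^ 3) * w (t n *\<^sub>R x)) * e1 x * e n x)
          = norm (w x - of_real (t n ^ 3) * w (t n *\<^sub>R x))" for n
        by (simp add: norm_mult en del: of_real_power)
      ultimately show "(\<lambda>n. (w x - of_real (t n ^ 3) * w (t n *\<^sub>R x)) * e1 x * e n x) \<longlonglongrightarrow> 0"
        by (subst tendsto_norm_zero_iff[symmetric]) (simp only:)
    qed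
    show "AE x in lebesgue. norm ((w x - of_real (t n ^ 3) * w (t n *\<^sub>R x)) * e1 x * e n x)
        \<le> (B + T ^ 3 * B) * indicator (cball 0 r) x" for n
    proof (rule AE_I2)
      fix x
      show "norm ((w x - of_real (t n ^ 3) * w (t n *\<^sub>R x)) * e1 x * e n x) \<le> (B + T ^ 3 * B) * indicator (cball 0 r) x"
      proof (cases "norm x \<le> r")
        case True
        have t0: "0 \<le> t n" using t1[of n] by simp
        have "norm ((w x - of_real (t n ^ 3) * w (t n *\<^sub>R x)) * e1 x * e n x)
            = norm (w x - of_real (t n ^ 3) * w (t n *\<^sub>R x))"
          by (simp add: norm_mult en del: of_real_power)
        also have "\<dots> \<le> norm (w x) + norm (of_real (t n ^ 3) * w (t n *\<^sub>R x))" by (rule norm_triangle_ineq4)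
        also have "norm (of_real (t n ^ 3) * w (t n *\<^sub>R x)) = t n ^ 3 * norm (w (t n *\<^sub>R x))"
          using t0 by (simp add: norm_mult norm_power)
        also have "\<dots> \<le> T ^ 3 * B"
          using B t0 tT by (intro mult_mono power_mono) (auto intro: order.trans[OF t0 tT])
        also have "norm (w x) \<le> B" by (rule B)
        finally show ?thesis using True by simp
      qed (use z zt in auto)
    qed
  qed simp_all
  then have "(\<lambda>n. LINT x|lebesgue. w x * (e1 x - 1) * e n x) \<longlonglongrightarrow> 0"
    unfolding key by simp
  then show ?thesis by (simp add: e_def e1_def)
qed

text \<open>The factor exp(i |x|) - 1 of the auxiliary statement has no zero for 0 < |x| < 2 pi,
  hence none on the shell 1 \<le> |x| \<le> 2, so f can be divided by it.\<close>

lemma Riemann_Lebesgue_shell: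
  fixes f :: "real^3 \<Rightarrow> complex"
  assumes f: "continuous_on UNIV f" and z: "\<And>x. norm x < 1 \<or> 2 < norm x \<Longrightarrow> f x = 0" and \<tau>: "0 < \<tau>"
  shows "(\<lambda>n. LINT x|lebesgue. f x * exp (\<i> * of_real (\<tau> * real (Suc n) * norm x))) \<longlonglongrightarrow> 0"
proof -
  define d where "d x = exp (\<i> * complex_of_real (norm (x::real^3))) - 1" for x
  have dnz: "d x \<noteq> 0" if "0 < norm x" "norm x < 2 * pi" for x
  proof
    assume "d x = 0"
    then have "exp (\<i> * complex_of_real (norm x)) = 1" by (simp add: d_def)
    then obtain m :: int where "norm x = of_int (2 * m) * pi" unfolding exp_eq_1 by auto
    then have "0 < real_of_int (2 * m) * pi" "real_of_int (2 * m) * pi < 2 * pi" using that by auto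
    then have "0 < m" "m < 1" by (auto simp: zero_less_mult_iff)
    then show False by simp
  qed
  define w where "w x = f x / d x" for x
  have wz: "w x = 0" if "norm x < 1 \<or> 2 < norm x" for x using z[OF that] by (simp add: w_def)
  have fw: "w x * d x = f x" for x
  proof (cases "norm x < 1 \<or> 2 < norm x")
    case False
    then have "d x \<noteq> 0" using pi_gt3 by (intro dnz) auto
    then show ?thesis by (simp add: w_def)
  qed (use z in \<open>auto simp: w_def\<close>)
  have "continuous_on UNIV w"
  proof -
    let ?A = "ball (0::real^3) 1" and ?B = "- cball (0::real^3) 2"
    let ?C = "ball (0::real^3) (2 * pi) - {0}"
    have "continuous_on ?C w"
      unfolding w_def[abs_def]
    proof (rule continuous_on_divide)
      show "continuous_on ?C f" using f continuous_on_subset by blast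
      show "continuous_on ?C d" unfolding d_def[abs_def] by (intro continuous_intros)
    qed (use dnz in auto)
    moreover have "continuous_on ?A w" using wz by (intro continuous_on_eq[OF continuous_on_const[of _ 0]]) auto
    moreover have "continuous_on ?B w" using wz by (intro continuous_on_eq[OF continuous_on_const[of _ 0]]) auto
    ultimately have "continuous_on (?A \<union> ?B \<union> ?C) w"
      by (intro continuous_on_open_Un open_Un) auto
    moreover have "?A \<union> ?B \<union> ?C = UNIV" using pi_gt3 by (auto simp: not_less)
    ultimately show ?thesis by simp
  qed
  from Riemann_Lebesgue_aux[OF this, of 3 \<tau>] wz \<tau>
  have "(\<lambda>n. LINT x|lebesgue. w x * d x * exp (\<i> * of_real (\<tau> * real (Suc n) * norm x))) \<longlonglongrightarrow> 0"
    by (simp add: d_def)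
  then show ?thesis by (simp add: fw)
qed

section \<open>The pairing with radial solutions at infinity and the induction over l\<close>

section \<open>Solutions of the Helmholtz equation\<close>

text \<open>In s = |x|^2 the plateau ends at |x| = 1 and the support at |x| = 2, so the slope lives
  on the shell of the oscillation lemma. The bounds -1 and -2 concern negative s and make the
  support compact.\<close>

lemma plateau_function:
  obtains \<theta> :: "real \<Rightarrow> complex" where "smooth_on \<theta> UNIV" "\<And>s. -1 \<le> s \<Longrightarrow> s \<le> 1 \<Longrightarrow> \<theta> s = 1"
    "\<And>s. s < -2 \<or> 4 < s \<Longrightarrow> \<theta> s = 0"
proof -
  have lt: "(1::real) < 4" "(-2::real) < -1" by simp_all
  from cutoff_function[OF lt(1)] obtain f :: "real \<Rightarrow> complex" where f: "smooth_on f UNIV" "\<And>s. s \<le> 1 \<Longrightarrow> f s = (1::complex)" "\<And>s. 4 \<le> s \<Longrightarrow> f s = 0"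
    by metis
  from cutoff_function[OF lt(2)] obtain g :: "real \<Rightarrow> complex" where g: "smooth_on g UNIV" "\<And>s. s \<le> -2 \<Longrightarrow> g s = (1::complex)" "\<And>s. -1 \<le> s \<Longrightarrow> g s = 0"
    by metis
  show ?thesis
  proof (rule that[of "\<lambda>s. f s * (1 - g s)"])
    show "smooth_on (\<lambda>s. f s * (1 - g s)) UNIV"
      by (intro smooth_on_mult smooth_on_diff smooth_on_const f(1) g(1)) auto
    show "f s * (1 - g s) = 1" if "-1 \<le> s" "s \<le> 1" for s using f(2) g(3) that by simp
    show "f s * (1 - g s) = 0" if "s < -2 \<or> 4 < s" for s using f(3)[of s] g(2)[of s] that by auto
  qed
qed

lemma Dr_rescale:
  assumes "smooth_on \<theta> UNIV"
  shows "Dr (\<lambda>s. \<theta> (e * s)) s = of_real e * Dr \<theta> (e * s)"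
proof (rule DrI)
  have "((\<lambda>s. e * s) has_vector_derivative e) (at s)"
    by (auto intro!: derivative_eq_intros simp: has_real_derivative_iff_has_vector_derivative[symmetric])
  from vector_diff_chain_at[OF this Dr_works[OF assms, of "e * s"]]
  show "((\<lambda>s. \<theta> (e * s)) has_vector_derivative of_real e * Dr \<theta> (e * s)) (at s)"
    by (simp add: o_def scaleR_conv_of_real)
qed

lemma smooth_rescale: "smooth_on \<theta> UNIV \<Longrightarrow> smooth_on (\<lambda>s. \<theta> (e * s)) (UNIV :: real set)"
  by (rule smooth_on_compose[where I=UNIV])
    (auto intro!: smooth_on_bounded_linear[OF _ bounded_linear_mult_right] smooth_on_ident)

lemma Dr_Dr_rescale:
  assumes "smooth_on \<theta> UNIV"
  shows "Dr (Dr (\<lambda>s. \<theta> (e * s))) s = of_real (e\<^sup>2) * Dr (Dr \<theta>) (e * s)"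
proof -
  have "Dr (Dr (\<lambda>s. \<theta> (e * s))) s = Dr (\<lambda>s. of_real e * Dr \<theta> (e * s)) s"
    unfolding Dr_rescale[OF assms] ..
  also have "\<dots> = of_real e * Dr (\<lambda>s. Dr \<theta> (e * s)) s"
    by (rule Dr_cmult[OF smooth_rescale[OF smooth_on_Dr[OF assms]]]) simp
  also have "\<dots> = of_real (e\<^sup>2) * Dr (Dr \<theta>) (e * s)"
    unfolding Dr_rescale[OF smooth_on_Dr[OF assms]] by (simp add: power2_eq_square)
  finally show ?thesis .
qed

text \<open>Leading part for large s of the n-th derivative of p exp(i k r) + q exp(-i k r), in
  which all derivatives fall on the exponentials.\<close>

definition Ek_lead :: "complex \<Rightarrow> complex \<Rightarrow> real \<Rightarrow> nat \<Rightarrow> real \<Rightarrow> complex" where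
  "Ek_lead p q k n s = p * (\<i> * of_real k / 2) ^ n * Ek k n s + q * (\<i> * of_real (-k) / 2) ^ n * Ek (-k) n s"

definition Ek_comb :: "complex \<Rightarrow> complex \<Rightarrow> real \<Rightarrow> nat \<Rightarrow> real \<Rightarrow> complex" where
  "Ek_comb p q k n s = p * (Dr ^^ n) (Ek k 0) s + q * (Dr ^^ n) (Ek (-k) 0) s"

lemma Ek_comb_bounds:
  "\<exists>B\<ge>0. \<forall>s\<ge>1. norm (Ek_comb p q k n s - Ek_lead p q k n s) \<le> B * inverse (sqrt s ^ (n + 1))
      \<and> norm (Ek_comb p q k n s) \<le> B * inverse (sqrt s ^ n)"
proof -
  let ?c = "\<lambda>k. (\<i> * complex_of_real k / 2) ^ n"
  obtain C1 where C1: "\<forall>s\<ge>1. norm ((Dr ^^ n) (Ek k 0) s - ?c k * Ek k (0 + n) s) \<le> C1 * inverse (sqrt s ^ (0 + n + 1))"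
    using Dr_iter_Ek_asymptotic by blast
  obtain C2 where C2: "\<forall>s\<ge>1. norm ((Dr ^^ n) (Ek (-k) 0) s - ?c (-k) * Ek (-k) (0 + n) s) \<le> C2 * inverse (sqrt s ^ (0 + n + 1))"
    using Dr_iter_Ek_asymptotic by blast
  define B1 where "B1 = norm p * \<bar>C1\<bar> + norm q * \<bar>C2\<bar>"
  define B2 where "B2 = norm p * norm (?c k) + norm q * norm (?c (-k))"
  have B0: "0 \<le> B1" "0 \<le> B2" by (auto simp: B1_def B2_def)
  have main: "norm (Ek_comb p q k n s - Ek_lead p q k n s) \<le> (B1 + B2) * inverse (sqrt s ^ (n + 1))
      \<and> norm (Ek_comb p q k n s) \<le> (B1 + B2) * inverse (sqrt s ^ n)" if s: "1 \<le> s" for s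
  proof -
    have s1: "1 \<le> sqrt s" using s by simp
    let ?X = "(Dr ^^ n) (Ek k 0) s - ?c k * Ek k n s" and ?Y = "(Dr ^^ n) (Ek (-k) 0) s - ?c (-k) * Ek (-k) n s"
    let ?L = "p * ?c k * Ek k n s + q * ?c (-k) * Ek (-k) n s"
    let ?w = "inverse (sqrt s ^ (n + 1))"
    have w: "0 \<le> ?w" "?w \<le> inverse (sqrt s ^ n)"
      using s1 by (auto intro!: le_imp_inverse_le power_increasing simp del: power_Suc)
    have c: "C1 * ?w \<le> \<bar>C1\<bar> * ?w" "C2 * ?w \<le> \<bar>C2\<bar> * ?w" using w(1) by (intro mult_right_mono; simp)+
    have "norm ?X \<le> C1 * ?w" using C1 s by simp
    with c have X: "norm ?X \<le> \<bar>C1\<bar> * ?w" by linarith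
    have "norm ?Y \<le> C2 * ?w" using C2 s by simp
    with c have Y: "norm ?Y \<le> \<bar>C2\<bar> * ?w" by linarith
    have "norm (p * ?X + q * ?Y) \<le> norm p * norm ?X + norm q * norm ?Y"
      by (rule norm_triangle_le) (simp add: norm_mult)
    also have "\<dots> \<le> norm p * (\<bar>C1\<bar> * ?w) + norm q * (\<bar>C2\<bar> * ?w)"
      by (intro add_mono mult_left_mono X Y) auto
    finally have 1: "norm (p * ?X + q * ?Y) \<le> B1 * ?w" by (simp add: B1_def algebra_simps)
    have eq: "Ek_comb p q k n s - Ek_lead p q k n s = p * ?X + q * ?Y"
      by (simp add: algebra_simps Ek_comb_def Ek_lead_def)
    have "B1 * ?w \<le> (B1 + B2) * ?w" using B0 w(1) by (intro mult_right_mono) auto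
    then have 3: "norm (Ek_comb p q k n s - Ek_lead p q k n s) \<le> (B1 + B2) * ?w"
      unfolding eq using 1 by linarith
    have "norm ?L \<le> norm (p * ?c k * Ek k n s) + norm (q * ?c (-k) * Ek (-k) n s)" by (rule norm_triangle_ineq)
    also have "\<dots> = B2 * inverse (sqrt s ^ n)"
      using s1 by (simp add: norm_mult norm_Ek B2_def distrib_right)
    finally have 2: "norm (Ek_lead p q k n s) \<le> B2 * inverse (sqrt s ^ n)" unfolding Ek_lead_def .
    have "norm (Ek_comb p q k n s) \<le> norm (p * ?X + q * ?Y) + norm (Ek_lead p q k n s)"
      using norm_triangle_sub[of "Ek_comb p q k n s" "Ek_lead p q k n s"] unfolding eq by simp
    also have "\<dots> \<le> B1 * inverse (sqrt s ^ n) + B2 * inverse (sqrt s ^ n)"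
      using 1 2 mult_left_mono[OF w(2) B0(1)] by linarith
    finally show ?thesis using 3 by (simp add: distrib_right)
  qed
  show ?thesis using main B0 by (intro exI[of _ "B1 + B2"]) auto
qed

lemma bounded_test:
  fixes h :: "real \<Rightarrow> complex"
  assumes "smooth_on h UNIV" "\<And>s. s < \<alpha> \<or> \<beta> < s \<Longrightarrow> h s = 0"
  shows "\<exists>B\<ge>0. \<forall>s. norm (h s) \<le> B"
proof -
  have "compact (h ` {\<alpha>..\<beta>})"
    by (intro compact_continuous_image continuous_on_subset[OF smooth_on_continuous[OF assms(1)]] compact_Icc) simp
  then obtain B where B: "\<And>s. s \<in> {\<alpha>..\<beta>} \<Longrightarrow> norm (h s) \<le> B"
    by (meson bounded_iff compact_imp_bounded imageI)
  have "norm (h s) \<le> max B 0" for s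
    using B[of s] assms(2)[of s] by (cases "s \<in> {\<alpha>..\<beta>}") (auto simp: not_le)
  then show ?thesis by (intro exI[of _ "max B 0"]) simp
qed

text \<open>Scalar form of the far field expansion, with an explicit radius and constant in place of
  the Landau symbol.\<close>

definition far_asymptotic :: "real \<Rightarrow> (real^3 \<Rightarrow> complex) \<Rightarrow> (real^3 \<Rightarrow> complex) \<Rightarrow> bool" where
  "far_asymptotic k v F \<longleftrightarrow> (\<exists>R C. AE x in lebesgue. R \<le> norm x \<longrightarrow>
     norm (v x - exp (\<i> * of_real (k * norm x)) / of_real (4 * pi * norm x) * F (x /\<^sub>R norm x)) \<le> C / (norm x)\<^sup>2)"

lemma norm_mult4_le:
  fixes a b c d :: complex
  assumes "norm a \<le> A" "norm b \<le> B" "norm c \<le> C" "norm d \<le> D"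
  shows "norm (a * b * c * d) \<le> A * B * C * D"
  unfolding norm_mult
  by (intro mult_mono assms mult_nonneg_nonneg norm_ge_zero order.trans[OF norm_ge_zero assms(1)]
      order.trans[OF norm_ge_zero assms(2)] order.trans[OF norm_ge_zero assms(3)])

lemma measure_ball_bound:
  assumes "0 \<le> r" shows "measure lebesgue (cball (0::real^3) r) = unit_ball_vol 3 * r ^ 3"
  using content_cball[OF assms, of "0::real^3"] by simp

text \<open>Pairing the outgoing field with an outgoing radial solution \<open>H\<close>, cut off at radius \<open>n\<close>,
  leaves only an oscillating boundary term.\<close>

lemma outgoing_limit:
  assumes k: "0 < k" and v: "loc_integrable v"
    and F: "continuous_on (sphere 0 1) F" and far: "far_asymptotic k v F"
    and H: "smooth_on H UNIV"
    and Hb: "\<And>s. \<beta> \<le> s \<Longrightarrow> H s = Ek_comb p q k (l + 1) s"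
    and or: "q = 0 \<or> (\<forall>d\<in>sphere 0 1. F d = 0)"
    and L: "\<And>s. 0 \<le> s \<Longrightarrow> Lop k (4 * real l + 6) H s = g s" and g: "tests UNIV g" "\<And>s. \<beta> \<le> s \<Longrightarrow> g s = 0"
    and z: "\<And>\<theta>. tests UNIV \<theta> \<Longrightarrow> mom v 0 a l (Lop k (4 * real l + 6) (\<lambda>s. \<theta> s * H s)) = 0"
  shows "mom v 0 a l g = 0"
proof -
  define c where "c = 4 * real l + 6"
  have c0: "0 \<le> c" by (simp add: c_def)
  obtain \<theta> :: "real \<Rightarrow> complex" where \<theta>: "smooth_on \<theta> UNIV" "\<And>s. -1 \<le> s \<Longrightarrow> s \<le> 1 \<Longrightarrow> \<theta> s = 1"
    "\<And>s. s < -2 \<or> 4 < s \<Longrightarrow> \<theta> s = 0" using plateau_function by blast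
  have s1: "smooth_on (Dr \<theta>) UNIV" and s2: "smooth_on (Dr (Dr \<theta>)) UNIV"
    using \<theta>(1) smooth_on_Dr by blast+
  have out: "(Dr ^^ n) \<theta> s = 0" if "s < -2 \<or> 4 < s" for n s
    by (rule Dr_eq_0_outside[of "{-2..4}"]) (use \<theta>(3) that in auto)
  have in1: "(Dr ^^ n) \<theta> s = (Dr ^^ n) (\<lambda>_. 1) s" if "-1 < s" "s < 1" for n s
    by (rule Dr_iter_cong[of "{-1<..<1}"]) (use \<theta>(2) that in auto)
  have one0: "Dr (\<lambda>_. 1) = (\<lambda>_. 0)" "Dr (\<lambda>_. 0) = (\<lambda>_. 0)"
    by (rule ext, rule DrI, simp)+
  have d1: "Dr \<theta> s = 0" if "-1 < s \<and> s < 1 \<or> s < -2 \<or> 4 < s" for s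
    using out[of s 1] in1[of s 1] that by (auto simp: one0)
  have d2: "Dr (Dr \<theta>) s = 0" if "-1 < s \<and> s < 1 \<or> s < -2 \<or> 4 < s" for s
    using out[of s 2] in1[of s 2] that by (auto simp: one0 numeral_2_eq_2)
  obtain T1 where "0 \<le> T1 \<and> (\<forall>s. norm (Dr \<theta> s) \<le> T1)"
    using bounded_test[OF s1, of "-2" 4] d1 by meson
  then have T1: "0 \<le> T1" "\<And>s. norm (Dr \<theta> s) \<le> T1" by simp_all
  obtain T2 where "0 \<le> T2 \<and> (\<forall>s. norm (Dr (Dr \<theta>) s) \<le> T2)"
    using bounded_test[OF s2, of "-2" 4] d2 by meson
  then have T2: "0 \<le> T2" "\<And>s. norm (Dr (Dr \<theta>) s) \<le> T2" by simp_all
  obtain BH where BH: "0 \<le> BH" "\<And>s. 1 \<le> s \<Longrightarrow> norm (Ek_comb p q k (l + 1) s) \<le> BH * inverse (sqrt s ^ (l + 1))"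
    using Ek_comb_bounds[of p q k "l + 1"] by meson
  obtain BD where BD: "0 \<le> BD"
    "\<And>s. 1 \<le> s \<Longrightarrow> norm (Ek_comb p q k (l + 2) s - Ek_lead p q k (l + 2) s) \<le> BD * inverse (sqrt s ^ (l + 2 + 1))"
    "\<And>s. 1 \<le> s \<Longrightarrow> norm (Ek_comb p q k (l + 2) s) \<le> BD * inverse (sqrt s ^ (l + 2))"
    using Ek_comb_bounds[of p q k "l + 2"] by meson
  define lead where "lead = Ek_lead p q k (l + 2)"
  have DH: "Dr H s = Ek_comb p q k (l + 2) s" if "max \<beta> 0 < s" for s
  proof -
    have "Dr H s = (Dr ^^ Suc 0) (\<lambda>s. p * (Dr ^^ (l + 1)) (Ek k 0) s + q * (Dr ^^ (l + 1)) (Ek (- k) 0) s) s"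
      unfolding funpow.simps o_def id_def Ek_comb_def[symmetric] by (rule Dr_cong[of "{max \<beta> 0<..}"]) (use Hb that in auto)
    also have "\<dots> = p * (Dr ^^ Suc 0) ((Dr ^^ (l + 1)) (Ek k 0)) s + q * (Dr ^^ Suc 0) ((Dr ^^ (l + 1)) (Ek (- k) 0)) s"
      by (rule Dr_iter_lincomb[OF smooth_on_Dr_iter[OF smooth_Ek] smooth_on_Dr_iter[OF smooth_Ek]]) (use that in auto)
    finally show ?thesis by (simp add: Ek_comb_def)
  qed
  obtain R C where RC: "AE x in lebesgue. R \<le> norm x \<longrightarrow>
     norm (v x - exp (\<i> * of_real (k * norm x)) / of_real (4 * pi * norm x) * F (x /\<^sub>R norm x)) \<le> C / (norm x)\<^sup>2"
    using far unfolding far_asymptotic_def by blast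
  have "compact (F ` sphere 0 1)" using F by (intro compact_continuous_image) auto
  then have "bounded (F ` sphere 0 1)" by (rule compact_imp_bounded)
  then obtain BF where "0 < BF \<and> (\<forall>y\<in>F ` sphere 0 1. norm y \<le> BF)" unfolding bounded_pos by (rule exE)
  then have BF: "0 \<le> BF" "\<And>d. d \<in> sphere 0 1 \<Longrightarrow> norm (F d) \<le> BF" by auto
  \<comment> \<open>The amplitude of the boundary term at radius N, rescaled to the shell 1 \<le>
    |z| \<le> 2: the factors depending on direction, the slope of the cutoff, and the power 1/|z|
    that remains after cancellation.\<close>
  define f where "f z = F (z /\<^sub>R norm z) * of_real (a \<bullet> (z /\<^sub>R norm z)) ^ l * Dr \<theta> ((norm z)\<^sup>2) / of_real (norm z)" for z
  have fz: "f z = 0" if "norm z < 1 \<or> 2 < norm z" for z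
  proof -
    have "(norm z)\<^sup>2 < 1 \<or> 4 < (norm z)\<^sup>2"
      using that power_strict_mono[of "norm z" 1 2] power_strict_mono[of 2 "norm z" 2] by auto
    moreover have "-1 < (norm z)\<^sup>2" using zero_le_power2[of "norm z"] by linarith
    ultimately show ?thesis using d1 by (simp add: f_def)
  qed
  have fc: "continuous_on UNIV f"
  proof -
    have sph: "continuous_on (- {0::real^3}) (\<lambda>z. z /\<^sub>R norm z)" by (intro continuous_intros) auto
    have 1: "continuous_on (- {0::real^3}) (\<lambda>z. F (z /\<^sub>R norm z))"
      by (rule continuous_on_compose2[OF F sph]) (auto simp: field_simps split: if_splits)
    have 2: "continuous_on (- {0::real^3}) (\<lambda>z. Dr \<theta> ((norm z)\<^sup>2))"
      by (rule continuous_on_compose2[OF smooth_on_continuous[OF s1]]) (auto intro!: continuous_intros)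
    have 3: "continuous_on (- {0::real^3}) (\<lambda>z. complex_of_real (a \<bullet> (z /\<^sub>R norm z)) ^ l)"
      by (intro continuous_on_power continuous_on_of_real continuous_on_inner continuous_on_const sph)
    have 4: "continuous_on (- {0::real^3}) (\<lambda>z. complex_of_real (norm z))"
      by (intro continuous_on_of_real continuous_on_norm continuous_on_id)
    have "continuous_on (- {0}) f"
      unfolding f_def[abs_def]
      by (rule continuous_on_divide[OF continuous_on_mult[OF continuous_on_mult[OF 1 3] 2] 4]) auto
    moreover have "continuous_on (ball 0 1) f"
      using fz by (intro continuous_on_eq[OF continuous_on_const[of _ 0]]) auto
    ultimately have "continuous_on (- {0} \<union> ball 0 1) f" by (intro continuous_on_open_Un) auto
    moreover have "- {0} \<union> ball (0::real^3) 1 = UNIV" by auto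
    ultimately show ?thesis by simp
  qed
  \<comment> \<open>p (i k / 2)^(l + 2) comes from the leading term of H', 8 from the cross term 8 s
    \<theta>' H' in \<open>Lop_mult\<close>, and 1 / (4 pi) from the far field normalisation. The
    two outgoing phases multiply to exp(2 i k |x|).\<close>
  define \<kappa> where "\<kappa> = p * (\<i> * of_real k / 2) ^ (l + 2) * of_real (8 / (4 * pi))"
  define M where "M N x = \<kappa> * (of_real (inverse (N ^ 3)) * (f (x /\<^sub>R N) * exp (\<i> * of_real (2 * k * norm x))))" for N :: real and x :: "real^3"
  \<comment> \<open>The commutator of \<open>Lop\<close> with the cutoff \<theta>(s / N^2), that is,
    the remainder in \<open>Lop_mult\<close>.\<close>
  define Rn where "Rn N s = of_real (8 * s) * (of_real (inverse (N\<^sup>2)) * Dr \<theta> (inverse (N\<^sup>2) * s)) * Dr H s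
    + (of_real (4 * s) * (of_real ((inverse (N\<^sup>2))\<^sup>2) * Dr (Dr \<theta>) (inverse (N\<^sup>2) * s))
       + of_real c * (of_real (inverse (N\<^sup>2)) * Dr \<theta> (inverse (N\<^sup>2) * s))) * H s" for N s :: real
  \<comment> \<open>Dilation by N absorbs the factor N^(-3) and turns the frequency 2 k into 2 k N,
    which is the form of the Riemann-Lebesgue lemma.\<close>
  have Mint: "(LINT x|lebesgue. M N x) = \<kappa> * (LINT x|lebesgue. f x * exp (\<i> * of_real (2 * k * N * norm x)))"
    and Mi: "integrable lebesgue (M N)" if N: "0 < N" for N
  proof -
    have fcN: "continuous_on UNIV (\<lambda>x. f (x /\<^sub>R N))"
      by (intro continuous_on_compose2[OF fc]) (auto intro!: continuous_intros)
    have ec: "continuous_on UNIV (\<lambda>x::real^3. exp (\<i> * complex_of_real (2 * k * norm x)))"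
      by (intro continuous_intros)
    have cN: "continuous_on UNIV (\<lambda>x. f (x /\<^sub>R N) * exp (\<i> * of_real (2 * k * norm x)))"
      by (intro continuous_on_mult fcN ec)
    have "(LINT x|lebesgue. f (x /\<^sub>R N) * exp (\<i> * of_real (2 * k * norm x)))
        = of_real (N ^ 3) * (LINT x|lebesgue. f ((N *\<^sub>R x) /\<^sub>R N) * exp (\<i> * of_real (2 * k * norm (N *\<^sub>R x))))"
      by (rule lebesgue_integral_scale[OF cN N])
    also have "(\<lambda>x. f ((N *\<^sub>R x) /\<^sub>R N) * exp (\<i> * of_real (2 * k * norm (N *\<^sub>R x))))
        = (\<lambda>x. f x * exp (\<i> * of_real (2 * k * N * norm x)))"
      using N by (simp add: mult.assoc)
    finally show "(LINT x|lebesgue. M N x) = \<kappa> * (LINT x|lebesgue. f x * exp (\<i> * of_real (2 * k * N * norm x)))"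
      using N by (simp add: M_def)
    have "f (x /\<^sub>R N) * exp (\<i> * of_real (2 * k * norm x)) = 0" if "3 * N \<le> norm x" for x
    proof -
      have "2 < norm (x /\<^sub>R N)" using that N by (simp add: field_simps)
      then show ?thesis using fz by simp
    qed
    from integrable_continuous_compact_support[OF cN this]
    show "integrable lebesgue (M N)" unfolding M_def by (intro integrable_mult_right) blast
  qed
  have Mlim: "(\<lambda>n. LINT x|lebesgue. M (real (Suc n)) x) \<longlonglongrightarrow> 0"
  proof -
    have "(\<lambda>n. \<kappa> * (LINT x|lebesgue. f x * exp (\<i> * of_real (2 * k * real (Suc n) * norm x)))) \<longlonglongrightarrow> \<kappa> * 0"
      using k by (intro tendsto_mult tendsto_const Riemann_Lebesgue_shell[OF fc fz]) auto
    then show ?thesis using Mint by simp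
  qed
  define \<theta>N where "\<theta>N N s = \<theta> (inverse (N\<^sup>2) * s)" for N s :: real
  have \<theta>N: "tests UNIV (\<theta>N N)" if N: "0 < N" for N
  proof -
    have "\<theta>N N s = 0" if "s \<notin> {-2 * N\<^sup>2..4 * N\<^sup>2}" for s
      unfolding \<theta>N_def using that N by (intro \<theta>(3)) (auto simp: field_simps not_le)
    moreover have "smooth_on (\<theta>N N) UNIV" unfolding \<theta>N_def[abs_def] by (rule smooth_rescale[OF \<theta>(1)])
    ultimately show ?thesis unfolding tests_def by (intro conjI exI[of _ "{-2 * N\<^sup>2..4 * N\<^sup>2}"]) auto
  qed
  \<comment> \<open>N^2 \<ge> N \<ge> \<beta>, so the cutoff is still 1 where g lives.\<close>
  have gN: "\<theta>N N s * g s = g s" if "0 \<le> s" "1 \<le> N" "\<beta> \<le> N" for N s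
  proof (cases "\<beta> \<le> s")
    case False
    have "N * 1 \<le> N * N" using that by (intro mult_left_mono) auto
    then have "s \<le> N\<^sup>2" using False that unfolding power2_eq_square by linarith
    then have "inverse (N\<^sup>2) * s \<le> 1" using that by (simp add: field_simps)
    moreover have "0 \<le> inverse (N\<^sup>2) * s" using that by simp
    ultimately show ?thesis using \<theta>(2)[of "inverse (N\<^sup>2) * s"] by (simp add: \<theta>N_def)
  qed (use g(2) in auto)
  have LN: "Lop k c (\<lambda>s. \<theta>N N s * H s) s = \<theta>N N s * g s + Rn N s" if "0 \<le> s" "0 < N" for N s
    using Lop_mult[OF tests_smooth[OF \<theta>N[OF that(2)]] H, of s k c] L[OF that(1)]
    unfolding \<theta>N_def[abs_def] Dr_rescale[OF \<theta>(1)] Dr_Dr_rescale[OF \<theta>(1)] Rn_def c_def[symmetric]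
    by simp
  have thN: "tests UNIV (\<lambda>s. \<theta>N N s * H s)" if "0 < N" for N
    using \<theta>N[OF that] H unfolding tests_def by (auto intro!: smooth_on_mult)
  have momN: "mom v 0 a l g = - (LINT x|lebesgue. v x * mom_test 0 a l (Rn N) x)"
    and RnI: "integrable lebesgue (\<lambda>x. v x * mom_test 0 a l (Rn N) x)" if N: "1 \<le> N" "\<beta> \<le> N" for N
  proof -
    have eq: "v x * mom_test 0 a l (Rn N) x
       = v x * mom_test 0 a l (Lop k c (\<lambda>s. \<theta>N N s * H s)) x - v x * mom_test 0 a l g x" for x
      using LN[of "sq_dist 0 x" N] gN[of "sq_dist 0 x" N] N by (simp add: mom_test_def sq_dist_eq algebra_simps)
    have i1: "integrable lebesgue (\<lambda>x. v x * mom_test 0 a l (Lop k c (\<lambda>s. \<theta>N N s * H s)) x)"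
      by (rule mom_integrable[OF v tests_Lop[OF thN]]) (use N in auto)
    have i2: "integrable lebesgue (\<lambda>x. v x * mom_test 0 a l g x)" by (rule mom_integrable[OF v g(1)])
    have "mom v 0 a l (Lop k c (\<lambda>s. \<theta>N N s * H s)) = 0"
      using z[OF \<theta>N[of N]] N by (simp add: c_def)
    then show "mom v 0 a l g = - (LINT x|lebesgue. v x * mom_test 0 a l (Rn N) x)"
      unfolding eq Bochner_Integration.integral_diff[OF i1 i2] by (simp add: mom_def)
    show "integrable lebesgue (\<lambda>x. v x * mom_test 0 a l (Rn N) x)"
      unfolding eq by (rule Bochner_Integration.integrable_diff[OF i1 i2])
  qed
  define A where "A = norm a ^ l"
  \<comment> \<open>Three errors: the far field remainder against the cross term, the far field
    against the lower order part of H', and the terms with H itself. 32 = 8 * 4 and 16 = 4 * 4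
    reflect s \<le> 4 N^2. Each error is O(N^(-4)) on a ball of volume O(N^3), hence O(1/N) after
    integration.\<close>
  define K where "K = \<bar>C\<bar> * A * (32 * T1) * BD + BF * A * (32 * T1) * BD + (BF + \<bar>C\<bar>) * A * (16 * T2 + c * T1) * BH"
  have est: "AE x in lebesgue. norm (v x * mom_test 0 a l (Rn N) x - M N x) \<le> K * inverse (N ^ 4) * indicator (cball 0 (2 * N)) x"
    if N: "1 \<le> N" "\<beta> < N" "R \<le> N" for N
    using RC
  proof eventually_elim
    case (elim x)
    define r where "r = norm x"
    define s where "s = sq_dist 0 x"
    have sr: "s = r\<^sup>2" by (simp add: s_def r_def sq_dist_eq)
    have esr: "inverse (N\<^sup>2) * s = (norm (x /\<^sub>R N))\<^sup>2"
      using N by (simp add: sr r_def power_divide power_mult_distrib field_simps)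
    have Nz: "norm (x /\<^sub>R N) = r / N" using N by (simp add: r_def field_simps)
    show ?case
    proof (cases "N \<le> r \<and> r \<le> 2 * N")
      case False
      then have o: "norm (x /\<^sub>R N) < 1 \<or> 2 < norm (x /\<^sub>R N)"
        unfolding Nz using N by (auto simp: field_simps)
      then have "(norm (x /\<^sub>R N))\<^sup>2 < 1 \<or> 4 < (norm (x /\<^sub>R N))\<^sup>2"
        using power_strict_mono[of "norm (x /\<^sub>R N)" 1 2] power_strict_mono[of 2 "norm (x /\<^sub>R N)" 2] by auto
      moreover have "-1 < (norm (x /\<^sub>R N))\<^sup>2" using zero_le_power2[of "norm (x /\<^sub>R N)"] by linarith
      ultimately have "Dr \<theta> (inverse (N\<^sup>2) * s) = 0" "Dr (Dr \<theta>) (inverse (N\<^sup>2) * s) = 0"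
        unfolding esr using d1 d2 by blast+
      then have "Rn N s = 0" by (simp add: Rn_def)
      moreover have "M N x = 0" using fz[OF o] by (simp add: M_def)
      moreover have "0 \<le> K" unfolding K_def A_def using T1(1) T2(1) BD(1) BH(1) BF(1) c0 by simp
      ultimately show ?thesis using N by (simp add: mom_test_def s_def[symmetric] indicator_def)
    next
      case True
      have r1: "1 \<le> r" "0 < r" using True N by auto
      have rr: "r * 1 \<le> r * r" using r1 by (intro mult_left_mono) auto
      have s1': "1 \<le> s" "\<beta> \<le> s" "max \<beta> 0 < s"
      proof -
        have "r \<le> s" using rr unfolding sr power2_eq_square by linarith
        then show "1 \<le> s" "\<beta> \<le> s" "max \<beta> 0 < s" using r1 True N by auto
      qed
      have sqs: "sqrt s = r" using r1 by (simp add: sr)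
      have s4: "s \<le> 4 * N\<^sup>2"
        using power_mono[of r "2 * N" 2] True r1 by (simp add: sr power_mult_distrib)
      define v0 where "v0 = exp (\<i> * of_real (k * r)) / of_real (4 * pi * r) * F (x /\<^sub>R r)"
      define v1 where "v1 = v x - v0"
      have vx: "v x = v0 + v1" by (simp add: v1_def)
      have d: "x /\<^sub>R r \<in> sphere 0 1" using r1 by (simp add: r_def)
      have v1b: "norm v1 \<le> \<bar>C\<bar> * inverse (r\<^sup>2)"
      proof -
        have "norm v1 \<le> C / r\<^sup>2" using elim True N unfolding v1_def v0_def r_def by auto
        also have "\<dots> \<le> \<bar>C\<bar> * inverse (r\<^sup>2)" by (simp add: divide_inverse mult_right_mono)
        finally show ?thesis .
      qed
      have v0b: "norm v0 \<le> BF * inverse r"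
      proof -
        have "norm v0 = norm (F (x /\<^sub>R r)) / (4 * pi * r)"
          using r1 by (simp add: v0_def norm_mult norm_divide norm_exp_eq_Re)
        also have "\<dots> \<le> BF / (4 * pi * r)" using BF(2)[OF d] r1 by (intro divide_right_mono) auto
        also have "\<dots> \<le> BF / r"
          using BF(1) r1 pi_gt3 by (intro divide_left_mono) (auto simp: mult_le_cancel_right1)
        finally show ?thesis by (simp add: divide_inverse)
      qed
      have vb: "norm (v x) \<le> (BF + \<bar>C\<bar>) * inverse r"
      proof -
        have "inverse (r\<^sup>2) \<le> inverse r" using rr r1 by (intro le_imp_inverse_le) (auto simp: power2_eq_square)
        then have "norm v1 \<le> \<bar>C\<bar> * inverse r" using v1b mult_left_mono[of "inverse (r\<^sup>2)" "inverse r" "\<bar>C\<bar>"] by simp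
        then show ?thesis unfolding vx using norm_triangle_ineq[of v0 v1] v0b by (simp add: distrib_right)
      qed
      define t where "t = complex_of_real (a \<bullet> x) ^ l"
      have tb: "norm t \<le> A * r ^ l"
        unfolding t_def A_def norm_power norm_of_real r_def power_mult_distrib[symmetric]
        by (intro power_mono Cauchy_Schwarz_ineq2) auto
      define b1 where "b1 = of_real (8 * s) * (of_real (inverse (N\<^sup>2)) * Dr \<theta> (inverse (N\<^sup>2) * s))"
      have b1b: "norm b1 \<le> 32 * T1"
      proof -
        have "norm b1 = (8 * (s * inverse (N\<^sup>2))) * norm (Dr \<theta> (inverse (N\<^sup>2) * s))"
          using s1' by (simp add: b1_def norm_mult norm_inverse norm_power)
        also have "\<dots> \<le> (8 * 4) * T1"
          using T1 s1' s4 N by (intro mult_mono) (auto simp: field_simps)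
        finally show ?thesis by simp
      qed
      define b2 where "b2 = of_real (4 * s) * (of_real ((inverse (N\<^sup>2))\<^sup>2) * Dr (Dr \<theta>) (inverse (N\<^sup>2) * s))
         + of_real c * (of_real (inverse (N\<^sup>2)) * Dr \<theta> (inverse (N\<^sup>2) * s))"
      have b2b: "norm b2 \<le> (16 * T2 + c * T1) * inverse (N\<^sup>2)"
      proof -
        have "norm b2 \<le> norm (of_real (4 * s) * (of_real ((inverse (N\<^sup>2))\<^sup>2) * Dr (Dr \<theta>) (inverse (N\<^sup>2) * s)))
          + norm (of_real c * (of_real (inverse (N\<^sup>2)) * Dr \<theta> (inverse (N\<^sup>2) * s)))"
          unfolding b2_def by (rule norm_triangle_ineq)
        also have "norm (of_real (4 * s) * (of_real ((inverse (N\<^sup>2))\<^sup>2) * Dr (Dr \<theta>) (inverse (N\<^sup>2) * s)))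
           = (4 * (s * inverse (N\<^sup>2))) * inverse (N\<^sup>2) * norm (Dr (Dr \<theta>) (inverse (N\<^sup>2) * s))"
          using s1' N by (simp add: norm_mult norm_inverse norm_power power2_eq_square)
        also have "\<dots> \<le> (4 * 4) * inverse (N\<^sup>2) * T2"
          using T2 s1' s4 N by (intro mult_mono) (auto simp: field_simps)
        also have "norm (of_real c * (of_real (inverse (N\<^sup>2)) * Dr \<theta> (inverse (N\<^sup>2) * s)))
           = c * inverse (N\<^sup>2) * norm (Dr \<theta> (inverse (N\<^sup>2) * s))"
          using c0 by (simp add: norm_mult norm_inverse norm_power)
        also have "\<dots> \<le> c * inverse (N\<^sup>2) * T1"
          using T1 c0 by (intro mult_left_mono) auto
        finally show ?thesis by (simp add: algebra_simps)
      qed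
      have Hbd: "norm (H s) \<le> BH * inverse (r ^ (l + 1))"
        using BH(2)[OF s1'(1)] unfolding Hb[OF s1'(2)] sqs .
      have DHb: "norm (Dr H s) \<le> BD * inverse (r ^ (l + 2))"
        using BD(3)[OF s1'(1)] unfolding DH[OF s1'(3)] sqs .
      have remb: "norm (Dr H s - lead s) \<le> BD * inverse (r ^ (l + 3))"
        using BD(2)[OF s1'(1)] unfolding DH[OF s1'(3)] sqs lead_def by (simp add: numeral_3_eq_3)
      have main: "v0 * t * b1 * lead s = M N x"
      proof -
        have xr: "(x /\<^sub>R N) /\<^sub>R norm (x /\<^sub>R N) = x /\<^sub>R r"
          unfolding Nz using r1 N by (simp add: divide_inverse)
        have "complex_of_real (a \<bullet> (x /\<^sub>R r)) ^ l = (complex_of_real (a \<bullet> x) * inverse (of_real r)) ^ l"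
          by (simp add: mult.commute)
        then have ax: "complex_of_real (a \<bullet> (x /\<^sub>R r)) ^ l = t * inverse (of_real r ^ l)"
          by (simp only: t_def power_mult_distrib power_inverse)
        have "inverse (complex_of_real (norm (x /\<^sub>R N))) = of_real (N / r)"
          unfolding Nz by (simp add: divide_inverse)
        then have ff: "f (x /\<^sub>R N) = F (x /\<^sub>R r) * (t * inverse (of_real r ^ l)) * Dr \<theta> (inverse (N\<^sup>2) * s) * of_real (N / r)"
          unfolding f_def xr ax esr[symmetric] divide_inverse[of "_ * _ :: complex"] by (simp only:)
        have e2: "exp (\<i> * complex_of_real (2 * k * r)) = exp (\<i> * of_real (k * r)) * exp (\<i> * of_real (k * r))"
          by (simp add: algebra_simps flip: exp_add)
        show ?thesis
        proof (cases "F (x /\<^sub>R r) = 0")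
          case True
          then show ?thesis by (simp add: v0_def M_def ff)
        next
          case False
          \<comment> \<open>A nonzero far field in this direction excludes an incoming part of H by
            \<open>or\<close>; if the far field is zero there, both sides vanish. Either way no
            non-oscillating product of an outgoing and an incoming wave survives.\<close>
          then have "q = 0" using or d by blast
          then have ld: "lead s = p * (\<i> * of_real k / 2) ^ (l + 2) * (exp (\<i> * of_real (k * r)) * inverse (of_real r ^ (l + 2)))"
            by (simp add: lead_def Ek_lead_def Ek_def sqs)
          have "complex_of_real r \<noteq> 0" "complex_of_real N \<noteq> 0" "complex_of_real pi \<noteq> 0" using r1 N by auto
          then show ?thesis
            unfolding ld unfolding M_def ff v0_def b1_def \<kappa>_def r_def[symmetric] e2 sr
            by (simp add: field_simps power_add power2_eq_square power3_eq_cube)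
        qed
      qed
      have "v x * mom_test 0 a l (Rn N) x - M N x
          = v1 * t * b1 * Dr H s + v0 * t * b1 * (Dr H s - lead s) + v x * t * b2 * H s"
        unfolding main[symmetric] mom_test_def s_def[symmetric] Rn_def b1_def[symmetric] b2_def[symmetric]
        by (simp add: t_def[symmetric] vx algebra_simps)
      also have "norm \<dots> \<le> norm (v1 * t * b1 * Dr H s) + norm (v0 * t * b1 * (Dr H s - lead s)) + norm (v x * t * b2 * H s)"
        by (intro norm_triangle_le add_right_mono) (auto intro: norm_triangle_ineq)
      also have "\<dots> \<le> (\<bar>C\<bar> * inverse (r\<^sup>2)) * (A * r ^ l) * (32 * T1) * (BD * inverse (r ^ (l + 2)))
          + (BF * inverse r) * (A * r ^ l) * (32 * T1) * (BD * inverse (r ^ (l + 3)))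
          + ((BF + \<bar>C\<bar>) * inverse r) * (A * r ^ l) * ((16 * T2 + c * T1) * inverse (N\<^sup>2)) * (BH * inverse (r ^ (l + 1)))"
        by (intro add_mono norm_mult4_le v1b tb b1b DHb v0b remb vb b2b Hbd)
      also have "\<dots> = (\<bar>C\<bar> * A * (32 * T1) * BD + BF * A * (32 * T1) * BD) * inverse (r ^ 4)
          + (BF + \<bar>C\<bar>) * A * (16 * T2 + c * T1) * BH * (inverse (r\<^sup>2) * inverse (N\<^sup>2))"
        using r1 N by (simp add: field_simps power_add power2_eq_square power3_eq_cube power4_eq_xxxx)
      also have "\<dots> \<le> (\<bar>C\<bar> * A * (32 * T1) * BD + BF * A * (32 * T1) * BD) * inverse (N ^ 4)
          + (BF + \<bar>C\<bar>) * A * (16 * T2 + c * T1) * BH * (inverse (N\<^sup>2) * inverse (N\<^sup>2))"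
        using True N T1(1) T2(1) BD(1) BH(1) BF(1) c0 unfolding A_def
        by (intro add_mono mult_left_mono mult_right_mono le_imp_inverse_le power_mono) auto
      also have "\<dots> = K * inverse (N ^ 4)"
        using N by (simp add: K_def field_simps power2_eq_square power4_eq_xxxx)
      finally show ?thesis using True by (simp add: r_def)
    qed
  qed
  have "(\<lambda>n. LINT x|lebesgue. v x * mom_test 0 a l (Rn (real (Suc n))) x) \<longlonglongrightarrow> 0"
  proof -
    define n0 where "n0 = nat \<lceil>\<bar>\<beta>\<bar> + \<bar>R\<bar>\<rceil> + 1"
    have n0: "1 \<le> real (Suc n)" "\<beta> < real (Suc n)" "R \<le> real (Suc n)" if "n0 \<le> n" for n
      using that unfolding n0_def by linarith+
    define W where "W n = (LINT x|lebesgue. v x * mom_test 0 a l (Rn (real (Suc n))) x) - (LINT x|lebesgue. M (real (Suc n)) x)" for n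
    have "norm (W n) \<le> (K * (unit_ball_vol 3 * 8)) * inverse (real (Suc n))" if "n0 \<le> n" for n
    proof -
      define N where "N = real (Suc n)"
      have N: "1 \<le> N" "\<beta> < N" "R \<le> N" using n0[OF that] by (auto simp: N_def)
      have i1: "integrable lebesgue (\<lambda>x. v x * mom_test 0 a l (Rn N) x)" using RnI N by simp
      have i2: "integrable lebesgue (M N)" using Mi N by simp
      have "W n = (LINT x|lebesgue. v x * mom_test 0 a l (Rn N) x - M N x)"
        unfolding W_def N_def[symmetric] by (rule Bochner_Integration.integral_diff[OF i1 i2, symmetric])
      also have "norm \<dots> \<le> (LINT x|lebesgue. K * inverse (N ^ 4) * indicator (cball (0::real^3) (2 * N)) x)"
      proof (rule order.trans[OF integral_norm_bound integral_mono_AE[OF _ _ est[OF N]]])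
        show "integrable lebesgue (\<lambda>x. norm (v x * mom_test 0 a l (Rn N) x - M N x))"
          by (intro integrable_norm Bochner_Integration.integrable_diff i1 i2)
        have "cball (0::real^3) (2 * N) \<in> lmeasurable" by (rule lmeasurable_cball)
        then show "integrable lebesgue (\<lambda>x. K * inverse (N ^ 4) * indicator (cball (0::real^3) (2 * N)) x)"
          by (intro integrable_mult_right) (simp add: fmeasurable_def)
      qed
      also have "\<dots> = K * inverse (N ^ 4) * (unit_ball_vol 3 * (2 * N) ^ 3)"
        using measure_ball_bound[of "2 * N"] N by simp
      also have "\<dots> = (K * (unit_ball_vol 3 * 8)) * inverse N"
        using N by (simp add: field_simps power3_eq_cube power4_eq_xxxx)
      finally show ?thesis by (simp add: N_def)
    qed
    then have "\<forall>\<^sub>F n in sequentially. norm (W n) \<le> (K * (unit_ball_vol 3 * 8)) * inverse (real (Suc n))"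
      unfolding eventually_sequentially by blast
    moreover have "(\<lambda>n. (K * (unit_ball_vol 3 * 8)) * inverse (real (Suc n))) \<longlonglongrightarrow> (K * (unit_ball_vol 3 * 8)) * 0"
      by (intro tendsto_intros LIMSEQ_inverse_real_of_nat)
    ultimately have "W \<longlonglongrightarrow> 0"
      by (intro Lim_null_comparison[of W]) simp_all
    then have "(\<lambda>n. W n + (LINT x|lebesgue. M (real (Suc n)) x)) \<longlonglongrightarrow> 0 + 0"
      using Mlim by (rule tendsto_add)
    then show ?thesis by (simp add: W_def)
  qed
  then have "(\<lambda>n. - (LINT x|lebesgue. v x * mom_test 0 a l (Rn (real (Suc n))) x)) \<longlonglongrightarrow> - 0"
    by (rule tendsto_minus)
  moreover have "\<forall>\<^sub>F n in sequentially. - (LINT x|lebesgue. v x * mom_test 0 a l (Rn (real (Suc n))) x) = mom v 0 a l g"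
  proof -
    have "- (LINT x|lebesgue. v x * mom_test 0 a l (Rn (real (Suc n))) x) = mom v 0 a l g"
      if "nat \<lceil>\<bar>\<beta>\<bar>\<rceil> \<le> n" for n
    proof -
      have "1 \<le> real (Suc n)" "\<beta> \<le> real (Suc n)" using that by linarith+
      then show ?thesis by (rule momN[symmetric])
    qed
    then show ?thesis unfolding eventually_sequentially by blast
  qed
  ultimately have "(\<lambda>n::nat. mom v 0 a l g) \<longlonglongrightarrow> - 0"
    by (rule Lim_transform_eventually)
  then show ?thesis by (simp add: LIMSEQ_const_iff)
qed

text \<open>The weak form of \<open>\<Delta>v + k\<^sup>2 v = 0\<close> in \<open>U\<close>, restricted to the test functions
  \<open>(a \<bullet> (x - c))^l h(|x - c|\<^sup>2)\<close>.\<close>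

definition helm :: "real \<Rightarrow> (real^3) set \<Rightarrow> (real^3 \<Rightarrow> complex) \<Rightarrow> bool" where
  "helm k U v \<longleftrightarrow> (\<forall>c a l h J. tests J h \<longrightarrow> (\<forall>x. sq_dist c x \<in> J \<longrightarrow> x \<in> U) \<longrightarrow>
     of_nat (l * (l - 1)) * of_real (a \<bullet> a) * mom v c a (l - 2) h
       + mom v c a l (Lop k (4 * real l + 6) h) = 0)"

text \<open>Once the moments of order l - 2 vanish, the weak equation says that order l kills the
  range of \<open>Lop\<close>, and the descent leaves only high derivatives. Those are the business
  of \<open>top\<close>, where radial solutions enter; \<open>ext\<close> bridges the gap if they
  serve only profiles in a smaller set J, such as one that avoids the centre.\<close>

lemma vanishing_moments:
  assumes k: "0 < k" and v: "loc_integrable v" and hv: "helm k U v"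
    and J: "J \<subseteq> J'" "\<And>x. sq_dist c x \<in> J' \<Longrightarrow> x \<in> U"
    and ext: "\<And>l h. (\<And>h. tests J h \<Longrightarrow> mom v c a l h = 0) \<Longrightarrow> tests J' h \<Longrightarrow> mom v c a l h = 0"
    and top: "\<And>l G. (\<And>h. tests J' h \<Longrightarrow> mom v c a l (Lop k (4 * real l + 6) h) = 0) \<Longrightarrow> tests J G \<Longrightarrow>
      mom v c a l ((Dr ^^ (l + 1)) G) = 0"
  shows "tests J' h \<Longrightarrow> mom v c a l h = 0"
proof (induction l arbitrary: h rule: less_induct)
  case (less l)
  have eq: "mom v c a l (Lop k (4 * real l + 6) g) = 0" if g: "tests J' g" for g
  proof -
    have e1: "of_nat (l * (l - 1)) * of_real (a \<bullet> a) * mom v c a (l - 2) g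
       + mom v c a l (Lop k (4 * real l + 6) g) = 0"
      using hv g J(2) unfolding helm_def by blast
    have e2: "of_nat (l * (l - 1)) * of_real (a \<bullet> a) * mom v c a (l - 2) g = 0"
    proof (cases "2 \<le> l")
      case True
      then have "mom v c a (l - 2) g = 0" by (intro less.IH g) simp
      then show ?thesis by simp
    next
      case False
      then have "l = 0 \<or> l = 1" by linarith
      then show ?thesis by auto
    qed
    show ?thesis using e1 unfolding e2 by simp
  qed
  have z: "mom v c a l g = 0" if g: "tests J g" for g
  proof (rule functional_descent[OF k, where \<Lambda>="mom v c a l" and J=J and l=l])
    show "mom v c a l (\<lambda>s. p * f s + q * g s) = p * mom v c a l f + q * mom v c a l g"
      if "tests J f" "tests J g" for f g p q
      using mom_lincomb[OF v that] .
    show "mom v c a l (Lop k (4 * real l + 6) h) = 0" if "tests J h" for h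
      by (rule eq[OF tests_mono[OF that J(1)]])
    show "mom v c a l ((Dr ^^ (l + 1)) G) = 0" if "tests J G" for G
      by (rule top[OF eq that])
  qed (rule g)
  show ?case by (rule ext[OF z less.prems])
qed

section \<open>Unique continuation, Rellich's lemma and entire outgoing solutions\<close>

lemma compact_lower:
  fixes K :: "real set"
  assumes "compact K" "K \<subseteq> {p<..}" obtains \<alpha> where "p < \<alpha>" "K \<subseteq> {\<alpha><..}"
proof (cases "K = {}")
  case True then show ?thesis using that[of "p + 1"] by simp
next
  case False
  then obtain m where m: "m \<in> K" "\<And>t. t \<in> K \<Longrightarrow> m \<le> t"
    using compact_attains_inf[OF assms(1)] by meson
  then have "p < m" using assms(2) by auto
  then show ?thesis using m(2) by (intro that[of "(p + m) / 2"]) force+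
qed

lemma compact_upper:
  fixes K :: "real set"
  assumes "compact K" "K \<subseteq> {..<q}" obtains \<beta> where "\<beta> < q" "K \<subseteq> {..<\<beta>}"
proof (cases "K = {}")
  case True then show ?thesis using that[of "q - 1"] by simp
next
  case False
  then obtain m where m: "m \<in> K" "\<And>t. t \<in> K \<Longrightarrow> t \<le> m"
    using compact_attains_sup[OF assms(1)] by meson
  then have "m < q" using assms(2) by auto
  then show ?thesis using m(2) by (intro that[of "(q + m) / 2"]) force+
qed

lemma Dr_iter_zero: "(Dr ^^ n) (\<lambda>_. 0) s = 0"
  by (rule Dr_eq_0_outside[of "{}"]) auto

text \<open>Rayleigh's formula for the inhomogeneous equation: 2 + 4 (l + 1) = 4 l + 6.\<close>

lemma Lop_Dr_iter_solution:
  assumes "smooth_on y {0<..}" "\<And>s. 0 < s \<Longrightarrow> Lop k 2 y s = G s" "0 < s"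
  shows "Lop k (4 * real l + 6) ((Dr ^^ (l + 1)) y) s = (Dr ^^ (l + 1)) G s"
proof -
  have "(Dr ^^ (l + 1)) G s = (Dr ^^ (l + 1)) (Lop k 2 y) s"
    by (rule Dr_iter_cong[of "{0<..}"]) (use assms in auto)
  also have "\<dots> = Lop k (2 + 4 * real (l + 1)) ((Dr ^^ (l + 1)) y) s"
    by (rule Dr_iter_Lop[OF assms(1)]) (use assms in auto)
  also have "2 + 4 * real (l + 1) = 4 * real l + 6" by simp
  finally show ?thesis by simp
qed

lemma continuous_eq_at_0:
  fixes f g :: "real \<Rightarrow> complex"
  assumes "continuous_on UNIV f" "continuous_on UNIV g" "\<And>s. 0 < s \<Longrightarrow> f s = g s" "0 \<le> s"
  shows "f s = g s"
proof (cases "s = 0")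
  case True
  have "(f \<longlongrightarrow> f 0) (at_right 0)" "(g \<longlongrightarrow> g 0) (at_right 0)"
    using assms(1,2) by (auto simp: continuous_on_def intro: filterlim_mono[OF _ order_refl at_le])
  moreover have "(f \<longlongrightarrow> g 0) (at_right 0)"
    using calculation(2) by (rule Lim_transform_eventually)
      (use assms(3) in \<open>auto simp: eventually_at_filter\<close>)
  ultimately show ?thesis using tendsto_unique[of "at_right (0::real)"] True by auto
qed (use assms in auto)

text \<open>Intervals with rational ends exhaust the open set, and countably many null sets unite to
  a null set.\<close>

lemma AE_zero_if_moments_zero_open:
  assumes v: "loc_integrable v" and J: "open J"
    and z: "\<And>a l h. tests J h \<Longrightarrow> mom v c a l h = 0"
  shows "AE x in lebesgue. sq_dist c x \<in> J \<longrightarrow> v x = 0"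
proof -
  define Q where "Q = {(p, q). p \<in> \<rat> \<and> q \<in> \<rat> \<and> {p..q} \<subseteq> J}"
  have "countable Q"
    by (rule countable_subset[of _ "\<rat> \<times> \<rat>"]) (auto simp: Q_def countable_rat)
  moreover have "AE x in lebesgue. fst pq < sq_dist c x \<longrightarrow> sq_dist c x < snd pq \<longrightarrow> v x = 0" if "pq \<in> Q" for pq
    by (rule AE_zero_if_moments_zero[OF v z, of J]) (use that in \<open>auto simp: Q_def\<close>)
  ultimately have "AE x in lebesgue. \<forall>pq\<in>Q. fst pq < sq_dist c x \<longrightarrow> sq_dist c x < snd pq \<longrightarrow> v x = 0"
    by (simp add: AE_ball_countable)
  then show ?thesis
  proof eventually_elim
    case (elim x)
    show ?case
    proof
      assume "sq_dist c x \<in> J"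
      then obtain e where e: "0 < e" "ball (sq_dist c x) e \<subseteq> J" using J open_contains_ball by blast
      obtain p where p: "p \<in> \<rat>" "sq_dist c x - e < p" "p < sq_dist c x"
        using Rats_dense_in_real[of "sq_dist c x - e" "sq_dist c x"] e(1) by auto
      obtain q where q: "q \<in> \<rat>" "sq_dist c x < q" "q < sq_dist c x + e"
        using Rats_dense_in_real[of "sq_dist c x" "sq_dist c x + e"] e(1) by auto
      have "{p..q} \<subseteq> ball (sq_dist c x) e" using p q by (auto simp: dist_real_def)
      then have "(p, q) \<in> Q" using e(2) p q by (auto simp: Q_def)
      then show "v x = 0" using elim p q by fastforce
    qed
  qed
qed

text \<open>The radial solution is normalised to vanish towards the boundary of the ball. Near the
  centre it is cut off where v is already known to vanish, so v does not see the error of the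
  cutoff.\<close>

theorem helm_unique_continuation:
  assumes k: "0 < k" and v: "loc_integrable v" and hv: "helm k U v"
    and U: "ball c \<rho> \<subseteq> U" and \<rho>: "0 < \<rho>" and \<rho>0: "0 < \<rho>0" and z0: "AE x in lebesgue. x \<in> ball c \<rho>0 \<longrightarrow> v x = 0"
  shows "AE x in lebesgue. x \<in> ball c \<rho> \<longrightarrow> v x = 0"
proof -
  let ?J = "{0<..<\<rho>\<^sup>2}"
  have inJ: "x \<in> U" if "sq_dist c x \<in> ?J" for x
  proof -
    have "(norm (x - c))\<^sup>2 < \<rho>\<^sup>2" using that by (simp add: sq_dist_eq)
    then have "norm (x - c) < \<rho>" using \<rho> by (simp add: power2_less_imp_less)
    then show ?thesis using U by (auto simp: dist_norm norm_minus_commute)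
  qed
  have top: "mom v c a l ((Dr ^^ (l + 1)) G) = 0"
    if eq: "\<And>h. tests ?J h \<Longrightarrow> mom v c a l (Lop k (4 * real l + 6) h) = 0" and G: "tests ?J G" for a l G
  proof -
    obtain K where K: "compact K" "K \<subseteq> ?J" "\<And>s. s \<notin> K \<Longrightarrow> G s = 0"
      using G unfolding tests_def by blast
    have sG: "smooth_on G UNIV" using G by (rule tests_smooth)
    have "K \<subseteq> {0<..}" "K \<subseteq> {..<\<rho>\<^sup>2}" using K(2) by auto
    obtain \<alpha> where \<alpha>: "0 < \<alpha>" "K \<subseteq> {\<alpha><..}" using compact_lower[OF K(1) \<open>K \<subseteq> {0<..}\<close>] .
    obtain \<beta> where \<beta>: "\<beta> < \<rho>\<^sup>2" "K \<subseteq> {..<\<beta>}" using compact_upper[OF K(1) \<open>K \<subseteq> {..<\<rho>\<^sup>2}\<close>] .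
    have Ga: "G s = 0" if "s \<le> \<alpha>" for s
      using \<alpha>(2) that by (intro K(3)) force
    have Gb: "G s = 0" if "\<beta> \<le> s" for s
      using \<beta>(2) that by (intro K(3)) force
    obtain y p q where y: "smooth_on y UNIV" "\<And>s. s \<le> \<alpha> \<Longrightarrow> y s = 0" "\<And>s. 0 < s \<Longrightarrow> Lop k 2 y s = G s"
      "\<And>s. \<beta> \<le> s \<Longrightarrow> y s = p * Ek k 0 s + q * Ek (- k) 0 s"
      using inhomogeneous_solution[OF k sG \<alpha>(1) Ga Gb] by metis
    define w where "w s = p * Ek k 0 s + q * Ek (- k) 0 s" for s
    have sw: "smooth_on w {0<..}" unfolding w_def[abs_def]
      by (intro smooth_on_add smooth_on_mult smooth_on_const smooth_Ek) auto
    have sy: "smooth_on y {0<..}" using y(1) smooth_on_subset by blast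
    \<comment> \<open>Subtracting the homogeneous solution that y equals beyond \<beta> moves the
      support from the outside to the inside: the result vanishes for s \<ge> \<beta>, at the price
      of smoothness at s = 0.\<close>
    define y2 where "y2 s = 1 * y s + - 1 * w s" for s
    have sy2: "smooth_on y2 {0<..}" unfolding y2_def[abs_def]
      by (intro smooth_on_add smooth_on_mult smooth_on_const sy sw) auto
    have Lw: "Lop k 2 w s = 0" if "0 < s" for s
      unfolding w_def[abs_def] using that Lop_Ek[OF that, of k k] Lop_Ek[OF that, of "-k" k]
      by (subst Lop_lincomb[OF smooth_Ek smooth_Ek]) auto
    have Ly2: "Lop k 2 y2 s = G s" if "0 < s" for s
      unfolding y2_def[abs_def] using that Lw[OF that] y(3)[OF that]
      by (subst Lop_lincomb[OF sy sw]) auto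
    define H where "H = (Dr ^^ (l + 1)) y2"
    have sH: "smooth_on H {0<..}" unfolding H_def by (rule smooth_on_Dr_iter[OF sy2])
    have H0: "H s = 0" if "max \<beta> 0 < s" for s
    proof -
      have "H s = (Dr ^^ (l + 1)) (\<lambda>_. 0) s" unfolding H_def
        by (rule Dr_iter_cong[of "{max \<beta> 0<..}"]) (use that y(4) in \<open>auto simp: y2_def w_def\<close>)
      then show ?thesis by (simp only: Dr_iter_zero)
    qed
    \<comment> \<open>The cutoff varies between r1 and r2; r2 < \<rho>0^2 places this where v
      vanishes, and r2 < \<rho>^2 keeps the profile inside the shell.\<close>
    define r2 where "r2 = min (\<rho>0\<^sup>2) (\<rho>\<^sup>2) / 2"
    define r1 where "r1 = r2 / 2"
    have r: "0 < r1" "r1 < r2" "r2 < \<rho>0\<^sup>2" "r2 < \<rho>\<^sup>2" 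
    proof -
      have "0 < \<rho>\<^sup>2" "0 < \<rho>0\<^sup>2" using \<rho> \<rho>0 by auto
      then show "0 < r1" "r1 < r2" "r2 < \<rho>0\<^sup>2" "r2 < \<rho>\<^sup>2" unfolding r1_def r2_def by linarith+
    qed
    obtain \<theta> :: "real \<Rightarrow> complex" where \<theta>: "smooth_on \<theta> UNIV" "\<And>s. s \<le> r1 \<Longrightarrow> \<theta> s = 1" "\<And>s. r2 \<le> s \<Longrightarrow> \<theta> s = 0"
      using cutoff_function[OF r(2)] by metis
    define h where "h s = (1 - \<theta> s) * H s" for s
    have "smooth_on h {0<..}" unfolding h_def[abs_def]
      by (intro smooth_on_mult smooth_on_diff smooth_on_const smooth_on_subset[OF \<theta>(1)] sH) auto
    then have "smooth_on h UNIV"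
      by (rule smooth_on_glue_zero[OF _ r(1)]) (use \<theta>(2) in \<open>auto simp: h_def\<close>)
    moreover have "h s = 0" if "s \<notin> {r1..max \<beta> r1}" for s
    proof (cases "s < r1")
      case True
      then show ?thesis using \<theta>(2)[of s] by (simp add: h_def)
    next
      case False
      then have "max \<beta> 0 < s" using that r(1) by auto
      then show ?thesis using H0[of s] by (simp add: h_def)
    qed
    moreover have "{r1..max \<beta> r1} \<subseteq> ?J" using r \<beta>(1) by auto
    ultimately have h: "tests ?J h" unfolding tests_def by (intro conjI exI[of _ "{r1..max \<beta> r1}"]) auto
    have "Lop k (4 * real l + 6) h s = (Dr ^^ (l + 1)) G s" if "r2 < s" for s
    proof -
      have "Lop k (4 * real l + 6) h s = Lop k (4 * real l + 6) H s"
        by (rule Lop_cong[of "{r2<..}"]) (use that \<theta>(3) in \<open>auto simp: h_def\<close>)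
      also have "\<dots> = (Dr ^^ (l + 1)) G s"
        unfolding H_def by (rule Lop_Dr_iter_solution[OF sy2 Ly2]) (use that r in auto)
      finally show ?thesis .
    qed
    note Lh = this
    have "mom v c a l ((Dr ^^ (l + 1)) G) = mom v c a l (Lop k (4 * real l + 6) h)"
      unfolding mom_def
    proof (rule integral_cong_AE)
      show "(\<lambda>x. v x * mom_test c a l ((Dr ^^ (l + 1)) G) x) \<in> borel_measurable lebesgue"
        by (rule borel_measurable_integrable[OF mom_integrable[OF v tests_Dr_iter[OF G]]])
      show "(\<lambda>x. v x * mom_test c a l (Lop k (4 * real l + 6) h) x) \<in> borel_measurable lebesgue"
        by (rule borel_measurable_integrable[OF mom_integrable[OF v tests_Lop[OF h]]])
      show "AE x in lebesgue. v x * mom_test c a l ((Dr ^^ (l + 1)) G) x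
          = v x * mom_test c a l (Lop k (4 * real l + 6) h) x"
        using z0
      proof eventually_elim
        case (elim x)
        show ?case
        proof (cases "r2 < sq_dist c x")
          case True
          then show ?thesis using Lh unfolding mom_test_def by simp
        next
          case False
          then have "(norm (x - c))\<^sup>2 < \<rho>0\<^sup>2" using r(3) by (simp add: sq_dist_eq)
          then have "norm (x - c) < \<rho>0" using \<rho>0 by (simp add: power2_less_imp_less)
          then have "x \<in> ball c \<rho>0" by (simp add: dist_norm norm_minus_commute)
          then show ?thesis using elim by simp
        qed
      qed
    qed
    then show ?thesis using eq[OF h] by simp
  qed
  have "mom v c a l h = 0" if "tests ?J h" for a l h
    by (rule vanishing_moments[OF k v hv order_refl inJ _ top that]) blast+
  from AE_zero_if_moments_zero_open[where J="?J", OF v _ this]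
  have "AE x in lebesgue. sq_dist c x \<in> ?J \<longrightarrow> v x = 0" by simp
  moreover have "AE x in lebesgue. x \<noteq> c"
    using AE_not_in[of "{c}" lebesgue] by (simp add: negligible_iff_null_sets[symmetric])
  ultimately show ?thesis
  proof eventually_elim
    case (elim x)
    show ?case
    proof
      assume "x \<in> ball c \<rho>"
      then have "(norm (x - c))\<^sup>2 < \<rho>\<^sup>2" by (intro power_strict_mono) (auto simp: dist_norm norm_minus_commute)
      then show "v x = 0" using elim by (auto simp: sq_dist_eq)
    qed
  qed
qed

lemma tests_cut_product:
  assumes "tests UNIV \<theta>" "smooth_on H UNIV" "\<And>s. s < \<alpha> \<Longrightarrow> H s = 0" "p < \<alpha>"
  shows "tests {p<..} (\<lambda>s. \<theta> s * H s)"
proof -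
  obtain K where K: "smooth_on \<theta> UNIV" "compact K" "\<And>s. s \<notin> K \<Longrightarrow> \<theta> s = 0"
    using assms(1) unfolding tests_def by blast
  have "smooth_on (\<lambda>s. \<theta> s * H s) UNIV" by (intro smooth_on_mult K(1) assms(2)) auto
  moreover have "compact (K \<inter> {\<alpha>..})" by (intro compact_Int_closed K(2)) auto
  moreover have "K \<inter> {\<alpha>..} \<subseteq> {p<..}" using assms(4) by auto
  moreover have "\<forall>s. s \<notin> K \<inter> {\<alpha>..} \<longrightarrow> \<theta> s * H s = 0" using K(3) assms(3) by auto
  ultimately show ?thesis unfolding tests_def by blast
qed

lemma Dr_iter_Ek_comb:
  assumes "\<And>s. \<beta> \<le> s \<Longrightarrow> y s = p * Ek k 0 s + q * Ek (- k) 0 s" "max \<beta> 0 + 1 \<le> s"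
  shows "(Dr ^^ n) y s = Ek_comb p q k n s"
proof -
  have "(Dr ^^ n) y s = (Dr ^^ n) (\<lambda>s. p * Ek k 0 s + q * Ek (- k) 0 s) s"
    by (rule Dr_iter_cong[of "{max \<beta> 0<..}"]) (use assms in auto)
  also have "\<dots> = Ek_comb p q k n s" unfolding Ek_comb_def
    by (rule Dr_iter_lincomb[OF smooth_Ek smooth_Ek]) (use assms in auto)
  finally show ?thesis .
qed

text \<open>The radial solution that vanishes up to slightly beyond the sphere |x| = R needs no
  cutoff there, but mixes outgoing and incoming waves at infinity. A zero far field makes the
  boundary term disappear for both kinds.\<close>

theorem helm_Rellich:
  assumes k: "0 < k" and v: "loc_integrable v" and hv: "helm k U v"
    and U: "\<And>x. R < norm x \<Longrightarrow> x \<in> U" and R: "0 \<le> R" and far: "far_asymptotic k v (\<lambda>_. 0)"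
  shows "AE x in lebesgue. R < norm x \<longrightarrow> v x = 0"
proof -
  let ?J = "{R\<^sup>2<..}"
  have norm_iff: "sq_dist 0 x \<in> ?J \<longleftrightarrow> R < norm x" for x :: "real^3"
  proof
    assume "sq_dist 0 x \<in> ?J"
    then have "R\<^sup>2 < (norm x)\<^sup>2" by (simp add: sq_dist_eq)
    then show "R < norm x" by (rule power2_less_imp_less) simp
  next
    assume "R < norm x"
    then have "R\<^sup>2 < (norm x)\<^sup>2" using R by (intro power_strict_mono) auto
    then show "sq_dist 0 x \<in> ?J" by (simp add: sq_dist_eq)
  qed
  have inJ: "x \<in> U" if "sq_dist 0 x \<in> ?J" for x
    using that U norm_iff by blast
  have top: "mom v 0 a l ((Dr ^^ (l + 1)) G) = 0"
    if eq: "\<And>h. tests ?J h \<Longrightarrow> mom v 0 a l (Lop k (4 * real l + 6) h) = 0" and G: "tests ?J G" for a l G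
  proof -
    obtain K where K: "compact K" "K \<subseteq> ?J" "\<And>s. s \<notin> K \<Longrightarrow> G s = 0"
      using G unfolding tests_def by blast
    have sG: "smooth_on G UNIV" using G by (rule tests_smooth)
    obtain \<alpha> where \<alpha>: "R\<^sup>2 < \<alpha>" "K \<subseteq> {\<alpha><..}" using compact_lower[OF K(1,2)] .
    have \<alpha>0: "0 < \<alpha>" using \<alpha>(1) zero_le_power2[of R] by linarith
    obtain \<beta> where \<beta>: "\<And>s. \<beta> \<le> s \<Longrightarrow> G s = 0" using tests_bounded_support[OF G] by metis
    have Ga: "G s = 0" if "s \<le> \<alpha>" for s
      using \<alpha>(2) that by (intro K(3)) force
    obtain y p q where y: "smooth_on y UNIV" "\<And>s. s \<le> \<alpha> \<Longrightarrow> y s = 0" "\<And>s. 0 < s \<Longrightarrow> Lop k 2 y s = G s"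
      "\<And>s. \<beta> \<le> s \<Longrightarrow> y s = p * Ek k 0 s + q * Ek (- k) 0 s"
      using inhomogeneous_solution[OF k sG \<alpha>0 Ga \<beta>] by metis
    define H where "H = (Dr ^^ (l + 1)) y"
    have sH: "smooth_on H UNIV" unfolding H_def by (rule smooth_on_Dr_iter[OF y(1)])
    have H0: "H s = 0" if "s < \<alpha>" for s
      unfolding H_def by (rule Dr_eq_0_outside[of "{\<alpha>..}"]) (use that y(2) in auto)
    show ?thesis
    proof (rule outgoing_limit[OF k v _ far sH, where \<beta>="max \<beta> 0 + 1" and p=p and q=q])
      show "H s = Ek_comb p q k (l + 1) s" if "max \<beta> 0 + 1 \<le> s" for s
        unfolding H_def by (rule Dr_iter_Ek_comb[OF y(4) that])
      show "Lop k (4 * real l + 6) H s = (Dr ^^ (l + 1)) G s" if "0 \<le> s" for s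
      proof (rule continuous_eq_at_0[OF _ _ _ that])
        show "continuous_on UNIV (Lop k (4 * real l + 6) H)"
          by (rule smooth_on_continuous[OF smooth_Lop[OF sH]]) simp
        show "continuous_on UNIV ((Dr ^^ (l + 1)) G)"
          by (rule smooth_on_continuous[OF smooth_on_Dr_iter[OF sG]])
        show "Lop k (4 * real l + 6) H s = (Dr ^^ (l + 1)) G s" if "0 < s" for s
          unfolding H_def by (rule Lop_Dr_iter_solution[OF smooth_on_subset[OF y(1)] y(3) that]) auto
      qed
      show "tests UNIV ((Dr ^^ (l + 1)) G)"
        by (rule tests_Dr_iter[OF tests_mono[OF G]]) simp
      show "(Dr ^^ (l + 1)) G s = 0" if "max \<beta> 0 + 1 \<le> s" for s
        by (rule Dr_eq_0_outside[of "{..\<beta>}"]) (use that \<beta> in auto)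
      show "mom v 0 a l (Lop k (4 * real l + 6) (\<lambda>s. \<theta> s * H s)) = 0" if "tests UNIV \<theta>" for \<theta>
        by (rule eq[OF tests_cut_product[OF that sH H0 \<alpha>(1)]])
    qed auto
  qed
  have "mom v 0 a l h = 0" if "tests ?J h" for a l h
    by (rule vanishing_moments[OF k v hv order_refl inJ _ top that]) blast+
  from AE_zero_if_moments_zero_open[where J="?J", OF v _ this]
  have "AE x in lebesgue. sq_dist 0 x \<in> ?J \<longrightarrow> v x = 0" by simp
  then show ?thesis by (simp only: norm_iff)
qed

text \<open>The centre is a null set, so profiles cut off on shrinking neighbourhoods of s = 0
  converge under the integral. Only boundedness of the cutoff matters, since it is never
  differentiated here.\<close>

lemma mom_zero_extend:
  assumes v: "loc_integrable v" and z: "\<And>h. tests {0<..} h \<Longrightarrow> mom v c a l h = 0" and h: "tests UNIV h"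
  shows "mom v c a l h = 0"
proof -
  have "(1::real) < 2" by simp
  from cutoff_function[OF this] obtain \<theta> :: "real \<Rightarrow> complex" where
    \<theta>: "smooth_on \<theta> UNIV" "\<And>s. s \<le> 1 \<Longrightarrow> \<theta> s = 1" "\<And>s. 2 \<le> s \<Longrightarrow> \<theta> s = 0" by metis
  have sd: "smooth_on (\<lambda>s. 1 - \<theta> s) UNIV" by (intro smooth_on_diff smooth_on_const \<theta>(1)) auto
  have "compact ((\<lambda>s. 1 - \<theta> s) ` {1..2})"
    by (intro compact_continuous_image continuous_on_subset[OF smooth_on_continuous[OF sd]]) auto
  then obtain B where B: "0 < B" "\<And>s. s \<in> {1..2} \<Longrightarrow> norm (1 - \<theta> s) \<le> B"
    unfolding bounded_pos[symmetric] by (metis bounded_pos compact_imp_bounded imageI)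
  have bd: "norm (1 - \<theta> s) \<le> B + 1" for s
    using B(1) B(2)[of s] \<theta>(2)[of s] \<theta>(3)[of s] by (cases "s \<le> 1"; cases "2 \<le> s") auto
  define hn where "hn n s = (1 - \<theta> (real (Suc n) * s)) * h s" for n s
  have hn: "tests {0<..} (hn n)" for n
  proof -
    have "tests {0<..} (\<lambda>s. h s * (1 - \<theta> (real (Suc n) * s)))"
    proof (rule tests_cut_product[OF h, where \<alpha>="1 / real (Suc n)"])
      show "smooth_on (\<lambda>s. 1 - \<theta> (real (Suc n) * s)) UNIV" by (rule smooth_rescale[OF sd])
      show "1 - \<theta> (real (Suc n) * s) = 0" if "s < 1 / real (Suc n)" for s
        using \<theta>(2)[of "real (Suc n) * s"] that by (simp add: field_simps del: of_nat_Suc)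
    qed simp
    then show ?thesis by (simp add: hn_def[abs_def] mult.commute)
  qed
  have i: "integrable lebesgue (\<lambda>x. v x * mom_test c a l h x)" by (rule mom_integrable[OF v h])
  have "(\<lambda>n. mom v c a l (hn n)) \<longlonglongrightarrow> mom v c a l h"
    unfolding mom_def
  proof (rule integral_dominated_convergence[where w="\<lambda>x. (B + 1) * norm (v x * mom_test c a l h x)"])
    show "(\<lambda>x. v x * mom_test c a l h x) \<in> borel_measurable lebesgue"
      by (rule borel_measurable_integrable[OF i])
    show "(\<lambda>x. v x * mom_test c a l (hn n) x) \<in> borel_measurable lebesgue" for n
      by (rule borel_measurable_integrable[OF mom_integrable[OF v hn]])
    show "integrable lebesgue (\<lambda>x. (B + 1) * norm (v x * mom_test c a l h x))"
      by (intro integrable_mult_right integrable_norm i)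
    have "AE x in lebesgue. x \<noteq> c"
      using AE_not_in[of "{c}" lebesgue] by (simp add: negligible_iff_null_sets[symmetric])
    then show "AE x in lebesgue. (\<lambda>n. v x * mom_test c a l (hn n) x) \<longlonglongrightarrow> v x * mom_test c a l h x"
    proof eventually_elim
      case (elim x)
      then have s: "0 < sq_dist c x" by (simp add: sq_dist_eq)
      obtain N where N: "2 / sq_dist c x < real N" using reals_Archimedean2 by blast
      have "v x * mom_test c a l h x = v x * mom_test c a l (hn n) x" if "N \<le> n" for n
      proof -
        have "2 / sq_dist c x \<le> real (Suc n)" using N that by linarith
        then have "2 \<le> real (Suc n) * sq_dist c x" using s by (simp add: field_simps del: of_nat_Suc)
        then show ?thesis using \<theta>(3) by (simp add: mom_test_def hn_def del: of_nat_Suc)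
      qed
      then show ?case
        by (intro Lim_transform_eventually[OF tendsto_const]) (auto simp: eventually_sequentially)
    qed
    show "AE x in lebesgue. norm (v x * mom_test c a l (hn n) x) \<le> (B + 1) * norm (v x * mom_test c a l h x)" for n
    proof (rule AE_I2)
      fix x
      have "v x * mom_test c a l (hn n) x = (1 - \<theta> (real (Suc n) * sq_dist c x)) * (v x * mom_test c a l h x)"
        by (simp add: mom_test_def hn_def)
      then show "norm (v x * mom_test c a l (hn n) x) \<le> (B + 1) * norm (v x * mom_test c a l h x)"
        using mult_right_mono[OF bd norm_ge_zero] by (simp only: norm_mult[of "1 - _"])
    qed
  qed
  moreover have "mom v c a l (hn n) = 0" for n by (rule z[OF hn])
  ultimately show ?thesis by (simp add: LIMSEQ_const_iff)
qed

text \<open>The profile must be smooth at the centre and purely outgoing at infinity. The solution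
  that starts from 0 is smooth but acquires incoming waves; a multiple of cos(k r) removes these and
  keeps the smoothness.\<close>

theorem helm_entire_outgoing:
  assumes k: "0 < k" and v: "loc_integrable v" and hv: "helm k UNIV v"
    and F: "continuous_on (sphere 0 1) F" and far: "far_asymptotic k v F"
  shows "AE x in lebesgue. v x = 0"
proof -
  let ?J = "{0<..} :: real set"
  have top: "mom v 0 a l ((Dr ^^ (l + 1)) G) = 0"
    if eq: "\<And>h. tests UNIV h \<Longrightarrow> mom v 0 a l (Lop k (4 * real l + 6) h) = 0" and G: "tests ?J G" for a l G
  proof -
    obtain K where K: "compact K" "K \<subseteq> ?J" "\<And>s. s \<notin> K \<Longrightarrow> G s = 0"
      using G unfolding tests_def by blast
    have sG: "smooth_on G UNIV" using G by (rule tests_smooth)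
    obtain \<alpha> where \<alpha>: "0 < \<alpha>" "K \<subseteq> {\<alpha><..}" using compact_lower[OF K(1,2)] .
    obtain \<beta> where \<beta>: "\<And>s. \<beta> \<le> s \<Longrightarrow> G s = 0" using tests_bounded_support[OF G] by metis
    have Ga: "G s = 0" if "s \<le> \<alpha>" for s
      using \<alpha>(2) that by (intro K(3)) force
    obtain y p q where y: "smooth_on y UNIV" "\<And>s. s \<le> \<alpha> \<Longrightarrow> y s = 0" "\<And>s. 0 < s \<Longrightarrow> Lop k 2 y s = G s"
      "\<And>s. \<beta> \<le> s \<Longrightarrow> y s = p * Ek k 0 s + q * Ek (- k) 0 s"
      using inhomogeneous_solution[OF k sG \<alpha>(1) Ga \<beta>] by metis
    obtain w where w: "smooth_on w UNIV" "\<And>s. 0 \<le> s \<Longrightarrow> w s = Ek k 0 s / 2 + Ek (- k) 0 s / 2"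
      using smooth_cos_sqrt[of k] by metis
    have Lw: "Lop k 2 w s = 0" if "0 < s" for s
    proof -
      have "Lop k 2 w s = Lop k 2 (\<lambda>s. 1 / 2 * Ek k 0 s + 1 / 2 * Ek (- k) 0 s) s"
        by (rule Lop_cong[of "{0<..}"]) (use w(2) that in auto)
      also have "\<dots> = 0"
        using that Lop_Ek[OF that, of k k] Lop_Ek[OF that, of "-k" k]
        by (subst Lop_lincomb[OF smooth_Ek smooth_Ek]) auto
      finally show ?thesis .
    qed
    \<comment> \<open>2 q cos(k r) = q exp(i k r) + q exp(-i k r), so that (p - q) exp(i k r) is
      left beyond max \<beta> 0.\<close>
    define y2 where "y2 s = 1 * y s + (- 2 * q) * w s" for s
    have sy2: "smooth_on y2 UNIV" unfolding y2_def[abs_def]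
      by (intro smooth_on_add smooth_on_mult smooth_on_const y(1) w(1)) auto
    have Ly2: "Lop k 2 y2 s = G s" if "0 < s" for s
      unfolding y2_def[abs_def] using that Lw[OF that] y(3)[OF that]
      by (subst Lop_lincomb[OF y(1) w(1)]) auto
    have y2b: "y2 s = (p - q) * Ek k 0 s + 0 * Ek (- k) 0 s" if "max \<beta> 0 \<le> s" for s
      using y(4)[of s] w(2)[of s] that by (simp add: y2_def algebra_simps)
    define H where "H = (Dr ^^ (l + 1)) y2"
    have sH: "smooth_on H UNIV" unfolding H_def by (rule smooth_on_Dr_iter[OF sy2])
    show ?thesis
    proof (rule outgoing_limit[OF k v F far sH, where \<beta>="max \<beta> 0 + 1" and p="p - q" and q=0])
      show "H s = Ek_comb (p - q) 0 k (l + 1) s" if "max \<beta> 0 + 1 \<le> s" for s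
        unfolding H_def by (rule Dr_iter_Ek_comb[where \<beta>="max \<beta> 0", OF y2b]) (use that in auto)
      show "Lop k (4 * real l + 6) H s = (Dr ^^ (l + 1)) G s" if "0 \<le> s" for s
      proof (rule continuous_eq_at_0[OF _ _ _ that])
        show "continuous_on UNIV (Lop k (4 * real l + 6) H)"
          by (rule smooth_on_continuous[OF smooth_Lop[OF sH]]) simp
        show "continuous_on UNIV ((Dr ^^ (l + 1)) G)"
          by (rule smooth_on_continuous[OF smooth_on_Dr_iter[OF sG]])
        show "Lop k (4 * real l + 6) H s = (Dr ^^ (l + 1)) G s" if "0 < s" for s
          unfolding H_def by (rule Lop_Dr_iter_solution[OF smooth_on_subset[OF sy2] Ly2 that]) auto
      qed
      show "tests UNIV ((Dr ^^ (l + 1)) G)"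
        by (rule tests_Dr_iter[OF tests_mono[OF G]]) simp
      show "(Dr ^^ (l + 1)) G s = 0" if "max \<beta> 0 + 1 \<le> s" for s
        by (rule Dr_eq_0_outside[of "{..\<beta>}"]) (use that \<beta> in auto)
      show "mom v 0 a l (Lop k (4 * real l + 6) (\<lambda>s. \<theta> s * H s)) = 0" if \<theta>: "tests UNIV \<theta>" for \<theta>
      proof (rule eq)
        obtain K where "smooth_on \<theta> UNIV" "compact K" "\<forall>s. s \<notin> K \<longrightarrow> \<theta> s = 0"
          using \<theta> unfolding tests_def by blast
        then show "tests UNIV (\<lambda>s. \<theta> s * H s)"
          unfolding tests_def using sH by (auto intro!: smooth_on_mult)
      qed
    qed auto
  qed
  have "mom v 0 a l h = 0" if "tests UNIV h" for a l h
    by (rule vanishing_moments[OF k v hv subset_UNIV _ mom_zero_extend[OF v] top that]) auto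
  from AE_zero_if_moments_zero_open[where J=UNIV, OF v _ this]
  show ?thesis by simp
qed

section \<open>Partial derivatives and Laplacian of the moment test functions\<close>

section \<open>From Maxwell's equations to the Helmholtz equation\<close>

definition pd :: "3 \<Rightarrow> (real^3 \<Rightarrow> complex) \<Rightarrow> real^3 \<Rightarrow> complex" where
  "pd i f x = frechet_derivative f (at x) (axis i 1)"

lemma pdI: "(f has_derivative f') (at x) \<Longrightarrow> pd i f x = f' (axis i 1)"
  unfolding pd_def by (simp add: frechet_derivative_at[symmetric])

lemma smooth_has_derivative:
  "smooth_on f UNIV \<Longrightarrow> (f has_derivative frechet_derivative f (at x)) (at x)"
  using smooth_on_differentiable[of f UNIV x] frechet_derivative_works by blast

lemma smooth_pd: "smooth_on f UNIV \<Longrightarrow> smooth_on (pd i f) UNIV"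
  unfolding pd_def[abs_def] by (rule smooth_on_frechet)

lemma pd_add: "smooth_on f UNIV \<Longrightarrow> smooth_on g UNIV \<Longrightarrow> pd i (\<lambda>x. f x + g x) = (\<lambda>x. pd i f x + pd i g x)"
  by (rule ext, subst pdI[OF has_derivative_add[OF smooth_has_derivative smooth_has_derivative]])
    (simp_all add: pd_def)

lemma pd_mult: "smooth_on f UNIV \<Longrightarrow> smooth_on g UNIV \<Longrightarrow>
    pd i (\<lambda>x. f x * g x) = (\<lambda>x. f x * pd i g x + pd i f x * g x)"
  by (rule ext, subst pdI[OF has_derivative_mult[OF smooth_has_derivative smooth_has_derivative]])
    (simp_all add: pd_def)

lemma pd_const: "pd i (\<lambda>_. c) = (\<lambda>_. 0)"
  by (rule ext, subst pdI[OF has_derivative_const]) simp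

lemma pd_cmult: "smooth_on f UNIV \<Longrightarrow> pd i (\<lambda>x. c * f x) = (\<lambda>x. c * pd i f x)"
  using pd_mult[OF smooth_on_const[OF open_UNIV, of c], of f i] by (simp add: pd_const)

lemma pd_minus: "smooth_on f UNIV \<Longrightarrow> pd i (\<lambda>x. - f x) = (\<lambda>x. - pd i f x)"
  using pd_cmult[of f i "- 1"] by simp

lemma pd_outside:
  assumes "closed K" "\<And>x. x \<notin> K \<Longrightarrow> f x = 0" "x \<notin> K"
  shows "pd i f x = 0"
proof -
  have "((\<lambda>_. 0) has_derivative (\<lambda>_. 0)) (at x)" by simp
  then have "(f has_derivative (\<lambda>_. 0)) (at x)"
    by (rule has_derivative_transform_within_open[of _ _ _ _ "- K"]) (use assms in auto)
  then show ?thesis by (simp add: pdI)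
qed

text \<open>Symmetry of mixed partial derivatives, obtained by closure under the operations that build
  the test functions.\<close>

definition sym_smooth :: "(real^3 \<Rightarrow> complex) \<Rightarrow> bool" where
  "sym_smooth f \<longleftrightarrow> smooth_on f UNIV \<and> (\<forall>i j. pd i (pd j f) = pd j (pd i f))"

lemma sym_smooth_const: "sym_smooth (\<lambda>_. c)"
  by (simp add: sym_smooth_def pd_const smooth_on_const)

lemma sym_smooth_add: "sym_smooth f \<Longrightarrow> sym_smooth g \<Longrightarrow> sym_smooth (\<lambda>x. f x + g x)"
  unfolding sym_smooth_def by (simp add: pd_add smooth_pd smooth_on_add)

lemma pd_pd_mult:
  assumes "smooth_on f UNIV" "smooth_on g UNIV"
  shows "pd i (pd j (\<lambda>x. f x * g x)) =
    (\<lambda>x. f x * pd i (pd j g) x + pd i f x * pd j g x + pd j f x * pd i g x + pd i (pd j f) x * g x)"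
  by (rule ext) (simp add: assms pd_mult pd_add smooth_pd smooth_on_mult add_ac)

lemma sym_smooth_mult: "sym_smooth f \<Longrightarrow> sym_smooth g \<Longrightarrow> sym_smooth (\<lambda>x. f x * g x)"
  unfolding sym_smooth_def by (auto simp: pd_pd_mult smooth_on_mult add_ac)

lemma sym_smooth_power: "sym_smooth f \<Longrightarrow> sym_smooth (\<lambda>x. f x ^ n)"
  by (induction n) (simp_all add: sym_smooth_const sym_smooth_mult)

definition lin :: "real^3 \<Rightarrow> real^3 \<Rightarrow> real^3 \<Rightarrow> complex" where
  "lin a c x = of_real (a \<bullet> (x - c))"

lemma smooth_lin: "smooth_on (lin a c) UNIV"
  unfolding lin_def[abs_def]
  by (intro smooth_on_bounded_linear[OF _ bounded_linear_of_real] smooth_on_inner smooth_on_diff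
      smooth_on_ident smooth_on_const) auto

lemma pd_lin: "pd i (lin a c) = (\<lambda>_. of_real (a $ i))"
proof
  fix x
  have "(lin a c has_derivative (\<lambda>v. complex_of_real (a \<bullet> v))) (at x)"
    unfolding lin_def[abs_def] by (auto intro!: derivative_eq_intros)
  from pdI[OF this] show "pd i (lin a c) x = of_real (a $ i)" by (simp add: inner_axis)
qed

lemma sym_smooth_lin: "sym_smooth (lin a c)"
  by (simp add: sym_smooth_def smooth_lin pd_lin pd_const)

definition radial :: "(real \<Rightarrow> complex) \<Rightarrow> real^3 \<Rightarrow> real^3 \<Rightarrow> complex" where
  "radial h c x = h (sq_dist c x)"

lemma smooth_radial: "smooth_on h UNIV \<Longrightarrow> smooth_on (radial h c) UNIV"
  unfolding radial_def[abs_def] sq_dist_def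
  by (rule smooth_on_compose[where I=UNIV])
    (auto intro!: smooth_on_inner smooth_on_diff smooth_on_ident smooth_on_const)

lemma pd_radial:
  assumes "smooth_on h UNIV"
  shows "pd i (radial h c) = (\<lambda>x. 2 * lin (axis i 1) c x * radial (Dr h) c x)"
proof
  fix x
  have 1: "(sq_dist c has_derivative (\<lambda>v. 2 * ((x - c) \<bullet> v))) (at x)"
    unfolding sq_dist_def[abs_def] by (auto intro!: derivative_eq_intros simp: inner_commute)
  have 2: "(h has_derivative (\<lambda>r. r *\<^sub>R Dr h (sq_dist c x))) (at (sq_dist c x))"
    using Dr_works[OF assms, of "sq_dist c x"] by (simp add: has_vector_derivative_def)
  have "(radial h c has_derivative (\<lambda>v. (2 * ((x - c) \<bullet> v)) *\<^sub>R Dr h (sq_dist c x))) (at x)"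
    unfolding radial_def[abs_def] by (rule has_derivative_compose[OF 1 2])
  from pdI[OF this] show "pd i (radial h c) x = 2 * lin (axis i 1) c x * radial (Dr h) c x"
    by (simp add: lin_def radial_def inner_commute scaleR_conv_of_real)
qed

lemma pd_pd_radial:
  assumes "smooth_on h UNIV"
  shows "pd i (pd j (radial h c)) = (\<lambda>x. (if i = j then 2 else 0) * radial (Dr h) c x
    + 4 * lin (axis i 1) c x * lin (axis j 1) c x * radial (Dr (Dr h)) c x)"
proof -
  have "pd i (\<lambda>x. 2 * lin (axis j 1) c x) = (\<lambda>x. if i = j then 2 else 0)"
    by (simp add: pd_cmult smooth_lin pd_lin axis_def)
  then show ?thesis
    using assms
    by (simp add: pd_radial smooth_on_Dr pd_mult smooth_lin smooth_radial smooth_on_mult smooth_on_const)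
      (auto simp: algebra_simps)
qed

lemma sym_smooth_radial: "smooth_on h UNIV \<Longrightarrow> sym_smooth (radial h c)"
  unfolding sym_smooth_def by (auto simp: pd_pd_radial smooth_radial)

lemma mom_test_eq: "mom_test c a l h = (\<lambda>x. lin a c x ^ l * radial h c x)"
  by (auto simp: mom_test_def lin_def radial_def)

lemma pd_lin_power: "pd i (\<lambda>x. lin a c x ^ n) = (\<lambda>x. of_nat n * of_real (a $ i) * lin a c x ^ (n - 1))"
proof (induction n)
  case (Suc n)
  have "pd i (\<lambda>x. lin a c x * lin a c x ^ n) =
      (\<lambda>x. lin a c x * (of_nat n * of_real (a $ i) * lin a c x ^ (n - 1)) + of_real (a $ i) * lin a c x ^ n)"
    by (subst pd_mult) (simp_all add: smooth_lin smooth_on_power Suc pd_lin)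
  also have "\<dots> = (\<lambda>x. of_nat (Suc n) * of_real (a $ i) * lin a c x ^ (Suc n - 1))"
    by (cases n) (auto simp: algebra_simps)
  finally show ?case by simp
qed (simp add: pd_const)

lemma sym_smooth_mom_test: "smooth_on h UNIV \<Longrightarrow> sym_smooth (mom_test c a l h)"
  unfolding mom_test_eq by (intro sym_smooth_mult sym_smooth_power sym_smooth_lin sym_smooth_radial)

text \<open>Symmetry is needed one order higher as well: the gradient of a first partial derivative
  serves as a test field, and its curl has to vanish.\<close>

lemma sym_smooth_pd_mom_test:
  assumes "smooth_on h UNIV" shows "sym_smooth (pd i (mom_test c a l h))"
proof -
  have "pd i (mom_test c a l h) = (\<lambda>x. lin a c x ^ l * (2 * lin (axis i 1) c x * radial (Dr h) c x)
      + of_nat l * of_real (a $ i) * lin a c x ^ (l - 1) * radial h c x)"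
    unfolding mom_test_eq
    by (subst pd_mult) (simp_all add: assms smooth_lin smooth_on_power smooth_radial pd_radial pd_lin_power)
  moreover have "sym_smooth \<dots>"
    by (intro sym_smooth_add sym_smooth_mult sym_smooth_power sym_smooth_lin sym_smooth_radial
        sym_smooth_const smooth_on_Dr assms)
  ultimately show ?thesis by simp
qed

text \<open>Origin of 4 l + 6: in three dimensions the Laplacian of h(s) is 4 s h'' + 6 h'; with t =
  a \<bullet> (x - c) the mixed term, twice the product of the gradients of t^l and h(s), adds 4 l
  t^l h'; and the Laplacian of t^l is l (l - 1) |a|^2 t^(l - 2).\<close>

lemma laplacian_mom_test:
  assumes h: "smooth_on h UNIV"
  shows "pd 1 (pd 1 (mom_test c a l h)) x + pd 2 (pd 2 (mom_test c a l h)) x + pd 3 (pd 3 (mom_test c a l h)) x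
      + of_real (k\<^sup>2) * mom_test c a l h x
    = of_nat (l * (l - 1)) * of_real (a \<bullet> a) * mom_test c a (l - 2) h x
      + mom_test c a l (Lop k (4 * real l + 6) h) x"
proof -
  let ?t = "lin a c x" and ?e = "\<lambda>i. lin (axis i 1) c x"
  let ?h = "radial h c x" and ?h1 = "radial (Dr h) c x" and ?h2 = "radial (Dr (Dr h)) c x"
  have p2: "pd i (pd i (\<lambda>x. lin a c x ^ l)) x = of_nat (l * (l - 1)) * of_real (a $ i * a $ i) * ?t ^ (l - 2)" for i
  proof -
    have "pd i (pd i (\<lambda>x. lin a c x ^ l)) = (\<lambda>x. of_nat l * of_real (a $ i) * (of_nat (l - 1) * of_real (a $ i) * lin a c x ^ (l - 1 - 1)))"
      unfolding pd_lin_power by (subst pd_cmult) (simp_all add: pd_lin_power smooth_on_power smooth_lin)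
    then show ?thesis by (simp add: diff_diff_add numeral_2_eq_2)
  qed
  have d: "pd i (pd i (mom_test c a l h)) x = ?t ^ l * (2 * ?h1 + 4 * ?e i * ?e i * ?h2)
      + 2 * (of_nat l * of_real (a $ i) * ?t ^ (l - 1) * (2 * ?e i * ?h1))
      + of_nat (l * (l - 1)) * of_real (a $ i * a $ i) * ?t ^ (l - 2) * ?h" for i
  proof -
    have l1: "pd i (\<lambda>x. lin a c x ^ l) x = of_nat l * of_real (a $ i) * ?t ^ (l - 1)"
      by (simp add: pd_lin_power)
    have r1: "pd i (radial h c) x = 2 * ?e i * ?h1"
      by (simp add: pd_radial h)
    have r2: "pd i (pd i (radial h c)) x = 2 * ?h1 + 4 * ?e i * ?e i * ?h2"
      by (simp add: pd_pd_radial h)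
    have "pd i (pd i (mom_test c a l h)) x = ?t ^ l * pd i (pd i (radial h c)) x
        + pd i (\<lambda>x. lin a c x ^ l) x * pd i (radial h c) x + pd i (\<lambda>x. lin a c x ^ l) x * pd i (radial h c) x
        + pd i (pd i (\<lambda>x. lin a c x ^ l)) x * ?h"
      unfolding mom_test_eq
      by (rule fun_cong[OF pd_pd_mult]) (auto intro: smooth_on_power smooth_lin smooth_radial h)
    then show ?thesis unfolding l1 r1 r2 p2 by (simp add: algebra_simps)
  qed
  have ev: "?e i = of_real ((x - c) $ i)" for i by (simp add: lin_def inner_commute[of "axis i 1"] inner_axis)
  have es: "?e 1 * ?e 1 + ?e 2 * ?e 2 + ?e 3 * ?e 3 = of_real (sq_dist c x)"
    unfolding ev sq_dist_def inner_vec_def by (simp add: sum_3)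
  have ea: "of_real (a $ 1) * ?e 1 + of_real (a $ 2) * ?e 2 + of_real (a $ 3) * ?e 3 = ?t"
    unfolding ev by (simp add: lin_def inner_vec_def sum_3)
  have aa: "complex_of_real (a $ 1 * a $ 1) + of_real (a $ 2 * a $ 2) + of_real (a $ 3 * a $ 3) = of_real (a \<bullet> a)"
    by (simp add: inner_vec_def sum_3)
  \<comment> \<open>For l = 0 the exponent l - 1 is truncated; the factor l makes both sides
    0.\<close>
  have tl: "of_nat l * ?t ^ (l - 1) * ?t = of_nat l * ?t ^ l" by (cases l) auto
  have "pd 1 (pd 1 (mom_test c a l h)) x + pd 2 (pd 2 (mom_test c a l h)) x + pd 3 (pd 3 (mom_test c a l h)) x
    = ?t ^ l * (6 * ?h1 + 4 * (?e 1 * ?e 1 + ?e 2 * ?e 2 + ?e 3 * ?e 3) * ?h2)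
      + 4 * (of_nat l * ?t ^ (l - 1) * (of_real (a $ 1) * ?e 1 + of_real (a $ 2) * ?e 2 + of_real (a $ 3) * ?e 3)) * ?h1
      + of_nat (l * (l - 1)) * (of_real (a $ 1 * a $ 1) + of_real (a $ 2 * a $ 2) + of_real (a $ 3 * a $ 3)) * ?t ^ (l - 2) * ?h"
    unfolding d by (simp only: distrib_left distrib_right mult_ac add_ac) (simp add: algebra_simps)
  also have "\<dots> = ?t ^ l * (6 * ?h1 + 4 * of_real (sq_dist c x) * ?h2) + 4 * (of_nat l * ?t ^ l) * ?h1
      + of_nat (l * (l - 1)) * of_real (a \<bullet> a) * ?t ^ (l - 2) * ?h"
    unfolding es ea aa tl ..
  finally show ?thesis
    by (simp add: mom_test_eq radial_def Lop_def algebra_simps)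
qed

section \<open>Test fields by components, and the passage from weak curls to the Helmholtz
  equation\<close>

subsection \<open>Vector fields given by components\<close>

definition vfield :: "(3 \<Rightarrow> real^3 \<Rightarrow> complex) \<Rightarrow> field3" where
  "vfield g x = (\<chi> j. g j x)"

definition vcurl :: "(3 \<Rightarrow> real^3 \<Rightarrow> complex) \<Rightarrow> 3 \<Rightarrow> real^3 \<Rightarrow> complex" where
  "vcurl g j x = (if j = 1 then pd 2 (g 3) x - pd 3 (g 2) x
     else if j = 2 then pd 3 (g 1) x - pd 1 (g 3) x else pd 1 (g 2) x - pd 2 (g 1) x)"

lemma smooth_vfield:
  assumes "\<And>j. smooth_on (g j) UNIV" shows "smooth_on (vfield g) UNIV"
proof -
  have "linear (\<lambda>z::complex. axis j z :: complex^3)" for j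
    by (rule linearI) (auto simp: vec_eq_iff axis_def)
  then have "bounded_linear (\<lambda>z::complex. axis j z :: complex^3)" for j
    by (simp add: linear_conv_bounded_linear)
  then have "smooth_on (\<lambda>x. axis j (g j x) :: complex^3) UNIV" for j
    by (rule smooth_on_bounded_linear[OF open_UNIV _ assms])
  then have "smooth_on (\<lambda>x. \<Sum>j\<in>UNIV. axis j (g j x) :: complex^3) UNIV"
    by (rule smooth_on_sum[OF open_UNIV])
  moreover have "(\<lambda>x. \<Sum>j\<in>UNIV. axis j (g j x) :: complex^3) = vfield g"
    by (auto simp: vfield_def vec_eq_iff axis_def if_distrib cong: if_cong)
  ultimately show ?thesis by simp
qed

lemma partial_component:
  assumes "smooth_on \<phi> UNIV" shows "partial i \<phi> x $ j = pd i (\<lambda>x. \<phi> x $ j) x"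
proof -
  have "(\<phi> has_derivative frechet_derivative \<phi> (at x)) (at x)"
    using smooth_on_differentiable[OF assms UNIV_I] frechet_derivative_works by blast
  from bounded_linear.has_derivative[OF bounded_linear_vec_nth this]
  have "((\<lambda>x. \<phi> x $ j) has_derivative (\<lambda>v. frechet_derivative \<phi> (at x) v $ j)) (at x)" .
  from pdI[OF this] show ?thesis by (simp add: partial_def)
qed

lemma curl_vfield:
  assumes "\<And>j. smooth_on (g j) UNIV" shows "curl (vfield g) = vfield (vcurl g)"
proof
  fix x
  have c: "(\<lambda>x. vfield g x $ j) = g j" for j by (simp add: vfield_def)
  show "curl (vfield g) x = vfield (vcurl g) x"
    unfolding vec_eq_iff
    by (simp add: curl_def partial_component[OF smooth_vfield[OF assms]] c vfield_def vcurl_def forall_3)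
qed

lemma smooth_vcurl:
  assumes "\<And>j. smooth_on (g j) UNIV" shows "smooth_on (vcurl g j) UNIV"
proof -
  have "vcurl g j = (if j = 1 then (\<lambda>x. pd 2 (g 3) x - pd 3 (g 2) x)
     else if j = 2 then (\<lambda>x. pd 3 (g 1) x - pd 1 (g 3) x) else (\<lambda>x. pd 1 (g 2) x - pd 2 (g 1) x))"
    by (auto simp: vcurl_def)
  then show ?thesis using assms by (auto intro!: smooth_on_diff smooth_pd)
qed

lemma vcurl_outside:
  assumes "closed K" "\<And>j x. x \<notin> K \<Longrightarrow> g j x = 0" "x \<notin> K"
  shows "vcurl g j x = 0"
proof -
  have "pd i (g j) x = 0" for i j by (rule pd_outside[OF assms(1) _ assms(3)]) (rule assms(2))
  then show ?thesis by (simp add: vcurl_def)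
qed

lemma test_field_vfield:
  assumes "\<And>j. smooth_on (g j) UNIV" "compact K" "K \<subseteq> U" "\<And>j x. x \<notin> K \<Longrightarrow> g j x = 0"
  shows "test_field U (vfield g)"
proof -
  have "{x. vfield g x \<noteq> 0} \<subseteq> K" using assms(4) by (auto simp: vfield_def vec_eq_iff)
  then have cl: "closure {x. vfield g x \<noteq> 0} \<subseteq> K"
    by (rule closure_minimal) (rule compact_imp_closed[OF assms(2)])
  then have "compact (closure {x. vfield g x \<noteq> 0})"
    using compact_Int_closed[OF assms(2) closed_closure] by (metis Int_absorb1)
  then show ?thesis using cl assms(3) smooth_vfield[OF assms(1)] by (auto simp: test_field_def Cj_on_infinity_iff)
qed

lemma cdot_vfield: "cdot u (vfield g x) = u $ 1 * g 1 x + u $ 2 * g 2 x + u $ 3 * g 3 x"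
  by (simp add: cdot_def vfield_def sum_3)

subsection \<open>Locally square integrable fields\<close>

definition loc_L2 :: "field3 \<Rightarrow> bool" where
  "loc_L2 u \<longleftrightarrow> (\<forall>r. (\<lambda>x. indicator (ball 0 r) x *\<^sub>R u x) \<in> borel_measurable lebesgue
     \<and> integrable lebesgue (\<lambda>x. indicator (ball 0 r) x * (norm (u x))\<^sup>2))"

lemma loc_L2_component:
  assumes "loc_L2 u" shows "loc_integrable (\<lambda>x. u x $ j)"
  unfolding loc_integrable_def
proof
  fix r
  let ?b = "indicator (ball (0::real^3) r) :: real^3 \<Rightarrow> real"
  have m: "(\<lambda>x. ?b x *\<^sub>R u x) \<in> borel_measurable lebesgue"
    and i: "integrable lebesgue (\<lambda>x. ?b x * (norm (u x))\<^sup>2)"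
    using assms unfolding loc_L2_def by auto
  have "(\<lambda>x. (?b x *\<^sub>R u x) $ j) \<in> borel_measurable lebesgue"
    by (rule borel_measurable_continuous_on[OF _ m]) (intro continuous_intros)
  then have m': "(\<lambda>x. ?b x *\<^sub>R (u x $ j)) \<in> borel_measurable lebesgue" by simp
  have "ball (0::real^3) r \<in> lmeasurable" by (rule lmeasurable_ball)
  then have ib: "integrable lebesgue ?b" by (simp add: fmeasurable_def)
  show "integrable lebesgue (\<lambda>x. ?b x *\<^sub>R (u x $ j))"
  proof (rule Bochner_Integration.integrable_bound[OF Bochner_Integration.integrable_add[OF ib i] m'])
    show "AE x in lebesgue. norm (?b x *\<^sub>R (u x $ j)) \<le> norm (?b x + ?b x * (norm (u x))\<^sup>2)"
    proof (rule AE_I2)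
      fix x
      have "norm (u x $ j) \<le> norm (u x)" by (rule Finite_Cartesian_Product.norm_nth_le)
      also have "\<dots> \<le> 1 + (norm (u x))\<^sup>2"
        using sum_squares_bound[of "norm (u x)" 1] norm_ge_zero[of "u x"] unfolding power2_eq_square by linarith
      finally show "norm (?b x *\<^sub>R (u x $ j)) \<le> norm (?b x + ?b x * (norm (u x))\<^sup>2)"
        by (auto simp: indicator_def)
    qed
  qed
qed

text \<open>Weak curl with integrals over the whole space, so that U restricts the test fields only.
  Shrinking U or modifying fields on null sets then leaves the measure untouched.\<close>

definition wcurl :: "(real^3) set \<Rightarrow> field3 \<Rightarrow> field3 \<Rightarrow> bool" where
  "wcurl U u w \<longleftrightarrow> (\<forall>\<phi>. test_field U \<phi> \<longrightarrow>
     (LINT x|lebesgue. cdot (u x) (curl \<phi> x)) = (LINT x|lebesgue. cdot (w x) (\<phi> x)))"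

lemma cdot_vfield_integral:
  assumes u: "loc_L2 u" and g: "\<And>j. smooth_on (g j) UNIV" "compact K" "\<And>j x. x \<notin> K \<Longrightarrow> g j x = 0"
  shows "integrable lebesgue (\<lambda>x. cdot (u x) (vfield g x))"
    and "integrable lebesgue (\<lambda>x. u x $ i * g j x)"
proof -
  obtain r where r: "\<And>x. x \<in> K \<Longrightarrow> norm x \<le> r"
    using compact_imp_bounded[OF g(2)] unfolding bounded_iff by blast
  have i: "integrable lebesgue (\<lambda>x. u x $ i * g j x)" for i j
  proof (rule loc_integrable_mult_continuous[OF loc_L2_component[OF u], where r="r + 1"])
    show "continuous_on UNIV (g j)" by (rule smooth_on_continuous[OF g(1)])
    show "g j x = 0" if "r + 1 \<le> norm x" for x using r[of x] that by (intro g(3)) auto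
  qed
  show "integrable lebesgue (\<lambda>x. u x $ i * g j x)" by (rule i)
  show "integrable lebesgue (\<lambda>x. cdot (u x) (vfield g x))"
    unfolding cdot_vfield by (intro Bochner_Integration.integrable_add i)
qed

text \<open>Tested form of curl curl = grad div - Laplacian. The double curl of \<psi> e_m is moved
  onto u by the two equations, which gives k^2; the gradient part drops out because \<beta> u is a
  weak curl and hence divergence free.\<close>

lemma maxwell_imp_helm:
  assumes u: "loc_L2 u" and w: "loc_L2 w"
    and cu: "wcurl U u (\<lambda>x. \<alpha> *s w x)" and cw: "wcurl U w (\<lambda>x. \<beta> *s u x)"
    and k: "\<alpha> * \<beta> = of_real (k\<^sup>2)" "\<beta> \<noteq> 0"
  shows "helm k U (\<lambda>x. u x $ m)"
  unfolding helm_def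
proof (intro allI impI)
  fix c a l h J assume h: "tests J h" and J: "\<forall>x. sq_dist c x \<in> J \<longrightarrow> x \<in> U"
  let ?\<psi> = "mom_test c a l h"
  obtain K0 where K0: "compact K0" "K0 \<subseteq> J" "\<And>s. s \<notin> K0 \<Longrightarrow> h s = 0" using h unfolding tests_def by blast
  have sh: "smooth_on h UNIV" using h by (rule tests_smooth)
  define K where "K = sq_dist c -` K0"
  have KU: "K \<subseteq> U" using J K0(2) by (auto simp: K_def)
  have K: "compact K"
  proof -
    have "continuous_on UNIV (sq_dist c)" unfolding sq_dist_def[abs_def] by (intro continuous_intros)
    then have "closed K" unfolding K_def using compact_imp_closed[OF K0(1)]
      by (intro continuous_closed_vimage) (auto simp: continuous_on_eq_continuous_at)
    moreover have "bounded K"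
    proof -
      obtain B where B: "\<And>s. s \<in> K0 \<Longrightarrow> \<bar>s\<bar> \<le> B"
        using compact_imp_bounded[OF K0(1)] unfolding bounded_iff by auto
      have "norm x \<le> norm c + (B + 1)" if "x \<in> K" for x
      proof -
        have "\<bar>sq_dist c x\<bar> \<le> B" using that B by (simp add: K_def)
        then have "(norm (x - c))\<^sup>2 \<le> B" by (simp add: sq_dist_eq)
        moreover have "2 * norm (x - c) \<le> (norm (x - c))\<^sup>2 + 1"
          using sum_squares_bound[of "norm (x - c)" 1] by (simp add: power2_eq_square)
        moreover have "norm x \<le> norm c + norm (x - c)" using norm_triangle_sub[of x c] by simp
        ultimately show ?thesis using norm_ge_zero[of "x - c"] by linarith
      qed
      then show ?thesis unfolding bounded_iff by blast
    qed
    ultimately show ?thesis by (simp add: compact_eq_bounded_closed)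
  qed
  note Kc = compact_imp_closed[OF K]
  have \<psi>0: "?\<psi> x = 0" if "x \<notin> K" for x using that K0(3) by (simp add: mom_test_def K_def)
  have s\<psi>: "smooth_on ?\<psi> UNIV" using sym_smooth_mom_test[OF sh] by (simp add: sym_smooth_def)
  define P where "P i = pd i ?\<psi>" for i
  have sP: "smooth_on (P i) UNIV" and P0: "x \<notin> K \<Longrightarrow> P i x = 0" for i x
    unfolding P_def using smooth_pd[OF s\<psi>] pd_outside[OF Kc \<psi>0] by auto
  have symP: "pd i (P j) = pd j (P i)" for i j
    using sym_smooth_mom_test[OF sh] by (simp add: sym_smooth_def P_def)
  have symPP: "pd i (pd j (P n)) = pd j (pd i (P n))" for i j n
    using sym_smooth_pd_mom_test[OF sh] by (simp add: sym_smooth_def P_def)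
  \<comment> \<open>The test field \<psi> e_m, which singles out the component u_m.\<close>
  define g where "g j = (if j = m then ?\<psi> else (\<lambda>_. 0))" for j
  have sg: "smooth_on (g j) UNIV" for j by (simp add: g_def s\<psi> smooth_on_const)
  have g0: "g j x = 0" if "x \<notin> K" for j x using \<psi>0[OF that] by (simp add: g_def)
  have scg: "smooth_on (vcurl g j) UNIV" for j by (rule smooth_vcurl[OF sg])
  have cg0: "vcurl g j x = 0" if "x \<notin> K" for j x by (rule vcurl_outside[OF Kc g0 that])
  \<comment> \<open>The gradient of the m-th partial derivative of \<psi>, which is the gradient of
    the divergence of \<psi> e_m.\<close>
  define gr where "gr j = pd j (P m)" for j
  have sgr: "smooth_on (gr j) UNIV" for j unfolding gr_def by (rule smooth_pd[OF sP])
  have gr0: "gr j x = 0" if "x \<notin> K" for j x unfolding gr_def by (rule pd_outside[OF Kc P0 that])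
  have cgr: "vcurl gr j x = 0" for j x unfolding vcurl_def gr_def using symPP by simp
  define Lap where "Lap x = pd 1 (P 1) x + pd 2 (P 2) x + pd 3 (P 3) x" for x
  have cc: "cdot (u x) (vfield (vcurl (vcurl g)) x) = cdot (u x) (vfield gr x) - u x $ m * Lap x" for x
  proof -
    have pm: "pd i (\<lambda>x. - P j x) = (\<lambda>x. - pd i (P j) x)" for i j by (rule pd_minus[OF sP])
    have v1: "vcurl g 1 = (if m = 3 then P 2 else if m = 2 then (\<lambda>x. - P 3 x) else (\<lambda>_. 0))"
      "vcurl g 2 = (if m = 1 then P 3 else if m = 3 then (\<lambda>x. - P 1 x) else (\<lambda>_. 0))"
      "vcurl g 3 = (if m = 2 then P 1 else if m = 1 then (\<lambda>x. - P 2 x) else (\<lambda>_. 0))"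
      by (auto simp: vcurl_def g_def pd_const P_def)
    have "m = 1 \<or> m = 2 \<or> m = 3" by (rule exhaust_3)
    then show ?thesis
      unfolding cdot_vfield vcurl_def[of "vcurl g"] v1 Lap_def gr_def
      by (elim disjE) (simp_all add: pm pd_const symP[of 2 1] symP[of 3 1] symP[of 3 2] algebra_simps)
  qed
  have int_cc: "(LINT x|lebesgue. cdot (u x) (vfield (vcurl (vcurl g)) x)) = of_real (k\<^sup>2) * (LINT x|lebesgue. u x $ m * ?\<psi> x)"
  proof -
    have t1: "test_field U (vfield (vcurl g))" by (rule test_field_vfield[OF scg K KU cg0])
    have t2: "test_field U (vfield g)" by (rule test_field_vfield[OF sg K KU g0])
    have "(LINT x|lebesgue. cdot (u x) (vfield (vcurl (vcurl g)) x)) = (LINT x|lebesgue. cdot (\<alpha> *s w x) (vfield (vcurl g) x))"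
      using cu t1 unfolding wcurl_def curl_vfield[OF scg, symmetric] by blast
    also have "\<dots> = \<alpha> * (LINT x|lebesgue. cdot (w x) (curl (vfield g) x))"
      unfolding curl_vfield[OF sg] cdot_vfield
      by (subst integral_mult_right_zero[symmetric]) (simp add: algebra_simps)
    also have "(LINT x|lebesgue. cdot (w x) (curl (vfield g) x)) = (LINT x|lebesgue. cdot (\<beta> *s u x) (vfield g x))"
      using cw t2 unfolding wcurl_def by blast
    also have "\<dots> = \<beta> * (LINT x|lebesgue. u x $ m * ?\<psi> x)"
    proof -
      have "cdot (\<beta> *s u x) (vfield g x) = \<beta> * (u x $ m * ?\<psi> x)" for x
        using exhaust_3[of m] unfolding cdot_vfield g_def by (elim disjE) simp_all
      then show ?thesis by simp
    qed
    finally show ?thesis using k(1) by (simp add: mult.assoc[symmetric])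
  qed
  \<comment> \<open>Weak divergence freeness: a gradient has zero curl, so testing curl w = \<beta>
    u with it gives 0.\<close>
  have int_gr: "(LINT x|lebesgue. cdot (u x) (vfield gr x)) = 0"
  proof -
    have t: "test_field U (vfield gr)" by (rule test_field_vfield[OF sgr K KU gr0])
    have "(LINT x|lebesgue. cdot (\<beta> *s u x) (vfield gr x)) = (LINT x|lebesgue. cdot (w x) (curl (vfield gr) x))"
      using cw t unfolding wcurl_def by metis
    also have "\<dots> = 0" unfolding curl_vfield[OF sgr] cdot_vfield cgr by simp
    finally have "\<beta> * (LINT x|lebesgue. cdot (u x) (vfield gr x)) = 0"
      unfolding cdot_vfield by (subst integral_mult_right_zero[symmetric]) (simp add: algebra_simps)
    then show ?thesis using k(2) by simp
  qed
  have sL: "smooth_on Lap UNIV" unfolding Lap_def[abs_def] by (intro smooth_on_add smooth_pd sP) auto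
  have L0: "Lap x = 0" if "x \<notin> K" for x
    unfolding Lap_def using pd_outside[OF Kc P0 that] by simp
  have iL: "integrable lebesgue (\<lambda>x. u x $ m * Lap x)"
    using cdot_vfield_integral(2)[OF u, of "\<lambda>_. Lap" K] sL K L0 by simp
  have i\<psi>: "integrable lebesgue (\<lambda>x. u x $ m * ?\<psi> x)"
    using cdot_vfield_integral(2)[OF u, of "\<lambda>_. ?\<psi>" K] s\<psi> K \<psi>0 by simp
  have igr: "integrable lebesgue (\<lambda>x. cdot (u x) (vfield gr x))"
    by (rule cdot_vfield_integral(1)[OF u sgr K gr0])
  have "of_real (k\<^sup>2) * (LINT x|lebesgue. u x $ m * ?\<psi> x) = - (LINT x|lebesgue. u x $ m * Lap x)"
    unfolding int_cc[symmetric] cc Bochner_Integration.integral_diff[OF igr iL] int_gr by simp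
  then have "0 = (LINT x|lebesgue. u x $ m * Lap x) + (LINT x|lebesgue. of_real (k\<^sup>2) * (u x $ m * ?\<psi> x))"
    by simp
  also have "\<dots> = (LINT x|lebesgue. u x $ m * Lap x + of_real (k\<^sup>2) * (u x $ m * ?\<psi> x))"
    by (rule Bochner_Integration.integral_add[symmetric, OF iL integrable_mult_right[OF i\<psi>]])
  also have "\<dots> = (LINT x|lebesgue. of_nat (l * (l - 1)) * of_real (a \<bullet> a) * (u x $ m * mom_test c a (l - 2) h x)
      + u x $ m * mom_test c a l (Lop k (4 * real l + 6) h) x)"
  proof (rule Bochner_Integration.integral_cong[OF refl])
    fix x
    have "u x $ m * Lap x + of_real (k\<^sup>2) * (u x $ m * ?\<psi> x) = u x $ m * (Lap x + of_real (k\<^sup>2) * ?\<psi> x)"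
      by (simp add: algebra_simps)
    also have "Lap x + of_real (k\<^sup>2) * ?\<psi> x = of_nat (l * (l - 1)) * of_real (a \<bullet> a) * mom_test c a (l - 2) h x
      + mom_test c a l (Lop k (4 * real l + 6) h) x"
      unfolding Lap_def P_def by (rule laplacian_mom_test[OF sh])
    finally show "u x $ m * Lap x + of_real (k\<^sup>2) * (u x $ m * ?\<psi> x)
      = of_nat (l * (l - 1)) * of_real (a \<bullet> a) * (u x $ m * mom_test c a (l - 2) h x)
      + u x $ m * mom_test c a l (Lop k (4 * real l + 6) h) x"
      by (simp only: distrib_left mult_ac)
  qed
  also have "\<dots> = of_nat (l * (l - 1)) * of_real (a \<bullet> a) * mom (\<lambda>x. u x $ m) c a (l - 2) h
      + mom (\<lambda>x. u x $ m) c a l (Lop k (4 * real l + 6) h)"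
    unfolding mom_def
    by (subst Bochner_Integration.integral_add[OF integrable_mult_right[OF mom_integrable[OF loc_L2_component[OF u] h]]
          mom_integrable[OF loc_L2_component[OF u] tests_Lop[OF h]]])
      (simp only: integral_mult_right_zero)
  finally show "of_nat (l * (l - 1)) * of_real (a \<bullet> a) * mom (\<lambda>x. u x $ m) c a (l - 2) h
      + mom (\<lambda>x. u x $ m) c a l (Lop k (4 * real l + 6) h) = 0" ..
qed

subsection \<open>Calculus of weak curls\<close>

lemma loc_L2_diff:
  assumes u: "loc_L2 u" and w: "loc_L2 w" shows "loc_L2 (\<lambda>x. u x - w x)"
  unfolding loc_L2_def
proof (intro allI conjI)
  fix r
  let ?b = "indicator (ball (0::real^3) r) :: real^3 \<Rightarrow> real"
  have m: "(\<lambda>x. ?b x *\<^sub>R u x) \<in> borel_measurable lebesgue" "(\<lambda>x. ?b x *\<^sub>R w x) \<in> borel_measurable lebesgue"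
    and i: "integrable lebesgue (\<lambda>x. ?b x * (norm (u x))\<^sup>2)" "integrable lebesgue (\<lambda>x. ?b x * (norm (w x))\<^sup>2)"
    using u w unfolding loc_L2_def by auto
  have md: "(\<lambda>x. ?b x *\<^sub>R (u x - w x)) \<in> borel_measurable lebesgue"
    unfolding scaleR_diff_right by (intro borel_measurable_diff m)
  then show "(\<lambda>x. ?b x *\<^sub>R (u x - w x)) \<in> borel_measurable lebesgue" .
  have "(\<lambda>x. (norm (?b x *\<^sub>R (u x - w x)))\<^sup>2) \<in> borel_measurable lebesgue"
    by (intro borel_measurable_power borel_measurable_continuous_on[OF continuous_on_norm[OF continuous_on_id] md])
  moreover have "(norm (?b x *\<^sub>R (u x - w x)))\<^sup>2 = ?b x * (norm (u x - w x))\<^sup>2" for x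
    by (simp add: indicator_def)
  ultimately have m2: "(\<lambda>x. ?b x * (norm (u x - w x))\<^sup>2) \<in> borel_measurable lebesgue" by simp
  show "integrable lebesgue (\<lambda>x. ?b x * (norm (u x - w x))\<^sup>2)"
  proof (rule Bochner_Integration.integrable_bound[OF Bochner_Integration.integrable_add[OF
          integrable_mult_right[OF i(1), of 2] integrable_mult_right[OF i(2), of 2]] m2])
    show "AE x in lebesgue. norm (?b x * (norm (u x - w x))\<^sup>2) \<le> norm (2 * (?b x * (norm (u x))\<^sup>2) + 2 * (?b x * (norm (w x))\<^sup>2))"
    proof (rule AE_I2)
      fix x
      have "(norm (u x - w x))\<^sup>2 \<le> (norm (u x) + norm (w x))\<^sup>2"
        by (intro power_mono norm_triangle_ineq4) auto
      also have "\<dots> \<le> 2 * (norm (u x))\<^sup>2 + 2 * (norm (w x))\<^sup>2"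
        using sum_squares_bound[of "norm (u x)" "norm (w x)"] by (simp add: power2_sum)
      finally show "norm (?b x * (norm (u x - w x))\<^sup>2) \<le> norm (2 * (?b x * (norm (u x))\<^sup>2) + 2 * (?b x * (norm (w x))\<^sup>2))"
        by (auto simp: indicator_def)
    qed
  qed
qed

lemma loc_L2_scale:
  assumes u: "loc_L2 u" shows "loc_L2 (\<lambda>x. \<alpha> *s u x)"
  unfolding loc_L2_def
proof (intro allI conjI)
  fix r
  let ?b = "indicator (ball (0::real^3) r) :: real^3 \<Rightarrow> real"
  have m: "(\<lambda>x. ?b x *\<^sub>R u x) \<in> borel_measurable lebesgue"
    and i: "integrable lebesgue (\<lambda>x. ?b x * (norm (u x))\<^sup>2)"
    using u unfolding loc_L2_def by auto
  have "continuous_on UNIV (\<lambda>z::complex^3. \<alpha> *s z)"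
    unfolding vector_scalar_mult_def by (intro continuous_intros)
  from borel_measurable_continuous_on[OF this m]
  have "(\<lambda>x. \<alpha> *s (?b x *\<^sub>R u x)) \<in> borel_measurable lebesgue" .
  moreover have "\<alpha> *s (?b x *\<^sub>R u x) = ?b x *\<^sub>R (\<alpha> *s u x)" for x by (simp add: vec_eq_iff)
  ultimately show "(\<lambda>x. ?b x *\<^sub>R (\<alpha> *s u x)) \<in> borel_measurable lebesgue" by simp
  have n: "(norm (\<alpha> *s z))\<^sup>2 = (norm \<alpha>)\<^sup>2 * (norm z)\<^sup>2" for z :: "complex^3"
    by (simp add: norm_vec_def L2_set_def norm_mult power_mult_distrib sum_distrib_left[symmetric] real_sqrt_mult
        sum_nonneg)
  have "integrable lebesgue (\<lambda>x. (norm \<alpha>)\<^sup>2 * (?b x * (norm (u x))\<^sup>2))" by (rule integrable_mult_right[OF i])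
  then show "integrable lebesgue (\<lambda>x. ?b x * (norm (\<alpha> *s u x))\<^sup>2)" unfolding n by (simp only: mult.left_commute)
qed

lemma test_field_components:
  assumes "test_field U \<phi>"
  obtains g K where "\<phi> = vfield g" "\<And>j. smooth_on (g j) UNIV" "compact K" "K \<subseteq> U" "\<And>j x. x \<notin> K \<Longrightarrow> g j x = 0"
proof -
  have s: "smooth_on \<phi> UNIV" using assms by (simp add: test_field_def Cj_on_infinity_iff)
  show ?thesis
  proof (rule that[of "\<lambda>j x. \<phi> x $ j" "closure {x. \<phi> x \<noteq> 0}"])
    show "\<phi> = vfield (\<lambda>j x. \<phi> x $ j)" by (auto simp: vfield_def vec_eq_iff)
    show "smooth_on (\<lambda>x. \<phi> x $ j) UNIV" for j
      by (rule smooth_on_bounded_linear[OF open_UNIV bounded_linear_vec_nth s])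
    show "compact (closure {x. \<phi> x \<noteq> 0})" "closure {x. \<phi> x \<noteq> 0} \<subseteq> U"
      using assms by (auto simp: test_field_def)
    show "\<phi> x $ j = 0" if "x \<notin> closure {x. \<phi> x \<noteq> 0}" for j x
    proof -
      have "\<phi> x = 0" using that closure_subset[of "{x. \<phi> x \<noteq> 0}"] by blast
      then show ?thesis by simp
    qed
  qed
qed

lemma cdot_test_integrable:
  assumes "loc_L2 u" "test_field U \<phi>"
  shows "integrable lebesgue (\<lambda>x. cdot (u x) (\<phi> x))" "integrable lebesgue (\<lambda>x. cdot (u x) (curl \<phi> x))"
proof -
  obtain g K where g: "\<phi> = vfield g" "\<And>j. smooth_on (g j) UNIV" "compact K" "K \<subseteq> U" "\<And>j x. x \<notin> K \<Longrightarrow> g j x = 0"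
    using test_field_components[OF assms(2)] by metis
  show "integrable lebesgue (\<lambda>x. cdot (u x) (\<phi> x))"
    unfolding g(1) by (rule cdot_vfield_integral(1)[OF assms(1) g(2,3,5)])
  show "integrable lebesgue (\<lambda>x. cdot (u x) (curl \<phi> x))"
    unfolding g(1) curl_vfield[OF g(2)]
    by (rule cdot_vfield_integral(1)[OF assms(1) smooth_vcurl[OF g(2)] g(3) vcurl_outside[OF compact_imp_closed[OF g(3)] g(5)]])
qed

lemma wcurl_mono: "wcurl U u w \<Longrightarrow> V \<subseteq> U \<Longrightarrow> wcurl V u w"
  unfolding wcurl_def test_field_def by blast

lemma cdot_diff: "cdot (a - b) c = cdot a c - cdot b c"
  by (simp add: cdot_def sum_subtractf left_diff_distrib)

lemma wcurl_diff:
  assumes "wcurl U u w" "wcurl U u' w'" "loc_L2 u" "loc_L2 w" "loc_L2 u'" "loc_L2 w'"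
  shows "wcurl U (\<lambda>x. u x - u' x) (\<lambda>x. w x - w' x)"
  unfolding wcurl_def
proof (intro allI impI)
  fix \<phi> assume t: "test_field U \<phi>"
  show "(LINT x|lebesgue. cdot (u x - u' x) (curl \<phi> x)) = (LINT x|lebesgue. cdot (w x - w' x) (\<phi> x))"
    unfolding cdot_diff
      Bochner_Integration.integral_diff[OF cdot_test_integrable(2)[OF assms(3) t] cdot_test_integrable(2)[OF assms(5) t]]
      Bochner_Integration.integral_diff[OF cdot_test_integrable(1)[OF assms(4) t] cdot_test_integrable(1)[OF assms(6) t]]
    using assms(1,2) t unfolding wcurl_def by simp
qed

lemma wcurl_cong_AE:
  assumes "wcurl U u w" "loc_L2 u" "loc_L2 w" "loc_L2 u'" "loc_L2 w'"
    and ae: "AE x in lebesgue. u x = u' x" "AE x in lebesgue. w x = w' x"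
  shows "wcurl U u' w'"
  unfolding wcurl_def
proof (intro allI impI)
  fix \<phi> assume t: "test_field U \<phi>"
  have "(LINT x|lebesgue. cdot (u' x) (curl \<phi> x)) = (LINT x|lebesgue. cdot (u x) (curl \<phi> x))"
    using cdot_test_integrable(2)[OF assms(2) t] cdot_test_integrable(2)[OF assms(4) t] ae(1)
    by (intro integral_cong_AE borel_measurable_integrable) auto
  also have "\<dots> = (LINT x|lebesgue. cdot (w x) (\<phi> x))" using assms(1) t by (simp add: wcurl_def)
  also have "\<dots> = (LINT x|lebesgue. cdot (w' x) (\<phi> x))"
    using cdot_test_integrable(1)[OF assms(3) t] cdot_test_integrable(1)[OF assms(5) t] ae(2)
    by (intro integral_cong_AE borel_measurable_integrable) auto
  finally show "(LINT x|lebesgue. cdot (u' x) (curl \<phi> x)) = (LINT x|lebesgue. cdot (w' x) (\<phi> x))" .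
qed

text \<open>Extension by 0 over the screen makes fields on the complement into fields on the whole
  space, and integrals over \<open>lebesgue_on (- S)\<close> into integrals over
  \<open>lebesgue\<close>.\<close>

definition zero_on :: "(real^3) set \<Rightarrow> field3 \<Rightarrow> field3" where
  "zero_on S u x = (if x \<in> S then 0 else u x)"

lemma has_weak_curl_imp_wcurl:
  assumes "has_weak_curl (- S) u w" "closed S"
  shows "wcurl (- S) (zero_on S u) (zero_on S w)"
  unfolding wcurl_def
proof (intro allI impI)
  fix \<phi> assume t: "test_field (- S) \<phi>"
  have r: "(LINT x|lebesgue_on (- S). cdot (v x) (\<psi> x)) = (LINT x|lebesgue. cdot (zero_on S v x) (\<psi> x))" for v \<psi>
  proof -
    have "- S \<inter> space lebesgue \<in> sets lebesgue" using assms(2) by (auto intro: sets_completionI_sets)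
    then have "(LINT x|lebesgue_on (- S). cdot (v x) (\<psi> x)) = (LINT x|lebesgue. indicator (- S) x *\<^sub>R cdot (v x) (\<psi> x))"
      by (rule integral_restrict_space)
    also have "\<dots> = (LINT x|lebesgue. cdot (zero_on S v x) (\<psi> x))"
      by (rule Bochner_Integration.integral_cong) (auto simp: zero_on_def indicator_def cdot_def)
    finally show ?thesis .
  qed
  show "(LINT x|lebesgue. cdot (zero_on S u x) (curl \<phi> x)) = (LINT x|lebesgue. cdot (zero_on S w x) (\<phi> x))"
    using assms(1) t unfolding has_weak_curl_def r by blast
qed

lemma L2_loc_imp_loc_L2:
  assumes "L2_loc (- S) u" "closed S"
  shows "loc_L2 (zero_on S u)"
  unfolding loc_L2_def
proof
  fix r
  obtain R0 where R0: "\<And>R. R0 \<le> R \<Longrightarrow> square_integrable (- S \<inter> ball 0 R) u"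
    using assms(1) unfolding L2_loc_def eventually_at_top_linorder by blast
  \<comment> \<open>Square integrability is given for large radii only; smaller balls are reached by
    restriction.\<close>
  define R where "R = max R0 r"
  let ?A = "- S \<inter> ball (0::real^3) R"
  have A: "?A \<inter> space lebesgue \<in> sets lebesgue" using assms(2) by (auto intro: sets_completionI_sets)
  have si: "square_integrable ?A u" using R0[of R] by (simp add: R_def)
  have m: "(\<lambda>x. indicator ?A x *\<^sub>R u x) \<in> borel_measurable lebesgue"
    using si borel_measurable_restrict_space_iff[OF A, of u] unfolding square_integrable_def by simp
  have i: "integrable lebesgue (\<lambda>x. indicator ?A x *\<^sub>R (norm (u x))\<^sup>2)"
    using si integrable_restrict_space[OF A, of "\<lambda>x. (norm (u x))\<^sup>2"] unfolding square_integrable_def by simp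
  have b: "ball (0::real^3) r \<in> sets lebesgue" by (auto intro: sets_completionI_sets)
  have e1: "indicator (ball 0 r) x *\<^sub>R zero_on S u x = indicator (ball 0 r) x *\<^sub>R (indicator ?A x *\<^sub>R u x)" for x
    by (auto simp: zero_on_def indicator_def R_def)
  have e2: "indicator (ball 0 r) x * (norm (zero_on S u x))\<^sup>2 = indicator (ball 0 r) x *\<^sub>R (indicator ?A x *\<^sub>R (norm (u x))\<^sup>2)" for x
    by (auto simp: zero_on_def indicator_def R_def)
  show "(\<lambda>x. indicator (ball 0 r) x *\<^sub>R zero_on S u x) \<in> borel_measurable lebesgue
    \<and> integrable lebesgue (\<lambda>x. indicator (ball 0 r) x * (norm (zero_on S u x))\<^sup>2)"
    unfolding e1 e2
    by (intro conjI borel_measurable_scaleR m borel_measurable_indicator b integrable_mult_indicator[OF b i])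
qed

section \<open>The intersection of two planes is invisible to the weak curl\<close>

subsection \<open>Removing the intersection of two planes\<close>

text \<open>Squaring the scaled signed distance lets a profile on the line act as a function smooth
  across the plane. With the plateau profile it is 1 up to distance \<delta> and 0 beyond 2
  \<delta>.\<close>

definition plane_cut :: "(real \<Rightarrow> complex) \<Rightarrow> real^3 \<Rightarrow> real \<Rightarrow> real \<Rightarrow> real^3 \<Rightarrow> complex" where
  "plane_cut \<theta> n c \<delta> x = \<theta> ((inverse \<delta> * (n \<bullet> x - c))\<^sup>2)"

lemma smooth_plane_cut:
  assumes "smooth_on \<theta> UNIV" shows "smooth_on (plane_cut \<theta> n c \<delta>) UNIV"
  unfolding plane_cut_def[abs_def]
  by (rule smooth_on_compose[OF assms])
    (auto intro!: smooth_on_power smooth_on_mult smooth_on_diff smooth_on_inner smooth_on_const smooth_on_ident)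

lemma pd_plane_cut:
  assumes "smooth_on \<theta> UNIV"
  shows "pd i (plane_cut \<theta> n c \<delta>) x
    = of_real (2 * inverse \<delta> * (inverse \<delta> * (n \<bullet> x - c)) * (n $ i)) * Dr \<theta> ((inverse \<delta> * (n \<bullet> x - c))\<^sup>2)"
proof -
  let ?q = "\<lambda>x. (inverse \<delta> * (n \<bullet> x - c))\<^sup>2"
  have 1: "(?q has_derivative (\<lambda>v. 2 * (inverse \<delta> * (n \<bullet> x - c)) * (inverse \<delta> * (n \<bullet> v)))) (at x)"
    by (auto intro!: derivative_eq_intros simp: power2_eq_square algebra_simps)
  have 2: "(\<theta> has_derivative (\<lambda>r. r *\<^sub>R Dr \<theta> (?q x))) (at (?q x))"
    using Dr_works[OF assms, of "?q x"] by (simp add: has_vector_derivative_def)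
  have "(plane_cut \<theta> n c \<delta> has_derivative
      (\<lambda>v. (2 * (inverse \<delta> * (n \<bullet> x - c)) * (inverse \<delta> * (n \<bullet> v))) *\<^sub>R Dr \<theta> (?q x))) (at x)"
    unfolding plane_cut_def[abs_def] by (rule has_derivative_compose[OF 1 2])
  from pdI[OF this] show ?thesis by (simp add: inner_axis scaleR_conv_of_real mult_ac)
qed

text \<open>By Lagrange's identity the squared length of the cross product and the squared inner
  product add up to 1. A zero cross product makes the inner product 1 or -1, and then n1 - n2 or n1
  + n2 has length 0.\<close>

lemma unit_normals_cases:
  fixes n1 n2 :: "real^3"
  assumes "norm n1 = 1" "norm n2 = 1"
  shows "n2 = n1 \<or> n2 = - n1 \<or> cross3 n1 n2 \<noteq> 0"
proof -
  have a: "n1 \<bullet> n1 = 1" "n2 \<bullet> n2 = 1" using assms by (simp_all add: dot_square_norm)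
  {
    assume "cross3 n1 n2 = 0"
    then have "(n1 \<bullet> n2)\<^sup>2 = 1" using norm_cross_dot[of n1 n2] assms by simp
    then have "n1 \<bullet> n2 = 1 \<or> n1 \<bullet> n2 = - 1" by (simp add: power2_eq_1_iff)
    moreover have "(n1 - n2) \<bullet> (n1 - n2) = 2 - 2 * (n1 \<bullet> n2)" "(n1 + n2) \<bullet> (n1 + n2) = 2 + 2 * (n1 \<bullet> n2)"
      using a by (simp_all add: inner_diff_left inner_diff_right inner_add_left inner_add_right inner_commute)
    ultimately have "n1 - n2 = 0 \<or> n1 + n2 = 0"
      by (metis inner_eq_zero_iff cancel_comm_monoid_add_class.diff_cancel mult_2 mult_minus1_right one_add_one right_minus mult.right_neutral)
    then have "n2 = n1 \<or> n2 = - n1" by (auto simp: eq_neg_iff_add_eq_0 add.commute)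
  }
  then show ?thesis by blast
qed

definition tube :: "real^3 \<Rightarrow> real \<Rightarrow> real^3 \<Rightarrow> real \<Rightarrow> real \<Rightarrow> real \<Rightarrow> (real^3) set" where
  "tube n1 c1 n2 c2 r \<delta> = {x. norm x \<le> r \<and> \<bar>n1 \<bullet> x - c1\<bar> \<le> 2 * \<delta> \<and> \<bar>n2 \<bullet> x - c2\<bar> \<le> 2 * \<delta>}"

lemma closed_tube: "closed (tube n1 c1 n2 c2 r \<delta>)"
  unfolding tube_def by (intro closed_Collect_conj closed_Collect_le continuous_intros)

lemma tube_lmeasurable: "tube n1 c1 n2 c2 r \<delta> \<in> lmeasurable"
proof (rule lmeasurable_compact)
  have "bounded (tube n1 c1 n2 c2 r \<delta>)" unfolding bounded_iff tube_def by auto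
  then show "compact (tube n1 c1 n2 c2 r \<delta>)" using closed_tube by (simp add: compact_eq_bounded_closed)
qed

text \<open>Distinct parallel planes have disjoint thin slabs. Otherwise the inner products with n1,
  n2 and their cross product are coordinates in which the tube lies in a box with two sides 4
  \<delta>.\<close>

lemma tube_measure:
  fixes n1 n2 :: "real^3"
  assumes n: "norm n1 = 1" "norm n2 = 1" and ne: "{x. n1 \<bullet> x = c1} \<noteq> {x. n2 \<bullet> x = c2}"
  shows "\<exists>C \<delta>0. 0 \<le> C \<and> 0 < \<delta>0 \<and> (\<forall>\<delta>. 0 < \<delta> \<longrightarrow> \<delta> < \<delta>0 \<longrightarrow> measure lebesgue (tube n1 c1 n2 c2 r \<delta>) \<le> C * \<delta>\<^sup>2)"
proof -
  consider "n2 = n1" | "n2 = - n1" | "cross3 n1 n2 \<noteq> 0" using unit_normals_cases[OF n] by blast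
  then show ?thesis
  proof cases
    case 1
    then have "c1 \<noteq> c2" using ne by auto
    \<comment> \<open>A point of both slabs would give |c1 - c2| \<le> 4 \<delta>.\<close>
    have "tube n1 c1 n2 c2 r \<delta> = {}" if "\<delta> < \<bar>c1 - c2\<bar> / 4" for \<delta>
      using that unfolding tube_def 1 by auto
    then show ?thesis using \<open>c1 \<noteq> c2\<close> by (intro exI[of _ 0] exI[of _ "\<bar>c1 - c2\<bar> / 4"]) auto
  next
    case 2
    then have "c1 \<noteq> - c2" using ne by (auto simp: inner_minus_left)
    have "tube n1 c1 n2 c2 r \<delta> = {}" if "\<delta> < \<bar>c1 + c2\<bar> / 4" for \<delta>
      using that unfolding tube_def 2 by (auto simp: inner_minus_left)
    then show ?thesis using \<open>c1 \<noteq> - c2\<close> by (intro exI[of _ 0] exI[of _ "\<bar>c1 + c2\<bar> / 4"]) auto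
  next
    case 3
    define n3 where "n3 = cross3 n1 n2"
    define f :: "real^3 \<Rightarrow> real^3" where "f x = vector [n1 \<bullet> x, n2 \<bullet> x, n3 \<bullet> x]" for x
    have lf: "linear f"
      by (rule linearI) (auto simp: f_def vec_eq_iff forall_3 inner_add_right)
    have "inj f"
    proof (rule linear_injective_0[THEN iffD2, OF lf, rule_format])
      fix x assume "f x = 0"
      then have z: "n1 \<bullet> x = 0" "n2 \<bullet> x = 0" "n3 \<bullet> x = 0" by (simp_all add: f_def vec_eq_iff forall_3)
      \<comment> \<open>A vector orthogonal to n1 and n2 is parallel to n3; being orthogonal to n3
        too, it is 0.\<close>
      have "cross3 n3 x = 0"
        using z(1,2) unfolding n3_def cross3_def inner_vec_def by (simp add: vec_eq_iff forall_3 sum_3) algebra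
      then show "x = 0" using z(3) norm_and_cross_eq_0[of n3 x] 3 by (simp add: n3_def)
    qed
    then obtain g where g: "linear g" "g \<circ> f = id"
      using linear_injective_left_inverse[OF lf] by blast
    define a b :: "real \<Rightarrow> real^3" where
      "a \<delta> = vector [c1 - 2 * \<delta>, c2 - 2 * \<delta>, - (norm n3 * \<bar>r\<bar>)]" and
      "b \<delta> = vector [c1 + 2 * \<delta>, c2 + 2 * \<delta>, norm n3 * \<bar>r\<bar>]" for \<delta>
    \<comment> \<open>16 from the two sides 4 \<delta>, the next factor from the third side, the
      determinant from undoing the change of coordinates.\<close>
    define D where "D = \<bar>det (matrix g)\<bar> * (16 * (2 * (norm n3 * \<bar>r\<bar>)))"
    have "measure lebesgue (tube n1 c1 n2 c2 r \<delta>) \<le> D * \<delta>\<^sup>2" if \<delta>: "0 < \<delta>" for \<delta>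
    proof -
      have sub: "tube n1 c1 n2 c2 r \<delta> \<subseteq> g ` cbox (a \<delta>) (b \<delta>)"
      proof
        fix x assume x: "x \<in> tube n1 c1 n2 c2 r \<delta>"
        have "\<bar>n3 \<bullet> x\<bar> \<le> norm n3 * norm x" by (rule Cauchy_Schwarz_ineq2)
        also have "\<dots> \<le> norm n3 * \<bar>r\<bar>" using x by (intro mult_left_mono) (auto simp: tube_def)
        finally have "f x \<in> cbox (a \<delta>) (b \<delta>)"
          using x by (auto simp: f_def a_def b_def mem_box_cart forall_3 tube_def)
        moreover have "x = g (f x)" using g(2) by (metis comp_apply id_apply)
        ultimately show "x \<in> g ` cbox (a \<delta>) (b \<delta>)" by blast
      qed
      have "measure lebesgue (tube n1 c1 n2 c2 r \<delta>) \<le> measure lebesgue (g ` cbox (a \<delta>) (b \<delta>))"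
        by (rule measure_mono_fmeasurable[OF sub fmeasurableD[OF tube_lmeasurable] measurable_linear_image[OF g(1)]]) simp
      also have "\<dots> = \<bar>det (matrix g)\<bar> * measure lebesgue (cbox (a \<delta>) (b \<delta>))"
        by (rule measure_linear_image[OF g(1)]) simp
      also have "measure lebesgue (cbox (a \<delta>) (b \<delta>)) = (\<Prod>i\<in>UNIV. b \<delta> $ i - a \<delta> $ i)"
      proof -
        have "a \<delta> $ i \<le> b \<delta> $ i" for i using \<delta> exhaust_3[of i] by (auto simp: a_def b_def)
        then have "cbox (a \<delta>) (b \<delta>) \<noteq> {}" by (simp add: interval_ne_empty_cart)
        from content_cbox_cart[OF this] show ?thesis by simp
      qed
      also have "\<dots> = 16 * (2 * (norm n3 * \<bar>r\<bar>)) * \<delta>\<^sup>2"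
      proof -
        have "prod h UNIV = h 1 * h 2 * h 3" for h :: "3 \<Rightarrow> real"
          unfolding UNIV_3 by simp
        then have "(\<Prod>i\<in>UNIV. b \<delta> $ i - a \<delta> $ i) = (4 * \<delta>) * (4 * \<delta>) * (2 * (norm n3 * \<bar>r\<bar>))"
          by (simp add: a_def b_def)
        then show ?thesis by (simp add: power2_eq_square)
      qed
      finally show ?thesis by (simp add: D_def mult.assoc)
    qed
    moreover have "0 \<le> D" by (simp add: D_def)
    ultimately show ?thesis by (intro exI[of _ D] exI[of _ 1]) auto
  qed
qed

lemma vcurl_add:
  assumes "\<And>j. smooth_on (f j) UNIV" "\<And>j. smooth_on (g j) UNIV"
  shows "vcurl (\<lambda>j x. f j x + g j x) j x = vcurl f j x + vcurl g j x"
  by (simp add: vcurl_def pd_add assms)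

lemma wcurl_vfield:
  assumes "wcurl V u w" "\<And>j. smooth_on (f j) UNIV" "compact K" "K \<subseteq> V" "\<And>j x. x \<notin> K \<Longrightarrow> f j x = 0"
  shows "(LINT x|lebesgue. cdot (u x) (vfield (vcurl f) x)) = (LINT x|lebesgue. cdot (w x) (vfield f x))"
proof -
  have "test_field V (vfield f)" by (rule test_field_vfield[OF assms(2-5)])
  from assms(1)[unfolded wcurl_def, rule_format, OF this] show ?thesis
    by (simp only: curl_vfield[OF assms(2)])
qed

lemma norm_cdot_vfield_le:
  assumes "\<And>j. norm (f j x) \<le> B"
  shows "norm (cdot v (vfield f x)) \<le> 3 * norm v * B"
proof -
  have 1: "norm (v $ j * f j x) \<le> norm v * B" for j
    unfolding norm_mult by (intro mult_mono Finite_Cartesian_Product.norm_nth_le assms) auto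
  have "norm (cdot v (vfield f x)) \<le> norm (v $ 1 * f 1 x) + norm (v $ 2 * f 2 x) + norm (v $ 3 * f 3 x)"
    unfolding cdot_vfield by (meson add_right_mono norm_triangle_ineq order_trans)
  then show ?thesis using 1[of 1] 1[of 2] 1[of 3] by linarith
qed

text \<open>A line has zero capacity for the curl: cutting off at distance \<open>\<delta>\<close> costs a gradient of size
  \<open>1/\<delta>\<close> on a set of measure \<open>\<delta>\<^sup>2\<close>, which is compensated by the vanishing of the \<open>L\<^sup>2\<close> norm there.\<close>

lemma wcurl_remove_intersection:
  assumes u: "loc_L2 u" and w: "loc_L2 w" and c1: "wcurl (- S1) u w" and c2: "wcurl (- S2) u w"
    and S: "S1 \<subseteq> {x. n1 \<bullet> x = c1}" "S2 \<subseteq> {x. n2 \<bullet> x = c2}"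
    and n: "norm n1 = 1" "norm n2 = 1" and ne: "{x. n1 \<bullet> x = c1} \<noteq> {x. n2 \<bullet> x = c2}"
  shows "wcurl UNIV u w"
  unfolding wcurl_def
proof (intro allI impI)
  fix \<phi> assume "test_field UNIV \<phi>"
  then obtain g K where \<phi>: "\<phi> = vfield g" and sg: "\<And>j. smooth_on (g j) UNIV" and K: "compact K"
    and g0: "\<And>j x. x \<notin> K \<Longrightarrow> g j x = 0"
    using test_field_components by metis
  obtain r where r: "\<And>x. x \<in> K \<Longrightarrow> norm x \<le> r"
    using compact_imp_bounded[OF K] unfolding bounded_iff by blast
  obtain \<theta> :: "real \<Rightarrow> complex" where \<theta>: "smooth_on \<theta> UNIV" "\<And>s. -1 \<le> s \<Longrightarrow> s \<le> 1 \<Longrightarrow> \<theta> s = 1"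
    "\<And>s. s < -2 \<or> 4 < s \<Longrightarrow> \<theta> s = 0" using plateau_function by blast
  obtain B where "0 \<le> B \<and> (\<forall>s. norm (\<theta> s) \<le> B)" using bounded_test[OF \<theta>(1) \<theta>(3)] by meson
  then have B: "0 \<le> B" "\<And>s. norm (\<theta> s) \<le> B" by simp_all
  have d0: "Dr \<theta> s = 0" if "s < -2 \<or> 4 < s" for s
  proof -
    have "(Dr ^^ 1) \<theta> s = 0" by (rule Dr_eq_0_outside[of "{-2..4}"]) (use \<theta>(3) that in auto)
    then show ?thesis by simp
  qed
  obtain B' where "0 \<le> B' \<and> (\<forall>s. norm (Dr \<theta> s) \<le> B')" using bounded_test[OF smooth_on_Dr[OF \<theta>(1)] d0] by meson
  then have B': "0 \<le> B'" "\<And>s. norm (Dr \<theta> s) \<le> B'" by simp_all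
  have cg0: "vcurl g j x = 0" if "x \<notin> K" for j x by (rule vcurl_outside[OF compact_imp_closed[OF K] g0 that])
  have bnd: "\<exists>G. \<forall>x. norm (f x) \<le> G" if c: "continuous_on UNIV f" and z: "\<And>x. x \<notin> K \<Longrightarrow> f x = 0"
    for f :: "real^3 \<Rightarrow> complex"
  proof -
    have "f x = 0" if "r + 1 \<le> norm x" for x using r[of x] that by (intro z) auto
    from bounded_of_compact_support[OF c this] show ?thesis by metis
  qed
  have "\<forall>j. \<exists>G. \<forall>x. norm (g j x) \<le> G"
    by (intro allI bnd smooth_on_continuous[OF sg] g0)
  then obtain G1 where G1: "\<forall>j x. norm (g j x) \<le> G1 j" by metis
  have "\<forall>j. \<exists>G. \<forall>x. norm (vcurl g j x) \<le> G"
    by (intro allI bnd smooth_on_continuous[OF smooth_vcurl[OF sg]] cg0)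
  then obtain G2 where G2: "\<forall>j x. norm (vcurl g j x) \<le> G2 j" by metis
  define G where "G = (\<Sum>j\<in>UNIV. \<bar>G1 j\<bar> + \<bar>G2 j\<bar>)"
  have Gj: "\<bar>G1 j\<bar> + \<bar>G2 j\<bar> \<le> G" for j
    unfolding G_def by (rule member_le_sum) auto
  have G: "norm (g j x) \<le> G" "norm (vcurl g j x) \<le> G" for j x
    using Gj[of j] G1[rule_format, of j x] G2[rule_format, of j x] by linarith+
  have G0: "0 \<le> G" using G(1)[of 1 0] norm_ge_zero order_trans by blast
  \<comment> \<open>A / \<delta> will bound both the cut-off field and its curl. B B G belongs to
    the undifferentiated cutoffs; 16 = 2 * 8, because a curl component has two terms with a
    derivative of the product cutoff, each derivative being at most 8 B B' / \<delta>.\<close>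
  define A where "A = B * B * G + 16 * (B * B') * G"
  have A0: "0 \<le> A" using B(1) B'(1) G0 by (simp add: A_def)
  define I where "I f = (LINT x|lebesgue. cdot (u x) (vfield (vcurl f) x)) - (LINT x|lebesgue. cdot (w x) (vfield f x))"
    for f :: "3 \<Rightarrow> real^3 \<Rightarrow> complex"
  define good where "good f \<longleftrightarrow> (\<forall>j. smooth_on (f j) UNIV) \<and> (\<forall>j x. x \<notin> K \<longrightarrow> f j x = 0)" for f :: "3 \<Rightarrow> real^3 \<Rightarrow> complex"
  have goodI: "integrable lebesgue (\<lambda>x. cdot (u x) (vfield (vcurl f) x))" "integrable lebesgue (\<lambda>x. cdot (w x) (vfield f x))"
    if "good f" for f
  proof -
    have s: "\<And>j. smooth_on (f j) UNIV" "\<And>j x. x \<notin> K \<Longrightarrow> f j x = 0" using that by (auto simp: good_def)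
    show "integrable lebesgue (\<lambda>x. cdot (w x) (vfield f x))" by (rule cdot_vfield_integral(1)[OF w s(1) K s(2)])
    show "integrable lebesgue (\<lambda>x. cdot (u x) (vfield (vcurl f) x))"
      by (rule cdot_vfield_integral(1)[OF u smooth_vcurl[OF s(1)] K vcurl_outside[OF compact_imp_closed[OF K] s(2)]])
  qed
  have I_add: "I (\<lambda>j x. f j x + f' j x) = I f + I f'" if f: "good f" and f': "good f'" for f f'
  proof -
    have e: "cdot v (vfield (\<lambda>j x. p j x + q j x) x) = cdot v (vfield p x) + cdot v (vfield q x)" for v p q x
      by (simp add: cdot_vfield algebra_simps)
    have "vcurl (\<lambda>j x. f j x + f' j x) = (\<lambda>j x. vcurl f j x + vcurl f' j x)"
      by (intro ext vcurl_add) (use f f' in \<open>auto simp: good_def\<close>)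
    then show ?thesis
      unfolding I_def
      by (simp only: e Bochner_Integration.integral_add[OF goodI(1)[OF f] goodI(1)[OF f']]
          Bochner_Integration.integral_add[OF goodI(2)[OF f] goodI(2)[OF f']]) simp
  qed
  \<comment> \<open>An upper bound for (|u| + |w|)^2, the square that Young's inequality will
    leave.\<close>
  define \<Phi> where "\<Phi> x = 2 * (norm (u x))\<^sup>2 + 2 * (norm (w x))\<^sup>2" for x
  define T where "T \<delta> = tube n1 c1 n2 c2 r \<delta>" for \<delta>
  have \<Phi>0: "0 \<le> \<Phi> x" for x by (simp add: \<Phi>_def)
  have \<Phi>b: "integrable lebesgue (\<lambda>x. indicator (ball 0 (r + 1)) x * \<Phi> x)"
  proof -
    have "integrable lebesgue (\<lambda>x. 2 * (indicator (ball 0 (r + 1)) x * (norm (u x))\<^sup>2) + 2 * (indicator (ball 0 (r + 1)) x * (norm (w x))\<^sup>2))"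
      using u w unfolding loc_L2_def by (intro Bochner_Integration.integrable_add integrable_mult_right) blast+
    then show ?thesis by (simp add: \<Phi>_def algebra_simps)
  qed
  have Tset: "T \<delta> \<in> sets lebesgue" for \<delta> unfolding T_def by (rule fmeasurableD[OF tube_lmeasurable])
  have eqT: "indicator (T \<delta>) x *\<^sub>R (indicator (ball 0 (r + 1)) x * \<Phi> x) = indicator (T \<delta>) x * \<Phi> x" for \<delta> x
    by (auto simp: indicator_def T_def tube_def)
  have \<Phi>T: "integrable lebesgue (\<lambda>x. indicator (T \<delta>) x * \<Phi> x)" for \<delta>
    using integrable_mult_indicator[OF Tset \<Phi>b, of \<delta>] unfolding eqT .
  define J where "J \<delta> = (LINT x|lebesgue. indicator (T \<delta>) x * \<Phi> x)" for \<delta>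
  obtain C \<delta>0 where C: "0 \<le> C" "0 < \<delta>0" "\<And>\<delta>. 0 < \<delta> \<Longrightarrow> \<delta> < \<delta>0 \<Longrightarrow> measure lebesgue (T \<delta>) \<le> C * \<delta>\<^sup>2"
    using tube_measure[OF n ne, of r] unfolding T_def by blast
  \<comment> \<open>Young's inequality with parameter \<eta> splits the pairing into the energy of
    the cutoff, bounded because the measure C \<delta>^2 meets (3 A / \<delta>)^2, and the energy of
    the fields in the tube. The 3 comes from the three components.\<close>
  have est: "norm (I g) \<le> \<eta> * (9 * A\<^sup>2 * C) + J \<delta> / \<eta>" if \<delta>: "0 < \<delta>" "\<delta> < \<delta>0" "\<delta> \<le> 1" and \<eta>: "0 < \<eta>" for \<delta> \<eta>
  proof -
    define b1 where "b1 = plane_cut \<theta> n1 c1 \<delta>"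
    define b2 where "b2 = plane_cut \<theta> n2 c2 \<delta>"
    define b where "b x = b1 x * b2 x" for x
    have sb: "smooth_on b1 UNIV" "smooth_on b2 UNIV" unfolding b1_def b2_def by (rule smooth_plane_cut[OF \<theta>(1)])+
    have sbb: "smooth_on b UNIV" unfolding b_def[abs_def] by (intro smooth_on_mult sb) auto
    have s1b: "smooth_on (\<lambda>x. 1 - b1 x) UNIV" "smooth_on (\<lambda>x. 1 - b2 x) UNIV"
      by (intro smooth_on_diff smooth_on_const sb open_UNIV)+
    have near: "plane_cut \<theta> m c \<delta> x = 1" if "\<bar>m \<bullet> x - c\<bar> < \<delta>" for m c x
    proof -
      have "\<bar>inverse \<delta> * (m \<bullet> x - c)\<bar> \<le> 1" using that \<delta> by (simp add: abs_mult field_simps)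
      then have "(inverse \<delta> * (m \<bullet> x - c))\<^sup>2 \<le> 1" by (simp add: abs_square_le_1)
      moreover have "-1 \<le> (inverse \<delta> * (m \<bullet> x - c))\<^sup>2" using zero_le_power2[of "inverse \<delta> * (m \<bullet> x - c)"] by linarith
      ultimately show ?thesis unfolding plane_cut_def by (intro \<theta>(2))
    qed
    have away: "plane_cut \<theta> m c \<delta> x = 0" if "2 * \<delta> < \<bar>m \<bullet> x - c\<bar>" for m c x
    proof -
      have "2 < \<bar>inverse \<delta> * (m \<bullet> x - c)\<bar>" using that \<delta> by (simp add: abs_mult field_simps)
      then have "2\<^sup>2 < \<bar>inverse \<delta> * (m \<bullet> x - c)\<bar>\<^sup>2" by (intro power_strict_mono) auto
      then show ?thesis unfolding plane_cut_def by (intro \<theta>(3)) simp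
    qed
    \<comment> \<open>1 = (1 - b1) + (1 - b2) b1 + b1 b2: the first part avoids the first plane, the
      second part the second plane, and only the third sees the intersection.\<close>
    define f1 where "f1 j x = (1 - b1 x) * g j x" for j x
    define f2 where "f2 j x = (1 - b2 x) * (b1 x * g j x)" for j x
    define f3 where "f3 j x = b x * g j x" for j x
    have gf: "good f1" "good f2" "good f3"
      unfolding good_def f1_def[abs_def] f2_def[abs_def] f3_def[abs_def] using g0
      by (auto intro!: smooth_on_mult s1b sb sbb sg)
    have clos: "closed {x. \<delta> \<le> \<bar>m \<bullet> x - c\<bar>}" for m :: "real^3" and c
      by (intro closed_Collect_le continuous_intros)
    have I1: "I f1 = 0"
    proof -
      have "K \<inter> {x. \<delta> \<le> \<bar>n1 \<bullet> x - c1\<bar>} \<subseteq> - S1" using S(1) \<delta> by auto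
      moreover have "f1 j x = 0" if "x \<notin> K \<inter> {x. \<delta> \<le> \<bar>n1 \<bullet> x - c1\<bar>}" for j x
        using that g0[of x j] near[of n1 x c1] by (auto simp: f1_def b1_def)
      ultimately show ?thesis
        using wcurl_vfield[OF c1, of f1 "K \<inter> {x. \<delta> \<le> \<bar>n1 \<bullet> x - c1\<bar>}"] gf(1) compact_Int_closed[OF K clos]
        unfolding I_def good_def by simp
    qed
    have I2: "I f2 = 0"
    proof -
      have "K \<inter> {x. \<delta> \<le> \<bar>n2 \<bullet> x - c2\<bar>} \<subseteq> - S2" using S(2) \<delta> by auto
      moreover have "f2 j x = 0" if "x \<notin> K \<inter> {x. \<delta> \<le> \<bar>n2 \<bullet> x - c2\<bar>}" for j x
        using that g0[of x j] near[of n2 x c2] by (auto simp: f2_def b2_def)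
      ultimately show ?thesis
        using wcurl_vfield[OF c2, of f2 "K \<inter> {x. \<delta> \<le> \<bar>n2 \<bullet> x - c2\<bar>}"] gf(2) compact_Int_closed[OF K clos]
        unfolding I_def good_def by simp
    qed
    have "good (\<lambda>j x. f1 j x + f2 j x)" using gf unfolding good_def by (auto intro!: smooth_on_add)
    then have "I (\<lambda>j x. (f1 j x + f2 j x) + f3 j x) = I f3" using I_add gf I1 I2 by simp
    moreover have "(\<lambda>j x. (f1 j x + f2 j x) + f3 j x) = g"
      by (intro ext) (simp add: f1_def f2_def f3_def b_def algebra_simps)
    ultimately have Ig: "I g = I f3" by simp
    have f3z: "f3 j x = 0" if "x \<notin> T \<delta>" for j x
    proof -
      have "x \<notin> K \<or> 2 * \<delta> < \<bar>n1 \<bullet> x - c1\<bar> \<or> 2 * \<delta> < \<bar>n2 \<bullet> x - c2\<bar>"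
        using that r[of x] by (auto simp: T_def tube_def)
      then show ?thesis using g0 away by (auto simp: f3_def b_def b1_def b2_def)
    qed
    have clT: "closed (T \<delta>)" unfolding T_def by (rule closed_tube)
    have cf3z: "vcurl f3 j x = 0" if "x \<notin> T \<delta>" for j x by (rule vcurl_outside[OF clT f3z that])
    have nb: "norm (b1 x) \<le> B" "norm (b2 x) \<le> B" for x by (simp_all add: b1_def b2_def plane_cut_def B)
    have nbb: "norm (b x) \<le> B * B" for x unfolding b_def norm_mult by (intro mult_mono nb B) auto
    have pdcut: "norm (pd i (plane_cut \<theta> m c \<delta>) x) \<le> 4 * B' / \<delta>"
      if "\<bar>m \<bullet> x - c\<bar> \<le> 2 * \<delta>" "norm m = 1" for i m c x
    proof -
      have "\<bar>m $ i\<bar> \<le> 1" using component_le_norm_cart[of m i] that(2) by simp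
      moreover have "\<bar>inverse \<delta> * (m \<bullet> x - c)\<bar> \<le> 2" using that(1) \<delta> by (simp add: abs_mult field_simps)
      ultimately have "\<bar>inverse \<delta> * (m \<bullet> x - c)\<bar> * \<bar>m $ i\<bar> \<le> 2 * 1" by (intro mult_mono) auto
      then have "(2 * inverse \<delta>) * (\<bar>inverse \<delta> * (m \<bullet> x - c)\<bar> * \<bar>m $ i\<bar>) \<le> (2 * inverse \<delta>) * (2 * 1)"
        using \<delta> by (intro mult_left_mono) auto
      then have "\<bar>2 * inverse \<delta> * (inverse \<delta> * (m \<bullet> x - c)) * (m $ i)\<bar> \<le> 4 / \<delta>"
        using \<delta> by (simp add: abs_mult divide_inverse)
      then have "\<bar>2 * inverse \<delta> * (inverse \<delta> * (m \<bullet> x - c)) * (m $ i)\<bar> * norm (Dr \<theta> ((inverse \<delta> * (m \<bullet> x - c))\<^sup>2)) \<le> 4 / \<delta> * B'"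
        using \<delta> by (intro mult_mono B') auto
      then show ?thesis unfolding pd_plane_cut[OF \<theta>(1)] norm_mult norm_of_real by simp
    qed
    have pdb: "norm (pd i b x) \<le> 8 * (B * B') / \<delta>" if "x \<in> T \<delta>" for i x
    proof -
      have t: "\<bar>n1 \<bullet> x - c1\<bar> \<le> 2 * \<delta>" "\<bar>n2 \<bullet> x - c2\<bar> \<le> 2 * \<delta>" using that
        by (auto simp: T_def tube_def)
      have "pd i b x = b1 x * pd i b2 x + pd i b1 x * b2 x"
        unfolding b_def[abs_def] by (simp add: pd_mult sb)
      also have "norm \<dots> \<le> norm (b1 x) * norm (pd i b2 x) + norm (pd i b1 x) * norm (b2 x)"
        by (rule norm_triangle_le) (simp add: norm_mult)
      also have "\<dots> \<le> B * (4 * B' / \<delta>) + 4 * B' / \<delta> * B"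
        using pdcut[OF t(1) n(1)] pdcut[OF t(2) n(2)] B(1) B'(1) \<delta> unfolding b1_def[symmetric] b2_def[symmetric]
        by (intro add_mono mult_mono nb) auto
      finally show ?thesis by (simp add: algebra_simps)
    qed
    have div: "X \<le> X / \<delta>" if "0 \<le> X" for X
      using mult_left_le[of \<delta> X] \<delta> that by (simp add: le_divide_eq)
    have f3b: "norm (f3 j x) \<le> A / \<delta> * indicator (T \<delta>) x" for j x
    proof (cases "x \<in> T \<delta>")
      case True
      have "norm (f3 j x) \<le> B * B * G" unfolding f3_def norm_mult by (intro mult_mono nbb G) (use B(1) in auto)
      also have "\<dots> \<le> A" using B(1) B'(1) G0 by (simp add: A_def)
      also have "\<dots> \<le> A / \<delta>" by (rule div[OF A0])
      finally show ?thesis using True by simp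
    qed (simp add: f3z)
    have cf3b: "norm (vcurl f3 j x) \<le> A / \<delta> * indicator (T \<delta>) x" for j x
    proof (cases "x \<in> T \<delta>")
      case True
      have p: "pd i (f3 j) x = b x * pd i (g j) x + pd i b x * g j x" for i j
        unfolding f3_def[abs_def] by (simp add: pd_mult sbb sg)
      obtain i1 i2 j1 j2 where e: "vcurl f3 j x = b x * vcurl g j x + (pd i1 b x * g j1 x - pd i2 b x * g j2 x)"
      proof -
        consider "j = 1" | "j = 2" | "j \<noteq> 1 \<and> j \<noteq> 2" by blast
        then show ?thesis
        proof cases
          case 1
          show ?thesis by (rule that[of 2 3 3 2]) (simp add: 1 vcurl_def p algebra_simps)
        next
          case 2
          show ?thesis by (rule that[of 3 1 1 3]) (simp add: 2 vcurl_def p algebra_simps)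
        next
          case 3
          show ?thesis by (rule that[of 1 2 2 1]) (simp add: 3 vcurl_def p algebra_simps)
        qed
      qed
      have q: "norm (pd i b x * g j' x) \<le> 8 * (B * B') / \<delta> * G" for i j'
        unfolding norm_mult using B(1) B'(1) \<delta> by (intro mult_mono pdb[OF True] G) auto
      have "norm (vcurl f3 j x) \<le> norm (b x * vcurl g j x) + (norm (pd i1 b x * g j1 x) + norm (pd i2 b x * g j2 x))"
        unfolding e by (intro norm_triangle_le add_left_mono norm_triangle_ineq4)
      also have "norm (b x * vcurl g j x) \<le> B * B * G" unfolding norm_mult by (intro mult_mono nbb G) (use B(1) in auto)
      also have "B * B * G \<le> B * B * G / \<delta>" by (rule div) (use B(1) G0 in simp)
      finally have "norm (vcurl f3 j x) \<le> B * B * G / \<delta> + (8 * (B * B') / \<delta> * G + 8 * (B * B') / \<delta> * G)"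
        using q[of i1 j1] q[of i2 j2] by linarith
      also have "\<dots> = A / \<delta>" using \<delta> by (simp add: A_def field_simps)
      finally show ?thesis using True by simp
    qed (simp add: cf3z)
    let ?E = "\<lambda>x. indicator (T \<delta>) x * (\<eta> * (3 * A / \<delta>)\<^sup>2) + (1 / \<eta>) * (indicator (T \<delta>) x * \<Phi> x)"
    have iT: "integrable lebesgue (\<lambda>x. indicator (T \<delta>) x * (\<eta> * (3 * A / \<delta>)\<^sup>2))"
    proof -
      have "integrable lebesgue (indicator (T \<delta>) :: real^3 \<Rightarrow> real)"
        using tube_lmeasurable[of n1 c1 n2 c2 r \<delta>] unfolding fmeasurable_def T_def
        by (intro integrable_real_indicator) auto
      then show ?thesis by (rule integrable_mult_left)
    qed
    have "norm (I f3) \<le> norm (LINT x|lebesgue. cdot (u x) (vfield (vcurl f3) x)) + norm (LINT x|lebesgue. cdot (w x) (vfield f3 x))"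
      unfolding I_def by (rule norm_triangle_ineq4)
    also have "\<dots> \<le> (LINT x|lebesgue. norm (cdot (u x) (vfield (vcurl f3) x))) + (LINT x|lebesgue. norm (cdot (w x) (vfield f3 x)))"
      by (intro add_mono integral_norm_bound)
    also have "\<dots> = (LINT x|lebesgue. norm (cdot (u x) (vfield (vcurl f3) x)) + norm (cdot (w x) (vfield f3 x)))"
      by (rule Bochner_Integration.integral_add[symmetric, OF integrable_norm[OF goodI(1)[OF gf(3)]] integrable_norm[OF goodI(2)[OF gf(3)]]])
    also have "\<dots> \<le> (LINT x|lebesgue. ?E x)"
    proof (rule integral_mono)
      show "integrable lebesgue (\<lambda>x. norm (cdot (u x) (vfield (vcurl f3) x)) + norm (cdot (w x) (vfield f3 x)))"
        by (intro Bochner_Integration.integrable_add integrable_norm goodI gf)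
      show "integrable lebesgue ?E" by (intro Bochner_Integration.integrable_add iT integrable_mult_right \<Phi>T)
      fix x
      have "norm (cdot (u x) (vfield (vcurl f3) x)) + norm (cdot (w x) (vfield f3 x))
          \<le> 3 * norm (u x) * (A / \<delta> * indicator (T \<delta>) x) + 3 * norm (w x) * (A / \<delta> * indicator (T \<delta>) x)"
        by (intro add_mono norm_cdot_vfield_le f3b cf3b)
      also have "\<dots> = indicator (T \<delta>) x * ((3 * A / \<delta>) * (norm (u x) + norm (w x)))"
        by (simp add: algebra_simps add_divide_distrib)
      also have "\<dots> \<le> indicator (T \<delta>) x * (\<eta> * (3 * A / \<delta>)\<^sup>2 + \<Phi> x / \<eta>)"
      proof (rule mult_left_mono)
        define X where "X = 3 * A / \<delta>"
        define Y where "Y = norm (u x) + norm (w x)"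
        have "0 \<le> (\<eta> * X - Y)\<^sup>2" by simp
        then have "2 * (\<eta> * (X * Y)) \<le> \<eta>\<^sup>2 * X\<^sup>2 + Y\<^sup>2" by (simp add: power2_diff power_mult_distrib mult.assoc)
        moreover have "0 \<le> \<eta> * (X * Y)" using \<eta> A0 \<delta> by (simp add: X_def Y_def)
        ultimately have "\<eta> * (X * Y) \<le> \<eta> * (\<eta> * X\<^sup>2) + Y\<^sup>2" by (simp add: power2_eq_square mult.assoc)
        moreover have "Y\<^sup>2 \<le> \<Phi> x" unfolding Y_def \<Phi>_def
          using sum_squares_bound[of "norm (u x)" "norm (w x)"] by (simp add: power2_sum)
        ultimately have "\<eta> * (X * Y) \<le> \<eta> * (\<eta> * X\<^sup>2 + \<Phi> x / \<eta>)" using \<eta> by (simp add: distrib_left)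
        then show "X * Y \<le> \<eta> * X\<^sup>2 + \<Phi> x / \<eta>" using \<eta> by simp
      qed simp
      also have "\<dots> = ?E x" by (simp add: distrib_left)
      finally show "norm (cdot (u x) (vfield (vcurl f3) x)) + norm (cdot (w x) (vfield f3 x)) \<le> ?E x" .
    qed
    also have "\<dots> = (LINT x|lebesgue. indicator (T \<delta>) x * (\<eta> * (3 * A / \<delta>)\<^sup>2)) + (LINT x|lebesgue. (1 / \<eta>) * (indicator (T \<delta>) x * \<Phi> x))"
      by (rule Bochner_Integration.integral_add[OF iT integrable_mult_right[OF \<Phi>T]])
    also have "\<dots> = measure lebesgue (T \<delta>) * (\<eta> * (3 * A / \<delta>)\<^sup>2) + J \<delta> / \<eta>"
      by (simp add: J_def)
    also have "measure lebesgue (T \<delta>) * (\<eta> * (3 * A / \<delta>)\<^sup>2) \<le> (C * \<delta>\<^sup>2) * (\<eta> * (3 * A / \<delta>)\<^sup>2)"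
      using C(3)[OF \<delta>(1,2)] \<eta> by (intro mult_right_mono) auto
    also have "(C * \<delta>\<^sup>2) * (\<eta> * (3 * A / \<delta>)\<^sup>2) = \<eta> * (9 * A\<^sup>2 * C)"
      using \<delta> by (simp add: field_simps power2_eq_square)
    finally show ?thesis unfolding Ig by simp
  qed
  \<comment> \<open>Off the first plane, a null set, every point eventually leaves the tubes, so
    dominated convergence applies.\<close>
  have Jlim: "(\<lambda>m. J (inverse (real (Suc m)))) \<longlonglongrightarrow> 0"
  proof -
    have "(\<lambda>m. J (inverse (real (Suc m)))) \<longlonglongrightarrow> integral\<^sup>L lebesgue (\<lambda>x::real^3. 0::real)"
      unfolding J_def
    proof (rule integral_dominated_convergence[where w="\<lambda>x. indicator (ball 0 (r + 1)) x * \<Phi> x" and f="\<lambda>_. 0"])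
      show "(\<lambda>x. indicator (T (inverse (real (Suc m)))) x * \<Phi> x) \<in> borel_measurable lebesgue" for m
        by (rule borel_measurable_integrable[OF \<Phi>T])
      have "n1 \<noteq> 0" using n by auto
      then have "negligible {x. n1 \<bullet> x = c1}" by (intro negligible_hyperplane) simp
      then have "AE x in lebesgue. x \<notin> {x. n1 \<bullet> x = c1}"
        by (intro AE_not_in) (simp add: negligible_iff_null_sets)
      then show "AE x in lebesgue. (\<lambda>m. indicator (T (inverse (real (Suc m)))) x * \<Phi> x) \<longlonglongrightarrow> 0"
      proof eventually_elim
        case (elim x)
        then have p: "0 < \<bar>n1 \<bullet> x - c1\<bar>" by simp
        have "(\<lambda>m. 2 * inverse (real (Suc m))) \<longlonglongrightarrow> 2 * 0" by (intro tendsto_intros LIMSEQ_inverse_real_of_nat)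
        then have "\<forall>\<^sub>F m in sequentially. 2 * inverse (real (Suc m)) < \<bar>n1 \<bullet> x - c1\<bar>"
          by (rule order_tendstoD(2)) (use p in simp)
        then have "\<forall>\<^sub>F m in sequentially. 0 = indicator (T (inverse (real (Suc m)))) x * \<Phi> x"
          by eventually_elim (simp add: T_def tube_def indicator_def del: of_nat_Suc)
        then show ?case by (intro Lim_transform_eventually[OF tendsto_const])
      qed
      show "AE x in lebesgue. norm (indicator (T (inverse (real (Suc m)))) x * \<Phi> x) \<le> indicator (ball 0 (r + 1)) x * \<Phi> x" for m
        using \<Phi>0 by (intro AE_I2) (auto simp: indicator_def T_def tube_def)
    qed (use \<Phi>b in simp_all)
    then show ?thesis by simp
  qed
  \<comment> \<open>First \<delta> tends to 0 with \<eta> fixed; only afterwards is \<eta> made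
    small.\<close>
  have small: "norm (I g) \<le> \<eta> * (9 * A\<^sup>2 * C)" if \<eta>: "0 < \<eta>" for \<eta>
  proof (rule tendsto_lowerbound)
    have "(\<lambda>m. \<eta> * (9 * A\<^sup>2 * C) + J (inverse (real (Suc m))) / \<eta>) \<longlonglongrightarrow> \<eta> * (9 * A\<^sup>2 * C) + 0 / \<eta>"
      using \<eta> by (intro tendsto_intros Jlim) auto
    then show "(\<lambda>m. \<eta> * (9 * A\<^sup>2 * C) + J (inverse (real (Suc m))) / \<eta>) \<longlonglongrightarrow> \<eta> * (9 * A\<^sup>2 * C)" by simp
    have "\<forall>\<^sub>F m in sequentially. inverse (real (Suc m)) < \<delta>0"
      by (rule order_tendstoD(2)[OF LIMSEQ_inverse_real_of_nat C(2)])
    then show "\<forall>\<^sub>F m in sequentially. norm (I g) \<le> \<eta> * (9 * A\<^sup>2 * C) + J (inverse (real (Suc m))) / \<eta>"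
    proof eventually_elim
      case (elim m)
      have "inverse (real (Suc m)) \<le> 1" by (simp add: field_simps)
      then show ?case by (intro est[OF _ elim _ \<eta>]) auto
    qed
  qed simp
  have "norm (I g) \<le> 0"
  proof (rule ccontr)
    assume "\<not> ?thesis"
    then have p: "0 < norm (I g)" by simp
    define D where "D = 9 * A\<^sup>2 * C"
    have D: "0 \<le> D" using C(1) by (simp add: D_def)
    have q: "0 < norm (I g) / (2 * (D + 1))" using p D by simp
    have "norm (I g) \<le> norm (I g) / (2 * (D + 1)) * D" by (rule small[OF q, folded D_def])
    also have "\<dots> \<le> norm (I g) / (2 * (D + 1)) * (D + 1)" using p D by (intro mult_left_mono) auto
    also have "\<dots> = norm (I g) / 2" using D by (simp add: field_simps)
    finally show False using p by simp
  qed
  then have "I g = 0" by simp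
  then show "(LINT x|lebesgue. cdot (u x) (curl \<phi> x)) = (LINT x|lebesgue. cdot (w x) (\<phi> x))"
    unfolding \<phi> curl_vfield[OF sg] I_def by simp
qed

section \<open>Continuation between the planes, reading off the far field, and the
  contradiction\<close>

section \<open>Uniqueness of the supporting plane\<close>

lemma AE_lebesgue_iff_negligible:
  fixes P :: "real^3 \<Rightarrow> bool"
  shows "(AE x in lebesgue. P x) \<longleftrightarrow> negligible {x. \<not> P x}"
proof
  assume "AE x in lebesgue. P x"
  then obtain N where "N \<in> null_sets lebesgue" "{x. \<not> P x} \<subseteq> N"
    unfolding eventually_ae_filter by auto
  then show "negligible {x. \<not> P x}"
    using negligible_subset[of N] by (simp add: negligible_iff_null_sets)
next
  assume "negligible {x. \<not> P x}"
  then have "AE x in lebesgue. x \<notin> {x. \<not> P x}"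
    by (intro AE_not_in) (simp add: negligible_iff_null_sets)
  then show "AE x in lebesgue. P x" by simp
qed

text \<open>In three dimensions two normals leave a direction d orthogonal to both. Along the line
  through x in direction d the distances to the planes are constant, so balls of one fixed radius
  can be chained from far away, where v vanishes, to x. A set that is negligible locally is
  negligible.\<close>

lemma helm_zero_off_planes:
  fixes n1 n2 :: "real^3"
  assumes k: "0 < k" and v: "loc_integrable v" and hv: "helm k U v"
    and far: "AE x in lebesgue. R < norm x \<longrightarrow> v x = 0"
    and n: "norm n1 = 1" "norm n2 = 1" and U: "\<And>x. n1 \<bullet> x \<noteq> c1 \<Longrightarrow> n2 \<bullet> x \<noteq> c2 \<Longrightarrow> x \<in> U"
  shows "AE x in lebesgue. v x = 0"
proof -
  have "dim {n1, n2} \<le> card {n1, n2}" by (rule dim_le_card') simp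
  also have "\<dots> \<le> 2" by (simp add: card_insert_if)
  finally have "dim {n1, n2} < DIM(real^3)" by simp
  from orthogonal_to_subspace_exists[OF this]
  obtain d0 where d0: "d0 \<noteq> 0" "\<And>y. y \<in> span {n1, n2} \<Longrightarrow> orthogonal d0 y" by blast
  define d where "d = d0 /\<^sub>R norm d0"
  have d1: "norm d = 1" using d0(1) by (simp add: d_def)
  have "n1 \<bullet> d0 = 0" "n2 \<bullet> d0 = 0"
    using d0(2)[of n1] d0(2)[of n2] by (auto simp: orthogonal_def span_base inner_commute)
  then have d: "n1 \<bullet> d = 0" "n2 \<bullet> d = 0" by (simp_all add: d_def)
  have loc: "\<exists>\<delta>>0. AE y in lebesgue. y \<in> ball x \<delta> \<longrightarrow> v y = 0" if x: "n1 \<bullet> x \<noteq> c1" "n2 \<bullet> x \<noteq> c2" for x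
  proof -
    define \<rho> where "\<rho> = min \<bar>n1 \<bullet> x - c1\<bar> \<bar>n2 \<bullet> x - c2\<bar>"
    have \<rho>: "0 < \<rho>" using x by (simp add: \<rho>_def)
    have ballU: "ball (x + t *\<^sub>R d) \<rho> \<subseteq> U" for t
    proof
      fix y assume y: "y \<in> ball (x + t *\<^sub>R d) \<rho>"
      have b: "\<bar>m \<bullet> y - m \<bullet> x\<bar> < \<rho>" if "norm m = 1" "m \<bullet> d = 0" for m
      proof -
        have "m \<bullet> y - m \<bullet> x = m \<bullet> (y - (x + t *\<^sub>R d))" using that(2) by (simp add: inner_diff_right inner_add_right)
        also have "\<bar>\<dots>\<bar> \<le> norm m * norm (y - (x + t *\<^sub>R d))" by (rule Cauchy_Schwarz_ineq2)
        also have "\<dots> < \<rho>" using y that(1) by (simp add: dist_norm norm_minus_commute)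
        finally show ?thesis .
      qed
      show "y \<in> U"
        using b[OF n(1) d(1)] b[OF n(2) d(2)] by (intro U) (auto simp: \<rho>_def)
    qed
    \<comment> \<open>Enough steps of length \<rho> / 2 for the first ball of the chain to lie
      outside the ball of radius R.\<close>
    obtain m :: nat where "(R + norm x + \<rho>) / (\<rho> / 2) < real m" using reals_Archimedean2 by blast
    then have m: "R + norm x + \<rho> < real m * (\<rho> / 2)" using \<rho> by (subst (asm) pos_divide_less_eq) simp_all
    \<comment> \<open>The chain starts far away at i = 0 and reaches x at i = m. Consecutive centres
      are \<rho> / 2 apart, so the half-size ball about the next centre lies in the full-size ball
      about the present one.\<close>
    define z where "z i = x + ((real m - real i) * (\<rho> / 2)) *\<^sub>R d" for i
    have "AE y in lebesgue. y \<in> ball (z i) (\<rho> / 2) \<longrightarrow> v y = 0" for i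
    proof (induction i)
      case 0
      show ?case using far
      proof eventually_elim
        case (elim y)
        show ?case
        proof
          assume "y \<in> ball (z 0) (\<rho> / 2)"
          then have "norm (z 0 - y) < \<rho> / 2" by (simp add: dist_norm)
          moreover have "norm (z 0 - x) = real m * (\<rho> / 2)" using \<rho> d1 by (simp add: z_def)
          moreover have "norm (z 0 - x) \<le> norm (z 0 - y) + norm y + norm x" by norm
          ultimately have "R < norm y" using m \<rho> by linarith
          then show "v y = 0" using elim by blast
        qed
      qed
    next
      case (Suc i)
      have "ball (z i) \<rho> \<subseteq> U" unfolding z_def by (rule ballU)
      from helm_unique_continuation[OF k v hv this \<rho> _ Suc] \<rho>
      have H: "AE y in lebesgue. y \<in> ball (z i) \<rho> \<longrightarrow> v y = 0" by simp
      have sub: "ball (z (Suc i)) (\<rho> / 2) \<subseteq> ball (z i) \<rho>"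
      proof -
        have "(real m - real i) * (\<rho> / 2) = (real m - real (Suc i)) * (\<rho> / 2) + \<rho> / 2"
          unfolding of_nat_Suc by (simp add: field_simps)
        then have "z i = z (Suc i) + (\<rho> / 2) *\<^sub>R d"
          unfolding z_def by (simp only: scaleR_left_distrib add.assoc)
        then have ds: "dist (z i) (z (Suc i)) = \<rho> / 2" using \<rho> d1 by (simp add: dist_norm)
        show ?thesis
        proof
          fix y assume "y \<in> ball (z (Suc i)) (\<rho> / 2)"
          then show "y \<in> ball (z i) \<rho>"
            using ds dist_triangle[of "z i" y "z (Suc i)"] by simp
        qed
      qed
      show ?case using H by (rule eventually_mono) (use sub in blast)
    qed
    from this[of m] show ?thesis using \<rho> by (intro exI[of _ "\<rho> / 2"]) (simp add: z_def)
  qed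
  define N where "N = {x. n1 \<bullet> x \<noteq> c1 \<and> n2 \<bullet> x \<noteq> c2 \<and> v x \<noteq> 0}"
  have "negligible N"
  proof (subst locally_negligible_alt, intro ballI)
    fix x assume "x \<in> N"
    then have "n1 \<bullet> x \<noteq> c1" "n2 \<bullet> x \<noteq> c2" by (auto simp: N_def)
    from loc[OF this] obtain \<delta> where \<delta>: "0 < \<delta>" "AE y in lebesgue. y \<in> ball x \<delta> \<longrightarrow> v y = 0" by blast
    have "negligible (N \<inter> ball x \<delta>)"
      using \<delta>(2) unfolding AE_lebesgue_iff_negligible by (rule negligible_subset) (auto simp: N_def)
    moreover have "openin (top_of_set N) (N \<inter> ball x \<delta>)" by (intro openin_open_Int) simp
    ultimately show "\<exists>U. openin (top_of_set N) U \<and> x \<in> U \<and> negligible U"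
      using \<open>x \<in> N\<close> \<delta>(1) by (intro exI[of _ "N \<inter> ball x \<delta>"]) simp
  qed
  moreover have "negligible {x. n1 \<bullet> x = c1}" "negligible {x. n2 \<bullet> x = c2}"
    using n by (auto intro!: negligible_hyperplane)
  ultimately have "negligible (N \<union> ({x. n1 \<bullet> x = c1} \<union> {x. n2 \<bullet> x = c2}))"
    by (intro negligible_Un)
  then show ?thesis
    unfolding AE_lebesgue_iff_negligible by (rule negligible_subset) (auto simp: N_def)
qed

text \<open>Continuity spreads F d \<noteq> 0 to an open set of directions; far out over these the
  leading term of order 1/r exceeds the error of order 1/r^2, and a nonempty open set is not
  negligible.\<close>

lemma far_asymptotic_zero:
  assumes far: "far_asymptotic k v F" and v: "AE x in lebesgue. v x = 0"
    and F: "continuous_on (sphere 0 1) F" and d: "d \<in> sphere 0 1"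
  shows "F d = 0"
proof (rule ccontr)
  assume nz: "F d \<noteq> 0"
  define \<eta> where "\<eta> = norm (F d) / 2"
  have \<eta>: "0 < \<eta>" "\<eta> < norm (F d)" using nz by (simp_all add: \<eta>_def)
  obtain R C where RC: "AE x in lebesgue. R \<le> norm x \<longrightarrow>
     norm (v x - exp (\<i> * of_real (k * norm x)) / of_real (4 * pi * norm x) * F (x /\<^sub>R norm x)) \<le> C / (norm x)\<^sup>2"
    using far unfolding far_asymptotic_def by blast
  \<comment> \<open>Beyond 4 pi |C| / \<eta> the main term, larger than \<eta> / (4 pi r), dominates
    C / r^2; the 1 keeps away from the origin.\<close>
  define M where "M = max (max R 1) (4 * pi * \<bar>C\<bar> / \<eta>)"
  have M: "R \<le> M" "1 \<le> M" "4 * pi * \<bar>C\<bar> / \<eta> \<le> M" by (auto simp: M_def)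
  define W where "W = (- cball 0 M) \<inter> (\<lambda>x. norm (F (x /\<^sub>R norm x))) -` {\<eta><..}"
  have sph: "x /\<^sub>R norm x \<in> sphere 0 1" if "x \<in> - cball 0 M" for x :: "real^3"
    using that M(2) by (auto simp: field_simps)
  have "continuous_on (- cball 0 M) (\<lambda>x::real^3. x /\<^sub>R norm x)"
    using M(2) by (intro continuous_intros) auto
  then have "continuous_on (- cball 0 M) (\<lambda>x. norm (F (x /\<^sub>R norm x)))"
    by (intro continuous_on_norm continuous_on_compose2[OF F]) (use sph in auto)
  then have "open W" unfolding W_def by (intro continuous_open_preimage) auto
  moreover have "(M + 1) *\<^sub>R d \<in> W" using d M(2) \<eta>(2) by (auto simp: W_def)
  ultimately have "\<not> negligible W" using open_not_negligible by blast
  moreover have "W \<subseteq> {x. \<not> (v x = 0 \<and> (R \<le> norm x \<longrightarrow>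
     norm (v x - exp (\<i> * of_real (k * norm x)) / of_real (4 * pi * norm x) * F (x /\<^sub>R norm x)) \<le> C / (norm x)\<^sup>2))}"
  proof
    fix x assume x: "x \<in> W"
    define r where "r = norm x"
    have r: "M < r" "\<eta> < norm (F (x /\<^sub>R r))" using x by (auto simp: W_def r_def)
    have r0: "0 < r" "R \<le> r" using r(1) M by auto
    {
      assume "v x = 0" "norm (v x - exp (\<i> * of_real (k * r)) / of_real (4 * pi * r) * F (x /\<^sub>R r)) \<le> C / r\<^sup>2"
      then have "norm (F (x /\<^sub>R r)) / (4 * pi * r) \<le> C / r\<^sup>2"
        using r0 by (simp add: norm_mult norm_divide norm_exp_eq_Re)
      then have "norm (F (x /\<^sub>R r)) * r \<le> 4 * pi * C"
        using r0 by (simp add: field_simps power2_eq_square)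
      moreover have "\<eta> * r < norm (F (x /\<^sub>R r)) * r" using r r0 by simp
      moreover have "4 * pi * C \<le> 4 * pi * \<bar>C\<bar>" by simp
      moreover have "4 * pi * \<bar>C\<bar> \<le> \<eta> * r" 
      proof -
        have "4 * pi * \<bar>C\<bar> \<le> M * \<eta>" using M(3) \<eta>(1) by (simp add: pos_divide_le_eq)
        also have "\<dots> \<le> r * \<eta>" using r(1) \<eta>(1) by (intro mult_right_mono) auto
        finally show ?thesis by (simp add: mult.commute)
      qed
      ultimately have False by linarith
    }
    then show "x \<in> {x. \<not> (v x = 0 \<and> (R \<le> norm x \<longrightarrow>
     norm (v x - exp (\<i> * of_real (k * norm x)) / of_real (4 * pi * norm x) * F (x /\<^sub>R norm x)) \<le> C / (norm x)\<^sup>2))}"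
      using r0 by (auto simp: r_def)
  qed
  moreover have "AE x in lebesgue. v x = 0 \<and> (R \<le> norm x \<longrightarrow>
     norm (v x - exp (\<i> * of_real (k * norm x)) / of_real (4 * pi * norm x) * F (x /\<^sub>R norm x)) \<le> C / (norm x)\<^sup>2)"
    using v RC by eventually_elim blast
  ultimately show False unfolding AE_lebesgue_iff_negligible using negligible_subset by blast
qed

text \<open>\<open>ae_at_infinity\<close> is the infimum of two filters, so the estimate splits into
  a radius and a null set; the latter also absorbs the passage from e to its extension by 0.\<close>

lemma far_field_pattern_imp_asymptotic:
  assumes far: "far_field_pattern k e F" and S: "negligible S"
  shows "far_asymptotic k (\<lambda>x. zero_on S e x $ m) (\<lambda>d. F d $ m)"
proof -
  let ?D = "\<lambda>x. e x - (exp (\<i> * of_real (k * norm x)) / of_real (4 * pi * norm x)) *s F (x /\<^sub>R norm x)"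
  obtain C where "\<forall>\<^sub>F x in ae_at_infinity. norm (norm (?D x)) \<le> C * norm (1 / (norm x)\<^sup>2)"
    using far unfolding far_field_pattern_def by (elim landau_o.bigE)
  then obtain P Q where P: "eventually P at_infinity" and Q: "AE x in lebesgue. Q x"
    and PQ: "\<And>x. P x \<Longrightarrow> Q x \<Longrightarrow> norm (norm (?D x)) \<le> C * norm (1 / (norm x)\<^sup>2)"
    unfolding ae_at_infinity_def eventually_inf by blast
  obtain R where R: "\<And>x. R \<le> norm x \<Longrightarrow> P x" using P unfolding eventually_at_infinity by blast
  have "AE x in lebesgue. x \<notin> S" using S unfolding AE_lebesgue_iff_negligible by simp
  with Q have "AE x in lebesgue. R \<le> norm x \<longrightarrow>
     norm (zero_on S e x $ m - exp (\<i> * of_real (k * norm x)) / of_real (4 * pi * norm x) * (F (x /\<^sub>R norm x) $ m)) \<le> C / (norm x)\<^sup>2"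
  proof eventually_elim
    case (elim x)
    show ?case
    proof
      assume "R \<le> norm x"
      have "norm (?D x $ m) \<le> norm (?D x)" by (rule Finite_Cartesian_Product.norm_nth_le)
      also have "\<dots> \<le> C / (norm x)\<^sup>2" using PQ[OF R[OF \<open>R \<le> norm x\<close>] elim(1)] by simp
      finally show "norm (zero_on S e x $ m - exp (\<i> * of_real (k * norm x)) / of_real (4 * pi * norm x) * (F (x /\<^sub>R norm x) $ m)) \<le> C / (norm x)\<^sup>2"
        using elim(2) by (simp add: zero_on_def)
    qed
  qed
  then show ?thesis unfolding far_asymptotic_def by blast
qed

lemma far_asymptotic_diff:
  assumes "far_asymptotic k v F" "far_asymptotic k v' F"
  shows "far_asymptotic k (\<lambda>x. v x - v' x) (\<lambda>_. 0)"
proof -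
  let ?s = "\<lambda>x. exp (\<i> * of_real (k * norm x)) / of_real (4 * pi * norm x) * F (x /\<^sub>R norm x)"
  obtain R C where 1: "AE x in lebesgue. R \<le> norm x \<longrightarrow> norm (v x - ?s x) \<le> C / (norm x)\<^sup>2"
    using assms(1) unfolding far_asymptotic_def by blast
  obtain R' C' where 2: "AE x in lebesgue. R' \<le> norm x \<longrightarrow> norm (v' x - ?s x) \<le> C' / (norm x)\<^sup>2"
    using assms(2) unfolding far_asymptotic_def by blast
  have "AE x in lebesgue. max R R' \<le> norm x \<longrightarrow> norm (v x - v' x) \<le> (C + C') / (norm x)\<^sup>2"
    using 1 2
  proof eventually_elim
    case (elim x)
    have "norm (v x - v' x) \<le> norm (v x - ?s x) + norm (v' x - ?s x)"
      using norm_triangle_ineq4[of "v x - ?s x" "v' x - ?s x"] by simp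
    then show ?case using elim by (auto simp: add_divide_distrib)
  qed
  then show ?thesis unfolding far_asymptotic_def by (intro exI[of _ "max R R'"] exI[of _ "C + C'"]) simp
qed

lemma planar_screenD:
  assumes "planar_screen j S P \<nu>"
  obtains c where "P = {x. \<nu> \<bullet> x = c}" "norm \<nu> = 1" "S \<subseteq> P" "compact S" "negligible S"
proof -
  from assms obtain c where c: "P = {x. \<nu> \<bullet> x = c}" "norm \<nu> = 1" "S \<subseteq> P" "compact S"
    unfolding planar_screen_def unit_normal_def plane_submanifold_with_boundary_def by blast
  have "\<nu> \<noteq> 0" using c(2) by auto
  then have "negligible P" unfolding c(1) by (intro negligible_hyperplane) simp
  then have "negligible S" using c(3) negligible_subset by blast
  then show ?thesis using that c by blast
qed

lemma maxwellD:
  assumes "maxwell \<epsilon> \<mu> \<omega> (- S) e h" "closed S"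
  defines "\<alpha> \<equiv> \<i> * of_real (\<omega> * \<mu>)" and "\<beta> \<equiv> - (\<i> * of_real (\<omega> * \<epsilon>))"
  shows "loc_L2 (zero_on S e)" "loc_L2 (zero_on S h)"
    "wcurl (- S) (zero_on S e) (\<lambda>x. \<alpha> *s zero_on S h x)"
    "wcurl (- S) (zero_on S h) (\<lambda>x. \<beta> *s zero_on S e x)"
proof -
  have m: "L2_loc (- S) e" "L2_loc (- S) h" "has_weak_curl (- S) e (\<lambda>x. \<alpha> *s h x)"
    "has_weak_curl (- S) h (\<lambda>x. - ((\<i> * of_real (\<omega> * \<epsilon>)) *s e x))"
    using assms(1) unfolding maxwell_def L2_loc_curl_def \<alpha>_def by auto
  show "loc_L2 (zero_on S e)" "loc_L2 (zero_on S h)" using L2_loc_imp_loc_L2 m(1,2) assms(2) by auto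
  have "zero_on S (\<lambda>x. \<alpha> *s h x) = (\<lambda>x. \<alpha> *s zero_on S h x)"
    "zero_on S (\<lambda>x. - ((\<i> * of_real (\<omega> * \<epsilon>)) *s e x)) = (\<lambda>x. \<beta> *s zero_on S e x)"
    by (auto simp: zero_on_def vec_eq_iff \<beta>_def)
  then show "wcurl (- S) (zero_on S e) (\<lambda>x. \<alpha> *s zero_on S h x)"
    "wcurl (- S) (zero_on S h) (\<lambda>x. \<beta> *s zero_on S e x)"
    using has_weak_curl_imp_wcurl[OF m(3) assms(2)] has_weak_curl_imp_wcurl[OF m(4) assms(2)] by simp_all
qed

lemma AE_vec3_zero:
  fixes u :: field3
  assumes "\<And>m. AE x in lebesgue. u x $ m = 0" shows "AE x in lebesgue. u x = 0"
  using assms[of 1] assms[of 2] assms[of 3]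
  by eventually_elim (simp add: vec_eq_iff forall_3)

theorem proposition2p3:
  fixes \<epsilon> \<mu> \<omega> k :: real
    and j\<^sub>1 j\<^sub>2 :: enat
    and S\<^sub>1 S\<^sub>2 \<pi>\<^sub>1 \<pi>\<^sub>2 :: "(real^3) set"
    and \<nu>\<^sub>1 \<nu>\<^sub>2 :: "real^3"
    and E\<^sub>0 H\<^sub>0 e\<^sub>1 h\<^sub>1 e\<^sub>2 h\<^sub>2 Einf Hinf :: "real^3 \<Rightarrow> complex^3"
  assumes "0 < \<epsilon>" and "0 < \<mu>" and "0 < \<omega>" and "k = \<omega> * sqrt (\<epsilon> * \<mu>)"
    and "planar_screen j\<^sub>1 S\<^sub>1 \<pi>\<^sub>1 \<nu>\<^sub>1" and "planar_screen j\<^sub>2 S\<^sub>2 \<pi>\<^sub>2 \<nu>\<^sub>2"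
    and "incident_field \<epsilon> \<mu> \<omega> E\<^sub>0 H\<^sub>0"
    and "scattering_solution \<epsilon> \<mu> \<omega> S\<^sub>1 \<pi>\<^sub>1 \<nu>\<^sub>1 E\<^sub>0 e\<^sub>1 h\<^sub>1"
    and "scattering_solution \<epsilon> \<mu> \<omega> S\<^sub>2 \<pi>\<^sub>2 \<nu>\<^sub>2 E\<^sub>0 e\<^sub>2 h\<^sub>2"
    and "far_field k e\<^sub>1 h\<^sub>1 Einf Hinf" and "far_field k e\<^sub>2 h\<^sub>2 Einf Hinf"
    and "\<exists>d\<in>sphere 0 1. Einf d \<noteq> 0 \<or> Hinf d \<noteq> 0"
  shows "\<pi>\<^sub>1 = \<pi>\<^sub>2"
proof (rule ccontr)
  assume ne: "\<pi>\<^sub>1 \<noteq> \<pi>\<^sub>2"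
  obtain c\<^sub>1 where s1: "\<pi>\<^sub>1 = {x. \<nu>\<^sub>1 \<bullet> x = c\<^sub>1}" "norm \<nu>\<^sub>1 = 1" "S\<^sub>1 \<subseteq> \<pi>\<^sub>1" "compact S\<^sub>1" "negligible S\<^sub>1"
    using planar_screenD[OF assms(5)] .
  obtain c\<^sub>2 where s2: "\<pi>\<^sub>2 = {x. \<nu>\<^sub>2 \<bullet> x = c\<^sub>2}" "norm \<nu>\<^sub>2 = 1" "S\<^sub>2 \<subseteq> \<pi>\<^sub>2" "compact S\<^sub>2" "negligible S\<^sub>2"
    using planar_screenD[OF assms(6)] .
  have k: "0 < k" and k2: "k\<^sup>2 = (\<omega> * \<mu>) * (\<omega> * \<epsilon>)"
    using assms(1-4) by (simp_all add: power_mult_distrib power2_eq_square mult_ac)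
  define \<alpha> where "\<alpha> = \<i> * complex_of_real (\<omega> * \<mu>)"
  define \<beta> where "\<beta> = - (\<i> * complex_of_real (\<omega> * \<epsilon>))"
  have ab: "\<alpha> * \<beta> = of_real (k\<^sup>2)" "\<beta> * \<alpha> = of_real (k\<^sup>2)" "\<alpha> \<noteq> 0" "\<beta> \<noteq> 0"
    using assms(1-3) unfolding \<alpha>_def \<beta>_def k2 by (simp_all add: algebra_simps)
  define E\<^sub>1 where "E\<^sub>1 = zero_on S\<^sub>1 e\<^sub>1"
  define H\<^sub>1 where "H\<^sub>1 = zero_on S\<^sub>1 h\<^sub>1"
  define E\<^sub>2 where "E\<^sub>2 = zero_on S\<^sub>2 e\<^sub>2"
  define H\<^sub>2 where "H\<^sub>2 = zero_on S\<^sub>2 h\<^sub>2"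
  have "maxwell \<epsilon> \<mu> \<omega> (- S\<^sub>1) e\<^sub>1 h\<^sub>1" "maxwell \<epsilon> \<mu> \<omega> (- S\<^sub>2) e\<^sub>2 h\<^sub>2"
    using assms(8,9) by (simp_all add: scattering_solution_def)
  note m1 = maxwellD[OF this(1) compact_imp_closed[OF s1(4)], folded \<alpha>_def \<beta>_def E\<^sub>1_def H\<^sub>1_def]
    and m2 = maxwellD[OF this(2) compact_imp_closed[OF s2(4)], folded \<alpha>_def \<beta>_def E\<^sub>2_def H\<^sub>2_def]
  have fE: "far_asymptotic k (\<lambda>x. E\<^sub>1 x $ m) (\<lambda>d. Einf d $ m)" "far_asymptotic k (\<lambda>x. E\<^sub>2 x $ m) (\<lambda>d. Einf d $ m)"
    and fH: "far_asymptotic k (\<lambda>x. H\<^sub>1 x $ m) (\<lambda>d. Hinf d $ m)" "far_asymptotic k (\<lambda>x. H\<^sub>2 x $ m) (\<lambda>d. Hinf d $ m)" for m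
    using assms(10,11) unfolding far_field_def E\<^sub>1_def H\<^sub>1_def E\<^sub>2_def H\<^sub>2_def
    by (auto intro!: far_field_pattern_imp_asymptotic s1(5) s2(5))
  let ?U = "- (S\<^sub>1 \<union> S\<^sub>2)"
  have U1: "?U \<subseteq> - S\<^sub>1" and U2: "?U \<subseteq> - S\<^sub>2" by auto
  have sd: "\<gamma> *s a - \<gamma> *s b = \<gamma> *s (a - b)" for \<gamma> :: complex and a b :: "complex^3"
    by (simp add: vec_eq_iff right_diff_distrib)
  have cE: "wcurl ?U (\<lambda>x. E\<^sub>1 x - E\<^sub>2 x) (\<lambda>x. \<alpha> *s (H\<^sub>1 x - H\<^sub>2 x))"
    using wcurl_diff[OF wcurl_mono[OF m1(3) U1] wcurl_mono[OF m2(3) U2] m1(1) loc_L2_scale[OF m1(2)] m2(1) loc_L2_scale[OF m2(2)]]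
    unfolding sd .
  have cH: "wcurl ?U (\<lambda>x. H\<^sub>1 x - H\<^sub>2 x) (\<lambda>x. \<beta> *s (E\<^sub>1 x - E\<^sub>2 x))"
    using wcurl_diff[OF wcurl_mono[OF m1(4) U1] wcurl_mono[OF m2(4) U2] m1(2) loc_L2_scale[OF m1(1)] m2(2) loc_L2_scale[OF m2(1)]]
    unfolding sd .
  have lE: "loc_L2 (\<lambda>x. E\<^sub>1 x - E\<^sub>2 x)" and lH: "loc_L2 (\<lambda>x. H\<^sub>1 x - H\<^sub>2 x)"
    using m1 m2 by (auto intro: loc_L2_diff)
  have "bounded (S\<^sub>1 \<union> S\<^sub>2)" using s1(4) s2(4) by (simp add: compact_imp_bounded)
  then obtain R where R: "0 < R" "\<And>x. x \<in> S\<^sub>1 \<union> S\<^sub>2 \<Longrightarrow> norm x \<le> R" unfolding bounded_pos by blast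
  have RU: "x \<in> ?U" if "R < norm x" for x using R(2)[of x] that by auto
  have PU: "x \<in> ?U" if "\<nu>\<^sub>1 \<bullet> x \<noteq> c\<^sub>1" "\<nu>\<^sub>2 \<bullet> x \<noteq> c\<^sub>2" for x using that s1(1,3) s2(1,3) by auto
  have zero: "AE x in lebesgue. u x = 0"
    if u: "loc_L2 u" and hu: "\<And>m. helm k ?U (\<lambda>x. u x $ m)" and fu: "\<And>m. far_asymptotic k (\<lambda>x. u x $ m) (\<lambda>_. 0)" for u
  proof (rule AE_vec3_zero)
    fix m
    have "AE x in lebesgue. R < norm x \<longrightarrow> u x $ m = 0"
      by (rule helm_Rellich[OF k loc_L2_component[OF u] hu RU _ fu]) (use R(1) in auto)
    from helm_zero_off_planes[OF k loc_L2_component[OF u] hu this s1(2) s2(2) PU]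
    show "AE x in lebesgue. u x $ m = 0" .
  qed
  have "AE x in lebesgue. E\<^sub>1 x - E\<^sub>2 x = 0"
  proof (rule zero[OF lE maxwell_imp_helm[OF lE lH cE cH ab(1,4)]])
    show "far_asymptotic k (\<lambda>x. (E\<^sub>1 x - E\<^sub>2 x) $ m) (\<lambda>_. 0)" for m
      using far_asymptotic_diff[OF fE[of m]] by simp
  qed
  then have eqE: "AE x in lebesgue. E\<^sub>2 x = E\<^sub>1 x" by eventually_elim simp
  have "AE x in lebesgue. H\<^sub>1 x - H\<^sub>2 x = 0"
  proof (rule zero[OF lH maxwell_imp_helm[OF lH lE cH cE ab(2,3)]])
    show "far_asymptotic k (\<lambda>x. (H\<^sub>1 x - H\<^sub>2 x) $ m) (\<lambda>_. 0)" for m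
      using far_asymptotic_diff[OF fH[of m]] by simp
  qed
  then have eqH: "AE x in lebesgue. H\<^sub>2 x = H\<^sub>1 x" by eventually_elim simp
  have eqE': "AE x in lebesgue. \<beta> *s E\<^sub>2 x = \<beta> *s E\<^sub>1 x" using eqE by eventually_elim simp
  have eqH': "AE x in lebesgue. \<alpha> *s H\<^sub>2 x = \<alpha> *s H\<^sub>1 x" using eqH by eventually_elim simp
  \<comment> \<open>Weak equations do not see null sets, so the first solution inherits the
    equations off the second screen. With its own equations off the first screen, this is the
    situation of the removal statement.\<close>
  have c2E: "wcurl (- S\<^sub>2) E\<^sub>1 (\<lambda>x. \<alpha> *s H\<^sub>1 x)"
    by (rule wcurl_cong_AE[OF m2(3) m2(1) loc_L2_scale[OF m2(2)] m1(1) loc_L2_scale[OF m1(2)] eqE eqH'])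
  have c2H: "wcurl (- S\<^sub>2) H\<^sub>1 (\<lambda>x. \<beta> *s E\<^sub>1 x)"
    by (rule wcurl_cong_AE[OF m2(4) m2(2) loc_L2_scale[OF m2(1)] m1(2) loc_L2_scale[OF m1(1)] eqH eqE'])
  have gE: "wcurl UNIV E\<^sub>1 (\<lambda>x. \<alpha> *s H\<^sub>1 x)"
    by (rule wcurl_remove_intersection[OF m1(1) loc_L2_scale[OF m1(2)] m1(3) c2E
          s1(3)[unfolded s1(1)] s2(3)[unfolded s2(1)] s1(2) s2(2) ne[unfolded s1(1) s2(1)]])
  have gH: "wcurl UNIV H\<^sub>1 (\<lambda>x. \<beta> *s E\<^sub>1 x)"
    by (rule wcurl_remove_intersection[OF m1(2) loc_L2_scale[OF m1(1)] m1(4) c2H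
          s1(3)[unfolded s1(1)] s2(3)[unfolded s2(1)] s1(2) s2(2) ne[unfolded s1(1) s2(1)]])
  have cont: "continuous_on (sphere 0 1) (\<lambda>d. Einf d $ m)" "continuous_on (sphere 0 1) (\<lambda>d. Hinf d $ m)" for m
    using assms(10) unfolding far_field_def by (auto intro!: continuous_intros)
  \<comment> \<open>Entire outgoing components vanish almost everywhere; continuity of the patterns
    turns this into vanishing in every single direction.\<close>
  have "Einf d $ m = 0" "Hinf d $ m = 0" if d: "d \<in> sphere 0 1" for d m
  proof -
    have "AE x in lebesgue. E\<^sub>1 x $ m = 0"
      by (rule helm_entire_outgoing[OF k loc_L2_component[OF m1(1)] maxwell_imp_helm[OF m1(1,2) gE gH ab(1,4)] cont(1) fE(1)])
    from far_asymptotic_zero[OF fE(1) this cont(1) d] show "Einf d $ m = 0" .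
    have "AE x in lebesgue. H\<^sub>1 x $ m = 0"
      by (rule helm_entire_outgoing[OF k loc_L2_component[OF m1(2)] maxwell_imp_helm[OF m1(2,1) gH gE ab(2,3)] cont(2) fH(1)])
    from far_asymptotic_zero[OF fH(1) this cont(2) d] show "Hinf d $ m = 0" .
  qed
  then show False using assms(12) by (auto simp: vec_eq_iff)
qed

end
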